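(* (Post-composition rule.) Let $F$ be a natural bundle on $\mathcal{M}f_n$, $M$ an $n$-dimensional manifold, $P$ a principal $G$-bundle over $M$, $N,N'$ manifolds with smooth left $G$-actions, $f\colon N\to N'$ a $G$-equivariant map, and $\omega'\colon TN'\to V'$ a $G$-equivariant $1$-form with values in a $G$-module $V'$. Then for every fiber bundle map $h\colon F(M)\to P\times_GN$ over $M$ and every $G$-invariant vector field $\widetilde X$ on $P$ $$\pounds^{\omega'}_{\widetilde X}\big((\mathrm{id}\times_Gf)\circ h\big)=\pounds^{f^*\omega'}_{\widetilde X}h .$$
   Context: All manifolds and maps are smooth. $\Phi^t_X$ denotes the (local) flow of a vector field $X$, defined at time $t$ on the open set $U^X_t$. Natural bundles. $\mathcal{M}f_n$ is the category of $n$-dimensional manifolds with local diffeomorphisms as morphisms. A natural bundle on $\mathcal{M}f_n$ is a functor $F$ from $\mathcal{M}f_n$ to smooth manifolds together with a natural transformation $p_M\colon F(M)\to M$ such that each $p_M$ is a fiber bundle and, for each morphism $f\colon M\to M'$, $F(f)$ covers $f$ and is a fiberwise diffeomorphism. For a vector field $X$ on $M$, its canonical lift $\mathcal F(X)$ is the unique vector field on $F(M)$ whose flow satisfies $U^{\mathcal F(X)}_t=\mathrm{Im}\,F(\iota_t)$ and $\Phi^t_{\mathcal F(X)}\circ F(\iota_t)=F(\iota_{-t})\circ F(\Phi^t_X)$, where $\iota_t\colon U^X_t\hookrightarrow M$ is the inclusion and $\Phi^t_X\colon U^X_t\to U^X_{-t}$. Associated bundles. For a manifold $N$ with left $G$-action,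 $P\times_G N=(P\times N)/G$ for the action $(p,y)g=(pg,g^{-1}y)$; classes are written $[p,y]$. For a $G$-equivariant map $f\colon N\to N'$, $\mathrm{id}\times_Gf\colon P\times_GN\to P\times_GN'$ is $[p,y]\mapsto[p,f(y)]$. The pullback is $f^*\omega'=\omega'\circ Tf\colon TN\to V'$. Darboux-Lie derivative. Let $\omega\colon TN\to V$ be a $G$-equivariant $1$-form with values in a $G$-module, $\widetilde X$ a $G$-invariant vector field on $P$ over the vector field $X$ on $M$, and $\widetilde X_N$ the vector field on $P\times_GN$ with flow $[p,y]\mapsto[\Phi^t_{\widetilde X}p,y]$. For a bundle map $h\colon F(M)\to P\times_GN$ over $\mathrm{id}_M$, the vector $T_yh(\mathcal F(X)_y)-(\widetilde X_N)_{h(y)}$ is vertical, hence of the form $\left.\frac{d}{dt}\right|_0[p,\gamma(t)]$ with $p\in P$ fixed and $\gamma$ a curve in $N$; set $\pounds^\omega_{\widetilde X}h(y)=[p,\omega(\dot\gamma(0))]\in P\times_GV$. *)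

theory Defs
  imports "HOL-Analysis.Analysis" "HOL-Algebra.Group"
begin

section \<open>Smooth manifolds\<close>

text \<open>
  The model spaces are the library's \<^const>\<open>Euclidean_space\<close> \<open>n\<close>: functions \<open>nat \<Rightarrow> real\<close> vanishing
  from \<open>n\<close> on, with the product topology. So dimensions are natural numbers, and dimension 0
  (discrete groups, finite fibres) is included. In \<open>Ck_on k m U f\<close> the set \<open>U\<close> is meant to be open
  in \<open>Euclidean_space m\<close>.
\<close>

primrec Ck_on :: "nat \<Rightarrow> nat \<Rightarrow> (nat \<Rightarrow> real) set \<Rightarrow> ((nat \<Rightarrow> real) \<Rightarrow> real) \<Rightarrow> bool" where
  "Ck_on 0 m U f \<longleftrightarrow> continuous_map (subtopology (Euclidean_space m) U) euclideanreal f"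
| "Ck_on (Suc k) m U f \<longleftrightarrow>
     continuous_map (subtopology (Euclidean_space m) U) euclideanreal f \<and>
     (\<forall>i<m. \<exists>g. Ck_on k m U g \<and>
        (\<forall>x\<in>U. ((\<lambda>s. f (x(i := s))) has_real_derivative g x) (at (x i))))"

definition smooth_on :: "nat \<Rightarrow> (nat \<Rightarrow> real) set \<Rightarrow> nat \<Rightarrow> ((nat \<Rightarrow> real) \<Rightarrow> nat \<Rightarrow> real) \<Rightarrow> bool" where
  "smooth_on m U n f \<longleftrightarrow> (\<forall>i<n. \<forall>k. Ck_on k m U (\<lambda>x. f x i))"

text \<open>
  A chart is a pair of its domain and the chart map; values of the chart map outside the domain are
  irrelevant. The atlas is not required to be maximal: two atlases define the same smooth structure
  iff the identity is a diffeomorphism in the sense of \<open>diffeo\<close> below.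
\<close>

record 'a mfd =
  mtop :: "'a topology"
  mdim :: nat
  atlas :: "('a set \<times> ('a \<Rightarrow> nat \<Rightarrow> real)) set"

abbreviation points :: "'a mfd \<Rightarrow> 'a set" where
  "points M \<equiv> topspace (mtop M)"

definition manifold :: "'a mfd \<Rightarrow> bool" where
  "manifold M \<longleftrightarrow>
     Hausdorff_space (mtop M) \<and> second_countable (mtop M) \<and>
     (\<forall>(U, c) \<in> atlas M. openin (mtop M) U \<and> openin (Euclidean_space (mdim M)) (c ` U) \<and>
        homeomorphic_map (subtopology (mtop M) U)
          (subtopology (Euclidean_space (mdim M)) (c ` U)) c) \<and>
     (\<Union>(U, c) \<in> atlas M. U) = points M \<and>
     (\<forall>(U, c) \<in> atlas M. \<forall>(V, d) \<in> atlas M.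
        smooth_on (mdim M) (c ` (U \<inter> V)) (mdim M) (d \<circ> inv_into U c))"

definition smooth_map :: "'a mfd \<Rightarrow> 'b mfd \<Rightarrow> ('a \<Rightarrow> 'b) \<Rightarrow> bool" where
  "smooth_map M N f \<longleftrightarrow>
     continuous_map (mtop M) (mtop N) f \<and>
     (\<forall>(U, c) \<in> atlas M. \<forall>(V, d) \<in> atlas N.
        smooth_on (mdim M) (c ` {x \<in> U. f x \<in> V}) (mdim N) (d \<circ> f \<circ> inv_into U c))"

definition diffeo :: "'a mfd \<Rightarrow> 'b mfd \<Rightarrow> ('a \<Rightarrow> 'b) \<Rightarrow> bool" where
  "diffeo M N f \<longleftrightarrow> smooth_map M N f \<and>
     (\<exists>g. smooth_map N M g \<and> (\<forall>x\<in>points M. g (f x) = x) \<and> (\<forall>y\<in>points N. f (g y) = y))"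

definition submfd :: "'a mfd \<Rightarrow> 'a set \<Rightarrow> 'a mfd" where
  "submfd M U = \<lparr>mtop = subtopology (mtop M) U, mdim = mdim M,
     atlas = {(V \<inter> U, c) | V c. (V, c) \<in> atlas M}\<rparr>"

definition coord_join :: "nat \<Rightarrow> (nat \<Rightarrow> real) \<Rightarrow> (nat \<Rightarrow> real) \<Rightarrow> nat \<Rightarrow> real" where
  "coord_join m u v = (\<lambda>i. if i < m then u i else v (i - m))"

definition prod_mfd :: "'a mfd \<Rightarrow> 'b mfd \<Rightarrow> ('a \<times> 'b) mfd" where
  "prod_mfd M N = \<lparr>mtop = prod_topology (mtop M) (mtop N), mdim = mdim M + mdim N,
     atlas = {(U \<times> V, \<lambda>(x, y). coord_join (mdim M) (c x) (d y)) | U c V d.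
                (U, c) \<in> atlas M \<and> (V, d) \<in> atlas N}\<rparr>"

definition real_mfd :: "real mfd" where
  "real_mfd = \<lparr>mtop = euclideanreal, mdim = 1, atlas = {(UNIV, \<lambda>t i. if i = 0 then t else 0)}\<rparr>"

definition local_diffeo :: "'a mfd \<Rightarrow> 'b mfd \<Rightarrow> ('a \<Rightarrow> 'b) \<Rightarrow> bool" where
  "local_diffeo M N f \<longleftrightarrow>
     (\<forall>x\<in>points M. \<exists>U. openin (mtop M) U \<and> x \<in> U \<and> openin (mtop N) (f ` U) \<and>
        diffeo (submfd M U) (submfd N (f ` U)) f)"


section \<open>Tangent vectors, vector fields and flows\<close>

text \<open>
  The velocity of a curve is the directional derivative operator it induces on germs of smooth
  functions, and a tangent vector at \<open>x\<close> is the velocity of a smooth curve through \<open>x\<close>. The vector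
  space structure of the tangent space is the pointwise one. Operators are set to 0 on functions
  that are not smooth near the base point, so that equality of tangent vectors is equality of
  functions. The base point is not part of the vector and is always passed separately.
\<close>

type_synonym 'a tvec = "('a \<Rightarrow> real) \<Rightarrow> real"

definition smooth_near :: "'a mfd \<Rightarrow> 'a \<Rightarrow> ('a \<Rightarrow> real) \<Rightarrow> bool" where
  "smooth_near M x \<phi> \<longleftrightarrow>
     (\<exists>U. openin (mtop M) U \<and> x \<in> U \<and> smooth_map (submfd M U) real_mfd \<phi>)"

definition velocity :: "'a mfd \<Rightarrow> (real \<Rightarrow> 'a) \<Rightarrow> real \<Rightarrow> 'a tvec" where
  "velocity M \<gamma> t = (\<lambda>\<phi>. if smooth_near M (\<gamma> t) \<phi> then deriv (\<lambda>s. \<phi> (\<gamma> s)) t else 0)"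

definition curve_germ :: "'a mfd \<Rightarrow> (real \<Rightarrow> 'a) \<Rightarrow> bool" where
  "curve_germ M \<gamma> \<longleftrightarrow> (\<exists>\<epsilon>>0. smooth_map (submfd real_mfd {-\<epsilon><..<\<epsilon>}) M \<gamma>)"

definition tangent_space :: "'a mfd \<Rightarrow> 'a \<Rightarrow> 'a tvec set" where
  "tangent_space M x = {velocity M \<gamma> 0 | \<gamma>. curve_germ M \<gamma> \<and> \<gamma> 0 = x}"

text \<open>\<open>tmap N f x\<close> is the tangent map at \<open>x\<close> of a map \<open>f\<close> with codomain \<open>N\<close>.\<close>

definition tmap :: "'b mfd \<Rightarrow> ('a \<Rightarrow> 'b) \<Rightarrow> 'a \<Rightarrow> 'a tvec \<Rightarrow> 'b tvec" where
  "tmap N f x v = (\<lambda>\<phi>. if smooth_near N (f x) \<phi> then v (\<phi> \<circ> f) else 0)"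

definition vector_field_on :: "'a mfd \<Rightarrow> 'a set \<Rightarrow> ('a \<Rightarrow> 'a tvec) \<Rightarrow> bool" where
  "vector_field_on M U X \<longleftrightarrow>
     (\<forall>x\<in>U. X x \<in> tangent_space M x) \<and>
     (\<forall>W \<phi>. openin (mtop M) W \<and> W \<subseteq> U \<and> smooth_map (submfd M W) real_mfd \<phi> \<longrightarrow>
        smooth_map (submfd M W) real_mfd (\<lambda>x. X x \<phi>))"

abbreviation vector_field :: "'a mfd \<Rightarrow> ('a \<Rightarrow> 'a tvec) \<Rightarrow> bool" where
  "vector_field M X \<equiv> vector_field_on M (points M) X"

definition integral_curve :: "'a mfd \<Rightarrow> ('a \<Rightarrow> 'a tvec) \<Rightarrow> real set \<Rightarrow> (real \<Rightarrow> 'a) \<Rightarrow> bool" where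
  "integral_curve M X I \<gamma> \<longleftrightarrow>
     open I \<and> is_interval I \<and> 0 \<in> I \<and> smooth_map (submfd real_mfd I) M \<gamma> \<and>
     (\<forall>t\<in>I. velocity M \<gamma> t = X (\<gamma> t))"

definition flow_dom :: "'a mfd \<Rightarrow> ('a \<Rightarrow> 'a tvec) \<Rightarrow> real \<Rightarrow> 'a set" where
  "flow_dom M X t = {x. \<exists>I \<gamma>. integral_curve M X I \<gamma> \<and> t \<in> I \<and> \<gamma> 0 = x}"

definition flow :: "'a mfd \<Rightarrow> ('a \<Rightarrow> 'a tvec) \<Rightarrow> real \<Rightarrow> 'a \<Rightarrow> 'a" where
  "flow M X t x = (THE y. \<exists>I \<gamma>. integral_curve M X I \<gamma> \<and> t \<in> I \<and> \<gamma> 0 = x \<and> \<gamma> t = y)"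


section \<open>Fiber bundles and natural bundles\<close>

definition local_triv ::
  "'e mfd \<Rightarrow> ('e \<Rightarrow> 'm) \<Rightarrow> 'm mfd \<Rightarrow> 's mfd \<Rightarrow> 'm set \<Rightarrow> ('e \<Rightarrow> 'm \<times> 's) \<Rightarrow> bool" where
  "local_triv E p M S U \<psi> \<longleftrightarrow>
     openin (mtop M) U \<and>
     diffeo (submfd E {e \<in> points E. p e \<in> U}) (prod_mfd (submfd M U) S) \<psi> \<and>
     (\<forall>e\<in>points E. p e \<in> U \<longrightarrow> fst (\<psi> e) = p e)"

text \<open>
  The standard fiber may be taken to live on the type of the total space, since it is diffeomorphic
  to an actual fiber.
\<close>

definition fiber_bundle :: "'e mfd \<Rightarrow> ('e \<Rightarrow> 'm) \<Rightarrow> 'm mfd \<Rightarrow> bool" where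
  "fiber_bundle E p M \<longleftrightarrow>
     manifold E \<and> manifold M \<and> smooth_map E M p \<and>
     (\<exists>S :: 'e mfd. manifold S \<and> (\<forall>x\<in>points M. \<exists>U \<psi>. x \<in> U \<and> local_triv E p M S U \<psi>))"

text \<open>
  The objects of the category are the \<open>n\<close>-dimensional manifolds whose points form a subset of the
  (arbitrary) type \<open>'m\<close>; this includes all open submanifolds of its objects. Morphisms are total HOL
  functions that matter on the source manifold only, whence the condition that \<open>fb_mor\<close> respects
  agreement on the source.
\<close>

record ('m, 'f) bundle_functor =
  fb_obj :: "'m mfd \<Rightarrow> 'f mfd"
  fb_mor :: "'m mfd \<Rightarrow> 'm mfd \<Rightarrow> ('m \<Rightarrow> 'm) \<Rightarrow> 'f \<Rightarrow> 'f"
  fb_proj :: "'m mfd \<Rightarrow> 'f \<Rightarrow> 'm"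

definition Mf :: "nat \<Rightarrow> 'm mfd set" where
  "Mf n = {M. manifold M \<and> mdim M = n}"

definition fiberwise_diffeo ::
  "'e mfd \<Rightarrow> ('e \<Rightarrow> 'm) \<Rightarrow> 'm mfd \<Rightarrow> 'd mfd \<Rightarrow> ('d \<Rightarrow> 'n) \<Rightarrow> 'n mfd \<Rightarrow> ('m \<Rightarrow> 'n) \<Rightarrow> ('e \<Rightarrow> 'd) \<Rightarrow> bool" where
  "fiberwise_diffeo E p M E' p' M' f h \<longleftrightarrow>
     (\<forall>x\<in>points M. \<forall>(S :: 'e mfd) (S' :: 'd mfd) U \<psi> U' \<psi>'.
        manifold S \<and> manifold S' \<and>
        x \<in> U \<and> local_triv E p M S U \<psi> \<and> f x \<in> U' \<and> local_triv E' p' M' S' U' \<psi>' \<longrightarrow>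
        diffeo S S' (\<lambda>s. snd (\<psi>' (h (inv_into {e \<in> points E. p e \<in> U} \<psi> (x, s))))))"

definition natural_bundle :: "nat \<Rightarrow> ('m, 'f) bundle_functor \<Rightarrow> bool" where
  "natural_bundle n F \<longleftrightarrow>
     (\<forall>M\<in>Mf n. fiber_bundle (fb_obj F M) (fb_proj F M) M) \<and>
     (\<forall>M\<in>Mf n. \<forall>M'\<in>Mf n. \<forall>f. local_diffeo M M' f \<longrightarrow>
        smooth_map (fb_obj F M) (fb_obj F M') (fb_mor F M M' f) \<and>
        (\<forall>e\<in>points (fb_obj F M). fb_proj F M' (fb_mor F M M' f e) = f (fb_proj F M e)) \<and>
        fiberwise_diffeo (fb_obj F M) (fb_proj F M) M (fb_obj F M') (fb_proj F M') M' f
          (fb_mor F M M' f)) \<and>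
     (\<forall>M\<in>Mf n. \<forall>e\<in>points (fb_obj F M). fb_mor F M M (\<lambda>x. x) e = e) \<and>
     (\<forall>M\<in>Mf n. \<forall>M'\<in>Mf n. \<forall>M''\<in>Mf n. \<forall>f g. local_diffeo M M' f \<and> local_diffeo M' M'' g \<longrightarrow>
        (\<forall>e\<in>points (fb_obj F M).
           fb_mor F M M'' (g \<circ> f) e = fb_mor F M' M'' g (fb_mor F M M' f e))) \<and>
     (\<forall>M\<in>Mf n. \<forall>M'\<in>Mf n. \<forall>f g. local_diffeo M M' f \<and> (\<forall>x\<in>points M. f x = g x) \<longrightarrow>
        (\<forall>e\<in>points (fb_obj F M). fb_mor F M M' f e = fb_mor F M M' g e))"

text \<open>Here \<open>U t\<close> is the domain of the flow of \<open>X\<close> at time \<open>t\<close>, as an open submanifold of \<open>M\<close>.\<close>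

definition is_canonical_lift ::
  "('m, 'f) bundle_functor \<Rightarrow> 'm mfd \<Rightarrow> ('m \<Rightarrow> 'm tvec) \<Rightarrow> ('f \<Rightarrow> 'f tvec) \<Rightarrow> bool" where
  "is_canonical_lift F M X Y \<longleftrightarrow>
     (let U = (\<lambda>t. submfd M (flow_dom M X t)) in
       vector_field (fb_obj F M) Y \<and>
       (\<forall>t. flow_dom (fb_obj F M) Y t =
              fb_mor F (U t) M (\<lambda>x. x) ` points (fb_obj F (U t)) \<and>
            (\<forall>w\<in>points (fb_obj F (U t)).
               flow (fb_obj F M) Y t (fb_mor F (U t) M (\<lambda>x. x) w) =
               fb_mor F (U (-t)) M (\<lambda>x. x) (fb_mor F (U t) (U (-t)) (flow M X t) w))))"

definition canonical_lift ::
  "('m, 'f) bundle_functor \<Rightarrow> 'm mfd \<Rightarrow> ('m \<Rightarrow> 'm tvec) \<Rightarrow> 'f \<Rightarrow> 'f tvec" where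
  "canonical_lift F M X =
     (THE Y. Y \<in> extensional (points (fb_obj F M)) \<and> is_canonical_lift F M X Y)"


section \<open>Lie groups, actions, principal bundles, associated bundles\<close>

record 'g lie_group = "'g monoid" +
  grp_mfd :: "'g mfd"

definition is_lie_group :: "'g lie_group \<Rightarrow> bool" where
  "is_lie_group G \<longleftrightarrow>
     group G \<and> manifold (grp_mfd G) \<and> points (grp_mfd G) = carrier G \<and>
     smooth_map (prod_mfd (grp_mfd G) (grp_mfd G)) (grp_mfd G) (\<lambda>(a, b). a \<otimes>\<^bsub>G\<^esub> b) \<and>
     smooth_map (grp_mfd G) (grp_mfd G) (\<lambda>a. inv\<^bsub>G\<^esub> a)"

definition left_action :: "'g lie_group \<Rightarrow> 'n mfd \<Rightarrow> ('g \<Rightarrow> 'n \<Rightarrow> 'n) \<Rightarrow> bool" where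
  "left_action G N l \<longleftrightarrow>
     smooth_map (prod_mfd (grp_mfd G) N) N (\<lambda>(a, y). l a y) \<and>
     (\<forall>y\<in>points N. l \<one>\<^bsub>G\<^esub> y = y) \<and>
     (\<forall>a\<in>carrier G. \<forall>b\<in>carrier G. \<forall>y\<in>points N. l (a \<otimes>\<^bsub>G\<^esub> b) y = l a (l b y))"

text \<open>
  A finite-dimensional real vector space is given as a linear subspace \<open>V\<close> of a Euclidean space, so
  that the zero space is included. Smoothness of the representation is smoothness of its matrix
  coefficients.
\<close>

definition g_module :: "'g lie_group \<Rightarrow> 'v::euclidean_space set \<Rightarrow> ('g \<Rightarrow> 'v \<Rightarrow> 'v) \<Rightarrow> bool" where
  "g_module G V \<rho> \<longleftrightarrow>
     subspace V \<and>
     (\<forall>a\<in>carrier G. \<forall>u\<in>V. \<rho> a u \<in> V) \<and>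
     (\<forall>a\<in>carrier G. \<forall>u\<in>V. \<forall>v\<in>V. \<forall>r s. \<rho> a (r *\<^sub>R u + s *\<^sub>R v) = r *\<^sub>R \<rho> a u + s *\<^sub>R \<rho> a v) \<and>
     (\<forall>u\<in>V. \<rho> \<one>\<^bsub>G\<^esub> u = u) \<and>
     (\<forall>a\<in>carrier G. \<forall>b\<in>carrier G. \<forall>u\<in>V. \<rho> (a \<otimes>\<^bsub>G\<^esub> b) u = \<rho> a (\<rho> b u)) \<and>
     (\<forall>u\<in>V. \<forall>b\<in>Basis. smooth_map (grp_mfd G) real_mfd (\<lambda>a. \<rho> a u \<bullet> b))"

text \<open>
  Since a tangent vector does not record its base point, a map \<open>TN \<rightarrow> V\<close> is a function of a point
  and a tangent vector at it.
\<close>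

definition one_form :: "'n mfd \<Rightarrow> 'v::euclidean_space set \<Rightarrow> ('n \<Rightarrow> 'n tvec \<Rightarrow> 'v) \<Rightarrow> bool" where
  "one_form N V \<omega> \<longleftrightarrow>
     (\<forall>y\<in>points N. \<forall>u\<in>tangent_space N y. \<omega> y u \<in> V) \<and>
     (\<forall>y\<in>points N. \<forall>u\<in>tangent_space N y. \<forall>v\<in>tangent_space N y. \<forall>r s.
        \<omega> y (\<lambda>\<phi>. r * u \<phi> + s * v \<phi>) = r *\<^sub>R \<omega> y u + s *\<^sub>R \<omega> y v) \<and>
     (\<forall>U Y. openin (mtop N) U \<and> vector_field_on N U Y \<longrightarrow>
        (\<forall>b\<in>Basis. smooth_map (submfd N U) real_mfd (\<lambda>y. \<omega> y (Y y) \<bullet> b)))"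

definition equivariant_form ::
  "'g lie_group \<Rightarrow> 'n mfd \<Rightarrow> ('g \<Rightarrow> 'n \<Rightarrow> 'n) \<Rightarrow> ('g \<Rightarrow> 'v \<Rightarrow> 'v) \<Rightarrow>
   ('n \<Rightarrow> 'n tvec \<Rightarrow> 'v::euclidean_space) \<Rightarrow> bool" where
  "equivariant_form G N l \<rho> \<omega> \<longleftrightarrow>
     (\<forall>a\<in>carrier G. \<forall>y\<in>points N. \<forall>u\<in>tangent_space N y.
        \<omega> (l a y) (tmap N (l a) y u) = \<rho> a (\<omega> y u))"

definition pullback_form ::
  "'b mfd \<Rightarrow> ('a \<Rightarrow> 'b) \<Rightarrow> ('b \<Rightarrow> 'b tvec \<Rightarrow> 'v) \<Rightarrow> 'a \<Rightarrow> 'a tvec \<Rightarrow> 'v" where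
  "pullback_form N f \<omega> = (\<lambda>y u. \<omega> (f y) (tmap N f y u))"

record ('p, 'm, 'g) principal_bundle =
  pb_total :: "'p mfd"
  pb_base :: "'m mfd"
  pb_group :: "'g lie_group"
  pb_proj :: "'p \<Rightarrow> 'm"
  pb_act :: "'p \<Rightarrow> 'g \<Rightarrow> 'p"

definition equivariant_triv ::
  "('p, 'm, 'g) principal_bundle \<Rightarrow> 'm set \<Rightarrow> ('p \<Rightarrow> 'm \<times> 'g) \<Rightarrow> bool" where
  "equivariant_triv B U \<psi> \<longleftrightarrow>
     local_triv (pb_total B) (pb_proj B) (pb_base B) (grp_mfd (pb_group B)) U \<psi> \<and>
     (\<forall>p\<in>points (pb_total B). \<forall>a\<in>carrier (pb_group B). pb_proj B p \<in> U \<longrightarrow>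
        snd (\<psi> (pb_act B p a)) = snd (\<psi> p) \<otimes>\<^bsub>pb_group B\<^esub> a)"

definition is_principal_bundle :: "('p, 'm, 'g) principal_bundle \<Rightarrow> bool" where
  "is_principal_bundle B \<longleftrightarrow>
     manifold (pb_total B) \<and> manifold (pb_base B) \<and> is_lie_group (pb_group B) \<and>
     smooth_map (pb_total B) (pb_base B) (pb_proj B) \<and>
     smooth_map (prod_mfd (pb_total B) (grp_mfd (pb_group B))) (pb_total B) (\<lambda>(p, a). pb_act B p a) \<and>
     (\<forall>p\<in>points (pb_total B). pb_act B p \<one>\<^bsub>pb_group B\<^esub> = p) \<and>
     (\<forall>p\<in>points (pb_total B). \<forall>a\<in>carrier (pb_group B). \<forall>b\<in>carrier (pb_group B).
        pb_act B p (a \<otimes>\<^bsub>pb_group B\<^esub> b) = pb_act B (pb_act B p a) b) \<and>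
     (\<forall>p\<in>points (pb_total B). \<forall>a\<in>carrier (pb_group B). pb_proj B (pb_act B p a) = pb_proj B p) \<and>
     (\<forall>x\<in>points (pb_base B). \<exists>U \<psi>. x \<in> U \<and> equivariant_triv B U \<psi>)"

text \<open>The class \<open>[p, y]\<close>, i.e. the orbit of \<open>(p, y)\<close> under \<open>(p, y) a = (p a, a\<^sup>-\<^sup>1 y)\<close>.\<close>

definition assoc_class ::
  "('p, 'm, 'g) principal_bundle \<Rightarrow> ('g \<Rightarrow> 'n \<Rightarrow> 'n) \<Rightarrow> 'p \<Rightarrow> 'n \<Rightarrow> ('p \<times> 'n) set" where
  "assoc_class B l p y =
     (\<lambda>a. (pb_act B p a, l (inv\<^bsub>pb_group B\<^esub> a) y)) ` carrier (pb_group B)"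

text \<open>
  The associated bundle carries the quotient topology; an equivariant trivialization \<open>\<psi>\<close> of the
  principal bundle over \<open>U\<close> identifies the part over \<open>U\<close> with \<open>U \<times> N\<close> by
  \<open>[p, y] \<mapsto> (\<pi> p, snd (\<psi> p) y)\<close>, and the charts are the product charts read through these
  identifications. The value of a chart does not depend on the chosen representative.
\<close>

definition assoc_space ::
  "('p, 'm, 'g) principal_bundle \<Rightarrow> 'n mfd \<Rightarrow> ('g \<Rightarrow> 'n \<Rightarrow> 'n) \<Rightarrow> ('p \<times> 'n) set set" where
  "assoc_space B N l = {assoc_class B l p y | p y. p \<in> points (pb_total B) \<and> y \<in> points N}"

definition assoc_mfd ::
  "('p, 'm, 'g) principal_bundle \<Rightarrow> 'n mfd \<Rightarrow> ('g \<Rightarrow> 'n \<Rightarrow> 'n) \<Rightarrow> ('p \<times> 'n) set mfd" where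
  "assoc_mfd B N l =
     \<lparr>mtop = topology (\<lambda>W. W \<subseteq> assoc_space B N l \<and>
        openin (prod_topology (mtop (pb_total B)) (mtop N))
          {(p, y). p \<in> points (pb_total B) \<and> y \<in> points N \<and> assoc_class B l p y \<in> W}),
      mdim = mdim (pb_base B) + mdim N,
      atlas =
        {({assoc_class B l p y | p y. p \<in> points (pb_total B) \<and> pb_proj B p \<in> U \<inter> V \<and>
             y \<in> points N \<and> l (snd (\<psi> p)) y \<in> W},
          \<lambda>z. case SOME q. q \<in> z of
            (p, y) \<Rightarrow> coord_join (mdim (pb_base B)) (c (pb_proj B p)) (d (l (snd (\<psi> p)) y)))
         | U \<psi> V c W d.
            equivariant_triv B U \<psi> \<and> (V, c) \<in> atlas (pb_base B) \<and> (W, d) \<in> atlas N}\<rparr>"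

definition assoc_proj :: "('p, 'm, 'g) principal_bundle \<Rightarrow> ('p \<times> 'n) set \<Rightarrow> 'm" where
  "assoc_proj B z = the_elem ((\<lambda>(p, y). pb_proj B p) ` z)"

text \<open>
  \<open>id \<times>\<^sub>G f\<close>: for equivariant \<open>f\<close>, the image of the set \<open>[p, y]\<close> under \<open>(p, y) \<mapsto> (p, f y)\<close> is
  \<open>[p, f y]\<close>.
\<close>

definition assoc_map :: "('n \<Rightarrow> 'k) \<Rightarrow> ('p \<times> 'n) set \<Rightarrow> ('p \<times> 'k) set" where
  "assoc_map f z = (\<lambda>(p, y). (p, f y)) ` z"

definition invariant_vector_field ::
  "('p, 'm, 'g) principal_bundle \<Rightarrow> ('p \<Rightarrow> 'p tvec) \<Rightarrow> bool" where
  "invariant_vector_field B Xt \<longleftrightarrow>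
     vector_field (pb_total B) Xt \<and>
     (\<forall>p\<in>points (pb_total B). \<forall>a\<in>carrier (pb_group B).
        tmap (pb_total B) (\<lambda>q. pb_act B q a) p (Xt p) = Xt (pb_act B p a))"

text \<open>The vector field on the base over which an invariant vector field lies.\<close>

definition base_field :: "('p, 'm, 'g) principal_bundle \<Rightarrow> ('p \<Rightarrow> 'p tvec) \<Rightarrow> 'm \<Rightarrow> 'm tvec" where
  "base_field B Xt x =
     (THE v. \<exists>p\<in>points (pb_total B). pb_proj B p = x \<and> v = tmap (pb_base B) (pb_proj B) p (Xt p))"


section \<open>The Darboux-Lie derivative\<close>

text \<open>
  \<open>assoc_field_value B N l Xt z v\<close>: the vector field on the associated bundle with flow
  \<open>[p, y] \<mapsto> [\<Phi>\<^sup>t p, y]\<close>, \<open>\<Phi>\<close> being the flow of \<open>Xt\<close>, takes the value \<open>v\<close> at \<open>z\<close>. Here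
  \<open>c t = \<Phi>\<^sup>t p\<close> is the integral curve through \<open>p\<close>.
\<close>

definition assoc_field_value ::
  "('p, 'm, 'g) principal_bundle \<Rightarrow> 'n mfd \<Rightarrow> ('g \<Rightarrow> 'n \<Rightarrow> 'n) \<Rightarrow> ('p \<Rightarrow> 'p tvec) \<Rightarrow>
   ('p \<times> 'n) set \<Rightarrow> ('p \<times> 'n) set tvec \<Rightarrow> bool" where
  "assoc_field_value B N l Xt z v \<longleftrightarrow>
     (\<exists>p\<in>points (pb_total B). \<exists>y\<in>points N. \<exists>I c.
        z = assoc_class B l p y \<and> integral_curve (pb_total B) Xt I c \<and> c 0 = p \<and>
        v = velocity (assoc_mfd B N l) (\<lambda>t. assoc_class B l (c t) y) 0)"

text \<open>
  The vertical vector \<open>T h (\<F>(X)) - Xt\<^sub>N\<close> at \<open>h e\<close> is written as the velocity of \<open>t \<mapsto> [p, \<gamma> t]\<close>;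
  the value of the derivative is \<open>[p, \<omega> (\<gamma>' 0)]\<close>, a class of pairs in \<open>P \<times> V\<close>.
\<close>

definition darboux_lie ::
  "('m, 'f) bundle_functor \<Rightarrow> ('p, 'm, 'g) principal_bundle \<Rightarrow> 'n mfd \<Rightarrow> ('g \<Rightarrow> 'n \<Rightarrow> 'n) \<Rightarrow>
   ('g \<Rightarrow> 'v \<Rightarrow> 'v) \<Rightarrow> ('n \<Rightarrow> 'n tvec \<Rightarrow> 'v::euclidean_space) \<Rightarrow> ('p \<Rightarrow> 'p tvec) \<Rightarrow>
   ('f \<Rightarrow> ('p \<times> 'n) set) \<Rightarrow> 'f \<Rightarrow> ('p \<times> 'v) set" where
  "darboux_lie F B N l \<rho> \<omega> Xt h e =
     (THE r. \<exists>u v p \<gamma>.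
        u = canonical_lift F (pb_base B) (base_field B Xt) e \<and>
        u \<in> tangent_space (fb_obj F (pb_base B)) e \<and>
        assoc_field_value B N l Xt (h e) v \<and>
        p \<in> points (pb_total B) \<and> curve_germ N \<gamma> \<and> assoc_class B l p (\<gamma> 0) = h e \<and>
        (\<lambda>\<phi>. tmap (assoc_mfd B N l) h e u \<phi> - v \<phi>) =
          velocity (assoc_mfd B N l) (\<lambda>t. assoc_class B l p (\<gamma> t)) 0 \<and>
        r = assoc_class B \<rho> p (\<omega> (\<gamma> 0) (velocity N \<gamma> 0)))"

end

theory Submission
  imports Defs
begin

text \<open>
  Both sides read off the same vertical vector: since \<open>id \<times>\<^sub>G f\<close> maps \<open>[c t, y]\<close> to \<open>[c t, f y]\<close>, its
  tangent map sends \<open>T h (\<F> X) - Xt\<^sub>N\<close> to the corresponding vector for \<open>(id \<times>\<^sub>G f) \<circ> h\<close>, and the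
  velocity of \<open>[p, \<gamma> t]\<close> to that of \<open>[p, f (\<gamma> t)]\<close>. As the derivative is given by a definite description,
  three facts are needed: a value of the derivative of \<open>h\<close> is one of \<open>(id \<times>\<^sub>G f) \<circ> h\<close>; the latter is
  unique, because \<open>y \<mapsto> [p, y]\<close> is injective on tangent vectors and \<open>\<omega>'\<close> is equivariant; and if
  the latter exists, then so does the former, because verticality only concerns the projection to
  the base, which \<open>id \<times>\<^sub>G f\<close> preserves. In this form neither the existence of the canonical lift nor
  that of flows enters.
\<close>

section \<open>Calculus on open subsets of Euclidean space\<close>

text \<open>Points of the associated bundle are orbits, so smoothness on it is tested on
  \<open>E \<times> N\<close>: over a trivializing set the lifted trivialization
  \<open>triv_map\<close> and a section through the group unit invert each other up to orbits,
  whence a map of classes is smooth as soon as its composite with the quotient map is.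

  Tangent vectors are operators on test functions, with value 0 at functions not smooth near the
  base point. Equations between them are checked function by function, and pushing a vector forward
  requires that composites of test functions stay smooth; the chain rule for \<open>Ck_on\<close>
  provides this.

  The existence direction needs a construction: a difference of two velocities has to be the
  velocity of a curve \<open>[q, \<gamma> t]\<close>. In a bundle chart the coordinates split into
  base and fiber. The base part of the difference vanishes, as it can be computed after applying
  \<open>id \<times>\<^sub>G f\<close>; the fiber part is realized by a straight line in a chart of
  \<open>N\<close>. The given integral curve fixes its starting point \<open>q\<close>, so the
  representative of \<open>h e\<close> is first moved to \<open>q\<close>.\<close>

abbreviation espace :: "nat \<Rightarrow> (nat \<Rightarrow> real) set" where
  "espace m \<equiv> topspace (Euclidean_space m)"

lemma mem_espace: "x \<in> espace m \<longleftrightarrow> (\<forall>i\<ge>m. x i = 0)"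
  by (simp add: topspace_Euclidean_space)

lemma openin_Euclidean_space_open:
  "openin (Euclidean_space m) U \<longleftrightarrow> (\<exists>T. open T \<and> U = T \<inter> espace m)"
  by (simp add: Euclidean_space_def euclidean_product_topology openin_subtopology)

lemma openin_Euclidean_space_subset: "openin (Euclidean_space m) U \<Longrightarrow> U \<subseteq> espace m"
  by (rule openin_subset)

lemma continuous_map_Euclidean_subtopology:
  assumes "U \<subseteq> espace m"
  shows "continuous_map (subtopology (Euclidean_space m) U) euclideanreal f \<longleftrightarrow> continuous_on U f"
proof -
  have "{x. \<forall>i\<ge>m. x i = 0} \<inter> U = U"
    using assms by (auto simp: topspace_Euclidean_space)
  then have "subtopology (Euclidean_space m) U = top_of_set U"
    by (simp add: Euclidean_space_def euclidean_product_topology subtopology_subtopology)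
  then show ?thesis
    by simp
qed

text \<open>A basic open set of the product topology restricts only finitely many coordinates, so
  one radius can serve for all of them.\<close>

lemma open_fun_box:
  fixes x :: "nat \<Rightarrow> real"
  assumes "open T" "x \<in> T"
  obtains e where "e > 0" "\<And>y. (\<And>i. \<bar>y i - x i\<bar> < e) \<Longrightarrow> y \<in> T"
proof -
  have "openin (product_topology (\<lambda>i. euclideanreal) UNIV) T"
    using assms by (simp add: euclidean_product_topology)
  then obtain X where X: "finite {i. X i \<noteq> UNIV}" "\<And>i. open (X i)" "x \<in> PiE UNIV X" "PiE UNIV X \<subseteq> T"
    using assms(2) unfolding openin_product_topology_alt by auto
  have "\<exists>e>0. \<forall>t. \<bar>t - x i\<bar> < e \<longrightarrow> t \<in> X i" for i
  proof -
    have "x i \<in> X i" using X(3) by auto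
    then show ?thesis
      using X(2)[of i] unfolding open_dist dist_real_def by auto
  qed
  then obtain d where d: "\<And>i. d i > 0" "\<And>i t. \<bar>t - x i\<bar> < d i \<Longrightarrow> t \<in> X i"
    by metis
  \<comment> \<open>The inserted 1 keeps the minimum defined when no coordinate is
    restricted.\<close>
  define e where "e = Min (insert 1 (d ` {i. X i \<noteq> UNIV}))"
  show thesis
  proof
    show "e > 0" unfolding e_def using X(1) d(1) by (subst Min_gr_iff) auto
    fix y assume y: "\<And>i. \<bar>y i - x i\<bar> < e"
    have "y i \<in> X i" for i
    proof (cases "X i = UNIV")
      case False
      then have "e \<le> d i" unfolding e_def using X(1) by (intro Min_le) auto
      then show ?thesis using y[of i] d(2)[of "y i" i] by linarith
    qed auto
    then show "y \<in> T" using X(4) by auto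
  qed
qed

lemma openin_Euclidean_space_box:
  assumes "openin (Euclidean_space m) U" "x \<in> U"
  obtains e where "e > 0" "\<And>y. y \<in> espace m \<Longrightarrow> (\<And>i. i < m \<Longrightarrow> \<bar>y i - x i\<bar> < e) \<Longrightarrow> y \<in> U"
proof -
  obtain T where T: "open T" "U = T \<inter> espace m"
    using assms openin_Euclidean_space_open by blast
  then obtain e where e: "e > 0" "\<And>y. (\<And>i. \<bar>y i - x i\<bar> < e) \<Longrightarrow> y \<in> T"
    using open_fun_box assms(2) by blast
  show thesis
  proof
    show "e > 0" by fact
    fix y assume "y \<in> espace m" "\<And>i. i < m \<Longrightarrow> \<bar>y i - x i\<bar> < e"
    moreover have "x \<in> espace m" using assms T by auto
    ultimately have "\<bar>y i - x i\<bar> < e" for i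
      using e(1) by (cases "i < m") (auto simp: mem_espace)
    then show "y \<in> U" using e(2) T \<open>y \<in> espace m\<close> by blast
  qed
qed

lemma espace_upd: "x \<in> espace m \<Longrightarrow> i < m \<Longrightarrow> x(i := s) \<in> espace m"
  by (auto simp: mem_espace)

text \<open>Partial derivatives in \<open>Ck_on\<close> look at \<open>f (x(i := s))\<close> for all
  \<open>s\<close>, also where the point leaves \<open>U\<close>. This lemma reduces them to germs,
  so that only values of \<open>f\<close> on \<open>U\<close> matter.\<close>

lemma eventually_upd_mem:
  assumes "openin (Euclidean_space m) U" "x \<in> U" "i < m"
  shows "\<forall>\<^sub>F s in nhds (x i). x(i := s) \<in> U"
proof -
  obtain e where e: "e > 0" "\<And>y. y \<in> espace m \<Longrightarrow> (\<And>i. i < m \<Longrightarrow> \<bar>y i - x i\<bar> < e) \<Longrightarrow> y \<in> U"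
    using openin_Euclidean_space_box assms(1,2) by blast
  have "x \<in> espace m" using assms openin_Euclidean_space_subset by blast
  have "\<forall>\<^sub>F s in nhds (x i). dist s (x i) < e"
    using e(1) eventually_nhds_metric by blast
  then show ?thesis
  proof eventually_elim
    case (elim s)
    show ?case
      by (rule e(2)) (use elim e(1) espace_upd \<open>x \<in> espace m\<close> \<open>i < m\<close> in \<open>auto simp: dist_real_def\<close>)
  qed
qed

text \<open>A canonical choice for the existentially quantified partial derivative in
  \<open>Ck_on\<close>. Uniqueness of derivatives makes it agree with every witness on an open set,
  and a choice independent of the set is what allows local statements to be glued.\<close>

definition pderiv_at :: "nat \<Rightarrow> ((nat \<Rightarrow> real) \<Rightarrow> real) \<Rightarrow> (nat \<Rightarrow> real) \<Rightarrow> real" where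
  "pderiv_at i f x = deriv (\<lambda>s. f (x(i := s))) (x i)"

lemma Ck_on_imp_continuous_on:
  "Ck_on k m U f \<Longrightarrow> U \<subseteq> espace m \<Longrightarrow> continuous_on U f"
  by (cases k) (auto simp: continuous_map_Euclidean_subtopology)

lemma Ck_on_0: "U \<subseteq> espace m \<Longrightarrow> Ck_on 0 m U f \<longleftrightarrow> continuous_on U f"
  by (simp add: continuous_map_Euclidean_subtopology)

lemma Ck_on_cong_imp:
  assumes "openin (Euclidean_space m) U" "\<And>x. x \<in> U \<Longrightarrow> f x = g x" "Ck_on k m U f"
  shows "Ck_on k m U g"
proof -
  have sub: "U \<subseteq> espace m" using assms openin_Euclidean_space_subset by blast
  have c: "continuous_on U g"
    using Ck_on_imp_continuous_on[OF assms(3) sub] assms(2) continuous_on_cong by metis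
  show ?thesis
  proof (cases k)
    case 0 then show ?thesis using c sub Ck_on_0 by blast
  next
    case (Suc j)
    have "\<exists>h. Ck_on j m U h \<and> (\<forall>x\<in>U. ((\<lambda>s. g (x(i := s))) has_real_derivative h x) (at (x i)))"
      if i: "i < m" for i
    proof -
      obtain h where h: "Ck_on j m U h" "\<forall>x\<in>U. ((\<lambda>s. f (x(i := s))) has_real_derivative h x) (at (x i))"
        using assms(3) Suc i by auto
      have "((\<lambda>s. g (x(i := s))) has_real_derivative h x) (at (x i))" if "x \<in> U" for x
      proof -
        have "\<forall>\<^sub>F s in nhds (x i). f (x(i := s)) = g (x(i := s))"
          using eventually_upd_mem[OF assms(1) that i] by eventually_elim (rule assms(2))
        from DERIV_cong_ev[OF refl this refl, THEN iffD1] show ?thesis using h(2) that by blast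
      qed
      then show ?thesis using h(1) by blast
    qed
    then show ?thesis using Suc c sub by (simp add: continuous_map_Euclidean_subtopology)
  qed
qed

lemma Ck_on_subset: "Ck_on k m U f \<Longrightarrow> V \<subseteq> U \<Longrightarrow> Ck_on k m V f"
proof (induction k arbitrary: f)
  case 0
  then show ?case by (auto intro: continuous_map_from_subtopology_mono)
next
  case (Suc k)
  then show ?case by simp (metis continuous_map_from_subtopology_mono subsetD)
qed

lemma Ck_on_Suc_pderiv:
  assumes "openin (Euclidean_space m) U"
  shows "Ck_on (Suc k) m U f \<longleftrightarrow> continuous_on U f \<and>
    (\<forall>i<m. Ck_on k m U (pderiv_at i f) \<and>
      (\<forall>x\<in>U. ((\<lambda>s. f (x(i := s))) has_real_derivative pderiv_at i f x) (at (x i))))"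
    (is "?L \<longleftrightarrow> ?R")
proof
  have sub: "U \<subseteq> espace m" using assms openin_Euclidean_space_subset by blast
  show ?L if ?R
    using that sub by (auto simp: continuous_map_Euclidean_subtopology)
  show ?R if L: ?L
  proof (intro conjI allI impI)
    show "continuous_on U f" using L sub by (simp add: continuous_map_Euclidean_subtopology)
    fix i assume "i < m"
    then obtain h where h: "Ck_on k m U h" "\<forall>x\<in>U. ((\<lambda>s. f (x(i := s))) has_real_derivative h x) (at (x i))"
      using L by auto
    have eq: "h x = pderiv_at i f x" if "x \<in> U" for x
      unfolding pderiv_at_def using h(2) that DERIV_imp_deriv by metis
    show "Ck_on k m U (pderiv_at i f)" using Ck_on_cong_imp[OF assms eq h(1)] .
    show "\<forall>x\<in>U. ((\<lambda>s. f (x(i := s))) has_real_derivative pderiv_at i f x) (at (x i))"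
      using h(2) eq by auto
  qed
qed

lemma Ck_on_Suc_imp: "Ck_on (Suc k) m U f \<Longrightarrow> Ck_on k m U f"
proof (induction k arbitrary: f)
  case 0
  then show ?case by simp
next
  case (Suc k)
  have "\<exists>g. Ck_on k m U g \<and> (\<forall>x\<in>U. ((\<lambda>s. f (x(i := s))) has_real_derivative g x) (at (x i)))"
    if "i < m" for i
    using Suc.prems that Suc.IH unfolding Ck_on.simps(2)[of "Suc k"] by blast
  then show ?case using Suc.prems by simp
qed

text \<open>Induction on \<open>k\<close>: the global partial derivative is
  \<open>pderiv_at i f\<close>, the same function on every neighbourhood, so the local witnesses fit
  together. Openness of \<open>U\<close> follows from the neighbourhoods themselves.\<close>

lemma Ck_on_local:
  assumes "\<And>x. x \<in> U \<Longrightarrow> \<exists>V. openin (Euclidean_space m) V \<and> x \<in> V \<and> V \<subseteq> U \<and> Ck_on k m V f"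
  shows "Ck_on k m U f"
proof -
  have op: "openin (Euclidean_space m) U"
    by (subst openin_subopen) (use assms in blast)
  then have sub: "U \<subseteq> espace m" using openin_Euclidean_space_subset by blast
  show ?thesis using assms
  proof (induction k arbitrary: f)
    case 0
    have "continuous_on U f"
    proof (subst continuous_on_eq_continuous_within, rule ballI)
      fix x assume "x \<in> U"
      then obtain V where V: "openin (Euclidean_space m) V" "x \<in> V" "V \<subseteq> U" "Ck_on 0 m V f"
        using 0 by blast
      obtain T where T: "open T" "V = T \<inter> espace m"
        using V openin_Euclidean_space_open by blast
      have "continuous_on V f" using V sub Ck_on_0 by blast
      then have "continuous (at x within V) f" using V continuous_on_eq_continuous_within by blast
      moreover have "at x within V = at x within U"
        by (rule at_within_nhd[where S=T]) (use T V sub in auto)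
      ultimately show "continuous (at x within U) f" by (simp add: continuous_within)
    qed
    then show ?case using sub Ck_on_0 by blast
  next
    case (Suc k)
    have "Ck_on k m U f" using Suc.IH Suc.prems Ck_on_Suc_imp by meson
    then have "continuous_on U f" using Ck_on_imp_continuous_on sub by blast
    moreover have "Ck_on k m U (pderiv_at i f)" if "i < m" for i
      by (rule Suc.IH) (use Suc.prems Ck_on_Suc_pderiv that in meson)
    moreover have "((\<lambda>s. f (x(i := s))) has_real_derivative pderiv_at i f x) (at (x i))"
      if "i < m" "x \<in> U" for i x
      using Suc.prems[OF that(2)] Ck_on_Suc_pderiv that by meson
    ultimately show ?case using Ck_on_Suc_pderiv[OF op] by blast
  qed
qed

section \<open>Closure of the classes \<open>Ck_on\<close> under sums and products\<close>

lemma Ck_on_const: "Ck_on k m U (\<lambda>x. c)"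
proof (induction k arbitrary: c)
  case (Suc k)
  then show ?case by (auto intro!: exI[of _ "\<lambda>x. 0"])
qed auto

lemma Ck_on_coord:
  assumes "U \<subseteq> espace m"
  shows "Ck_on k m U (\<lambda>x. x j)"
proof -
  have c: "continuous_on U (\<lambda>x. x j)"
    by (intro continuous_intros continuous_on_product_coordinates continuous_on_subset[OF continuous_on_product_coordinates]) auto
  show ?thesis
  proof (cases k)
    case (Suc k)
    have "((\<lambda>s. (x(i := s)) j) has_real_derivative (if i = j then 1 else 0)) (at (x i))" for x i
      by auto
    then have "\<exists>g. Ck_on k m U g \<and> (\<forall>x\<in>U. ((\<lambda>s. (x(i := s)) j) has_real_derivative g x) (at (x i)))" for i
      using Ck_on_const by blast
    then show ?thesis
      unfolding Suc using c assms by (simp add: continuous_map_Euclidean_subtopology)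
  qed (use c assms Ck_on_0 in auto)
qed

lemma Ck_on_add: "Ck_on k m U f \<Longrightarrow> Ck_on k m U g \<Longrightarrow> Ck_on k m U (\<lambda>x. f x + g x)"
proof (induction k arbitrary: f g)
  case 0
  then show ?case by (auto intro: continuous_intros)
next
  case (Suc k)
  have "\<exists>h. Ck_on k m U h \<and> (\<forall>x\<in>U. ((\<lambda>s. f (x(i := s)) + g (x(i := s))) has_real_derivative h x) (at (x i)))"
    if "i < m" for i
  proof -
    obtain a where "Ck_on k m U a" "\<forall>x\<in>U. ((\<lambda>s. f (x(i := s))) has_real_derivative a x) (at (x i))"
      using Suc.prems(1) \<open>i < m\<close> by auto
    moreover obtain b where "Ck_on k m U b" "\<forall>x\<in>U. ((\<lambda>s. g (x(i := s))) has_real_derivative b x) (at (x i))"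
      using Suc.prems(2) \<open>i < m\<close> by auto
    ultimately show ?thesis
      by (intro exI[of _ "\<lambda>x. a x + b x"]) (auto intro!: Suc.IH derivative_intros)
  qed
  then show ?case using Suc.prems by (auto intro: continuous_intros)
qed

lemma Ck_on_mult: "Ck_on k m U f \<Longrightarrow> Ck_on k m U g \<Longrightarrow> Ck_on k m U (\<lambda>x. f x * g x)"
proof (induction k arbitrary: f g)
  case 0
  then show ?case by (auto intro: continuous_intros)
next
  case (Suc k)
  have "\<exists>h. Ck_on k m U h \<and> (\<forall>x\<in>U. ((\<lambda>s. f (x(i := s)) * g (x(i := s))) has_real_derivative h x) (at (x i)))"
    if "i < m" for i
  proof -
    obtain a where 1: "Ck_on k m U a" "\<forall>x\<in>U. ((\<lambda>s. f (x(i := s))) has_real_derivative a x) (at (x i))"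
      using Suc.prems(1) \<open>i < m\<close> by auto
    obtain b where 2: "Ck_on k m U b" "\<forall>x\<in>U. ((\<lambda>s. g (x(i := s))) has_real_derivative b x) (at (x i))"
      using Suc.prems(2) \<open>i < m\<close> by auto
    have "Ck_on k m U (\<lambda>x. a x * g x + b x * f x)"
      by (intro Ck_on_add Suc.IH 1 2 Suc.prems[THEN Ck_on_Suc_imp])
    moreover have "((\<lambda>s. f (x(i := s)) * g (x(i := s))) has_real_derivative a x * g x + b x * f x) (at (x i))"
      if "x \<in> U" for x
      using 1 2 DERIV_mult[of "\<lambda>s. f (x(i := s))" "a x" "x i" UNIV "\<lambda>s. g (x(i := s))" "b x"] that by simp
    ultimately show ?thesis by blast
  qed
  then show ?case using Suc.prems by (auto intro: continuous_intros)
qed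

lemma Ck_on_sum:
  assumes "finite J" "\<And>j. j \<in> J \<Longrightarrow> Ck_on k m U (f j)"
  shows "Ck_on k m U (\<lambda>x. \<Sum>j\<in>J. f j x)"
  using assms by (induction J) (auto intro: Ck_on_const Ck_on_add)

section \<open>Derivatives along curves and the chain rule\<close>

text \<open>The increment of \<open>f\<close> is telescoped over the coordinates and the mean value theorem is applied
  to each summand; this is where continuity of the partial derivatives enters.\<close>

lemma has_real_derivative_along_curve:
  fixes G :: "real \<Rightarrow> nat \<Rightarrow> real"
  assumes V: "openin (Euclidean_space n) V" and f: "Ck_on 1 n V f" and G0: "G s0 \<in> V"
    and G: "\<forall>\<^sub>F s in nhds s0. G s \<in> espace n"
    and D: "\<And>j. j < n \<Longrightarrow> ((\<lambda>s. G s j) has_real_derivative D j) (at s0)"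
  shows "((\<lambda>s. f (G s)) has_real_derivative (\<Sum>j<n. pderiv_at j f (G s0) * D j)) (at s0)"
proof -
  \<comment> \<open>\<open>z k s\<close> takes its first \<open>k\<close> coordinates from
    \<open>G s\<close> and the others from \<open>G s0\<close>, so consecutive points differ in
    coordinate \<open>k\<close> alone.\<close>
  define z where "z k s = (\<lambda>j. if j < k then G s j else G s0 j)" for k s
  obtain e where e: "e > 0" "\<And>y. y \<in> espace n \<Longrightarrow> (\<And>i. i < n \<Longrightarrow> \<bar>y i - G s0 i\<bar> < e) \<Longrightarrow> y \<in> V"
    using openin_Euclidean_space_box V G0 by blast
  have sub: "V \<subseteq> espace n" using V openin_Euclidean_space_subset by blast
  have G0E: "G s0 \<in> espace n" using G0 sub by auto
  have pd: "continuous_on V (pderiv_at i f)"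
    "\<And>x. x \<in> V \<Longrightarrow> ((\<lambda>s. f (x(i := s))) has_real_derivative pderiv_at i f x) (at (x i))"
    if "i < n" for i
    using f that Ck_on_Suc_pderiv[OF V, of 0 f] sub by (auto simp: continuous_map_Euclidean_subtopology)
  have near: "\<forall>\<^sub>F s in nhds s0. \<forall>j<n. \<bar>G s j - G s0 j\<bar> < d" if "d > 0" for d
  proof -
    have "\<forall>\<^sub>F s in nhds s0. dist (G s j) (G s0 j) < d" if "j < n" for j
    proof -
      have "((\<lambda>s. G s j) \<longlongrightarrow> G s0 j) (nhds s0)"
        using DERIV_isCont[OF D[OF that]] tendsto_at_iff_tendsto_nhds[of "\<lambda>s. G s j" s0]
        by (simp add: isCont_def)
      then show ?thesis using \<open>d > 0\<close> by (rule tendstoD)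
    qed
    then show ?thesis
      using eventually_ball_finite[of "{..<n}" "\<lambda>s j. dist (G s j) (G s0 j) < d" "nhds s0"]
      by (simp add: dist_real_def Ball_def)
  qed
  have step: "((\<lambda>s. f (z (Suc k) s) - f (z k s)) has_real_derivative pderiv_at k f (G s0) * D k) (at s0)"
    if k: "k < n" for k
  proof -
    \<comment> \<open>The difference quotient of \<open>f\<close> in coordinate \<open>k\<close>.
      Where that coordinate does not move, it is filled in with the expected limit, so that
      increment equals \<open>r s\<close> times displacement without exception and \<open>r\<close>
      still converges.\<close>
    define r where "r s = (if G s k = G s0 k then pderiv_at k f (G s0)
       else (f (z (Suc k) s) - f (z k s)) / (G s k - G s0 k))" for s
    have zS: "z (Suc k) s = (z k s)(k := G s k)" "(z k s) k = G s0 k" for s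
      by (auto simp: z_def less_Suc_eq)
    have "f (z (Suc k) s) - f (z k s) = r s * (G s k - G s0 k)" for s
    proof (cases "G s k = G s0 k")
      case True
      then have "z (Suc k) s = z k s" by (auto simp: z_def less_Suc_eq)
      then show ?thesis using True by simp
    qed (simp add: r_def)
    moreover have "((\<lambda>s. r s * ((G s k - G s0 k) / (s - s0))) \<longlongrightarrow> pderiv_at k f (G s0) * D k) (at s0)"
    proof (rule tendsto_mult)
      show "((\<lambda>s. (G s k - G s0 k) / (s - s0)) \<longlongrightarrow> D k) (at s0)"
        using D[OF k] by (simp add: has_field_derivative_iff)
      show "(r \<longlongrightarrow> pderiv_at k f (G s0)) (at s0)"
      proof (rule tendstoI)
        fix \<epsilon> :: real assume "\<epsilon> > 0"
        have "continuous (at (G s0) within V) (pderiv_at k f)"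
          using pd(1)[OF k] G0 continuous_on_eq_continuous_within by blast
        then have "\<forall>\<^sub>F y in at (G s0) within V. dist (pderiv_at k f y) (pderiv_at k f (G s0)) < \<epsilon>"
          using \<open>\<epsilon> > 0\<close> by (simp add: continuous_within tendsto_iff)
        then obtain T where T: "open T" "G s0 \<in> T" "\<And>y. y \<in> T \<Longrightarrow> y \<in> V \<Longrightarrow> y \<noteq> G s0 \<Longrightarrow>
            dist (pderiv_at k f y) (pderiv_at k f (G s0)) < \<epsilon>"
          unfolding eventually_at_topological by auto
        obtain e' where e': "e' > 0" "\<And>y. (\<And>i. \<bar>y i - G s0 i\<bar> < e') \<Longrightarrow> y \<in> T"
          using open_fun_box T by blast
        \<comment> \<open>The radius \<open>e\<close> keeps \<open>y\<close> inside
          \<open>V\<close>, and \<open>e'\<close> keeps the partial derivative within \<epsilon> of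
          its value at \<open>G s0\<close>.\<close>
        have pdn: "dist (pderiv_at k f y) (pderiv_at k f (G s0)) < \<epsilon>" and yV: "y \<in> V"
          if "y \<in> espace n" "\<And>i. i < n \<Longrightarrow> \<bar>y i - G s0 i\<bar> < min e e'" for y
        proof -
          have "\<bar>y i - G s0 i\<bar> < e'" for i
            using that G0E e'(1) by (cases "i < n") (auto simp: mem_espace)
          then have "y \<in> T" using e'(2) by blast
          moreover show "y \<in> V" using e(2) that by force
          ultimately show "dist (pderiv_at k f y) (pderiv_at k f (G s0)) < \<epsilon>"
            using T(3) \<open>\<epsilon> > 0\<close> by (cases "y = G s0") auto
        qed
        have "\<forall>\<^sub>F s in nhds s0. dist (r s) (pderiv_at k f (G s0)) < \<epsilon>"
          using near[OF min_less_iff_conj[THEN iffD2, OF conjI, OF e(1) e'(1)]] G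
        proof eventually_elim
          case (elim s)
          have zE: "(z k s)(k := t) \<in> espace n" for t
            using elim G0E k by (auto simp: z_def mem_espace)
          have bd: "\<bar>((z k s)(k := t)) i - G s0 i\<bar> < min e e'" if "\<bar>t - G s0 k\<bar> \<le> \<bar>G s k - G s0 k\<bar>" "i < n" for t i
            using elim(1) that k e(1) e'(1) by (cases "i = k") (fastforce simp: z_def)+
          show ?case
          proof (cases "G s k = G s0 k")
            case True
            then show ?thesis using \<open>\<epsilon> > 0\<close> by (simp add: r_def)
          next
            case False
            \<comment> \<open>The mean value theorem wants ordered endpoints, while
              \<open>G s k\<close> may lie on either side of \<open>G s0 k\<close>.\<close>
            define a b where "a = min (G s k) (G s0 k)" and "b = max (G s k) (G s0 k)"
            have ab: "a < b" using False by (auto simp: a_def b_def)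
            have der: "((\<lambda>t. f ((z k s)(k := t))) has_real_derivative pderiv_at k f ((z k s)(k := t))) (at t)"
              if "a \<le> t" "t \<le> b" for t
            proof -
              have "(z k s)(k := t) \<in> V"
                by (rule yV[OF zE bd]) (use that in \<open>auto simp: a_def b_def\<close>)
              from pd(2)[OF k this] show ?thesis by simp
            qed
            obtain \<xi> where \<xi>: "a < \<xi>" "\<xi> < b"
              "f ((z k s)(k := b)) - f ((z k s)(k := a)) = (b - a) * pderiv_at k f ((z k s)(k := \<xi>))"
              using MVT2[OF ab der] by blast
            have "f (z (Suc k) s) - f (z k s) = (G s k - G s0 k) * pderiv_at k f ((z k s)(k := \<xi>))"
            proof -
              have "(z k s)(k := G s0 k) = z k s" by (metis zS(2) fun_upd_triv)
              then show ?thesis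
                using \<xi>(3) False unfolding zS(1) a_def b_def
                by (cases "G s k < G s0 k") (auto simp: algebra_simps min_def max_def split: if_splits)
            qed
            then have "r s = pderiv_at k f ((z k s)(k := \<xi>))" using False by (simp add: r_def)
            moreover have "dist (pderiv_at k f ((z k s)(k := \<xi>))) (pderiv_at k f (G s0)) < \<epsilon>"
              by (rule pdn[OF zE bd]) (use \<xi> in \<open>auto simp: a_def b_def\<close>)
            ultimately show ?thesis by simp
          qed
        qed
        then show "\<forall>\<^sub>F s in at s0. dist (r s) (pderiv_at k f (G s0)) < \<epsilon>"
          using eventually_nhds_conv_at by blast
      qed
    qed
    moreover have "z (Suc k) s0 = z k s0" by (auto simp: z_def)
    ultimately show ?thesis by (simp add: has_field_derivative_iff)
  qed
  have 1: "((\<lambda>s. f (G s0) + (\<Sum>k<n. f (z (Suc k) s) - f (z k s))) has_real_derivative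
      0 + (\<Sum>k<n. pderiv_at k f (G s0) * D k)) (at s0)"
    by (intro DERIV_add DERIV_const DERIV_sum step) auto
  have 2: "\<forall>\<^sub>F s in nhds s0. f (G s0) + (\<Sum>k<n. f (z (Suc k) s) - f (z k s)) = f (G s)"
    using G
  proof eventually_elim
    case (elim s)
    have "z n s = G s" "z 0 s = G s0"
      using elim G0E by (auto simp: z_def mem_espace fun_eq_iff)
    then show ?case using sum_lessThan_telescope[of "\<lambda>k. f (z k s)" n] by simp
  qed
  show ?thesis using DERIV_cong_ev[OF refl 2 refl, THEN iffD1, OF 1] by simp
qed

text \<open>Induction on \<open>k\<close> with \<open>f\<close> arbitrary: each partial derivative
  of the composite is a sum of products of \<open>pderiv_at j f\<close> along \<open>G\<close> and
  partial derivatives of \<open>G\<close>, and the induction hypothesis applies to the first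
  factor.\<close>

lemma Ck_on_compose:
  assumes U: "openin (Euclidean_space m) U" and V: "openin (Euclidean_space n) V"
    and f: "Ck_on k n V f" and G: "\<And>j. j < n \<Longrightarrow> Ck_on k m U (\<lambda>x. G x j)"
    and GV: "\<And>x. x \<in> U \<Longrightarrow> G x \<in> V"
  shows "Ck_on k m U (\<lambda>x. f (G x))"
proof -
  have subU: "U \<subseteq> espace m" and subV: "V \<subseteq> espace n"
    using U V openin_Euclidean_space_subset by blast+
  have c: "continuous_on U (\<lambda>x. f (G x))" if "continuous_on V f" "\<And>j. j < n \<Longrightarrow> continuous_on U (\<lambda>x. G x j)" for f
  proof (rule continuous_on_compose2[OF that(1)])
    show "continuous_on U G"
    proof (rule continuous_on_coordinatewise_then_product)
      \<comment> \<open>Continuity into the full function space also concerns the coordinates from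
        \<open>n\<close> on; there \<open>G\<close> vanishes because its values lie in
        \<open>V\<close>.\<close>
      fix j show "continuous_on U (\<lambda>x. G x j)"
      proof (cases "j < n")
        case False
        then have "G x j = 0" if "x \<in> U" for x using GV[OF that] subV by (auto simp: mem_espace)
        then show ?thesis using continuous_on_cong[of U U "\<lambda>x. G x j" "\<lambda>_. 0"] by simp
      qed (rule that)
    qed
  qed (use GV in auto)
  show ?thesis using f G
  proof (induction k arbitrary: f)
    case 0
    then show ?case using c Ck_on_0 subU subV by metis
  next
    case (Suc k)
    have 1: "Ck_on 1 n V f" using Suc.prems(1)
      by (induction k) (use Ck_on_Suc_imp in auto)
    have cG: "\<And>j. j < n \<Longrightarrow> continuous_on U (\<lambda>x. G x j)"
      using Ck_on_imp_continuous_on Suc.prems(2) subU by blast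
    have cf: "continuous_on V f" using Ck_on_imp_continuous_on Suc.prems(1) subV by blast
    have "\<exists>g. Ck_on k m U g \<and> (\<forall>x\<in>U. ((\<lambda>s. f (G (x(i := s)))) has_real_derivative g x) (at (x i)))"
      if i: "i < m" for i
    proof (intro exI[of _ "\<lambda>x. \<Sum>j<n. pderiv_at j f (G x) * pderiv_at i (\<lambda>x. G x j) x"] conjI ballI)
      show "Ck_on k m U (\<lambda>x. \<Sum>j<n. pderiv_at j f (G x) * pderiv_at i (\<lambda>x. G x j) x)"
      proof (intro Ck_on_sum Ck_on_mult)
        fix j assume j: "j \<in> {..<n}"
        show "Ck_on k m U (\<lambda>x. pderiv_at j f (G x))"
        proof (rule Suc.IH)
          show "Ck_on k n V (pderiv_at j f)"
            using Suc.prems(1) j Ck_on_Suc_pderiv[OF V] by blast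
        qed (use Suc.prems(2) Ck_on_Suc_imp in blast)
        show "Ck_on k m U (pderiv_at i (\<lambda>x. G x j))"
          using Suc.prems(2)[of j] i j Ck_on_Suc_pderiv[OF U] by auto
      qed auto
      fix x assume x: "x \<in> U"
      have "((\<lambda>s. f (G (x(i := s)))) has_real_derivative
        (\<Sum>j<n. pderiv_at j f (G (x(i := x i))) * pderiv_at i (\<lambda>x. G x j) x)) (at (x i))"
      proof (rule has_real_derivative_along_curve[OF V 1])
        show "G (x(i := x i)) \<in> V" using GV x by simp
        show "\<forall>\<^sub>F s in nhds (x i). G (x(i := s)) \<in> espace n"
          using eventually_upd_mem[OF U x i] by eventually_elim (use GV subV in blast)
        fix j assume "j < n"
        then show "((\<lambda>s. G (x(i := s)) j) has_real_derivative pderiv_at i (\<lambda>x. G x j) x) (at (x i))"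
          using Suc.prems(2)[of j] x i Ck_on_Suc_pderiv[OF U, of k "\<lambda>x. G x j"] by auto
      qed
      then show "((\<lambda>s. f (G (x(i := s)))) has_real_derivative
        (\<Sum>j<n. pderiv_at j f (G x) * pderiv_at i (\<lambda>x. G x j) x)) (at (x i))" by simp
    qed
    then show ?case using c[OF cf cG] subU by (simp add: continuous_map_Euclidean_subtopology)
  qed
qed

section \<open>Smooth maps\<close>

text \<open>The part of \<^const>\<open>manifold\<close> that the composition of smooth maps depends on.\<close>

definition charted :: "'a mfd \<Rightarrow> bool" where
  "charted M \<longleftrightarrow>
     (\<forall>(U, c) \<in> atlas M. openin (mtop M) U \<and> inj_on c U \<and>
        (\<forall>W. openin (mtop M) W \<and> W \<subseteq> U \<longrightarrow> openin (Euclidean_space (mdim M)) (c ` W))) \<and>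
     (\<Union>(U, c) \<in> atlas M. U) = points M"

lemma chartedD:
  assumes "charted M" "(U, c) \<in> atlas M"
  shows "openin (mtop M) U" "inj_on c U"
    "\<And>W. openin (mtop M) W \<Longrightarrow> W \<subseteq> U \<Longrightarrow> openin (Euclidean_space (mdim M)) (c ` W)"
  using assms unfolding charted_def by auto

lemma charted_chart:
  assumes "charted M" "x \<in> points M"
  obtains U c where "(U, c) \<in> atlas M" "x \<in> U"
proof -
  have "x \<in> (\<Union>(U, c) \<in> atlas M. U)" using assms unfolding charted_def by blast
  then show thesis using that by auto
qed

lemma manifold_chartD:
  assumes "manifold M" "(U, c) \<in> atlas M"
  shows "openin (mtop M) U" "openin (Euclidean_space (mdim M)) (c ` U)"
    "homeomorphic_map (subtopology (mtop M) U) (subtopology (Euclidean_space (mdim M)) (c ` U)) c"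
    "inj_on c U"
proof -
  show *: "openin (mtop M) U" "openin (Euclidean_space (mdim M)) (c ` U)"
    "homeomorphic_map (subtopology (mtop M) U) (subtopology (Euclidean_space (mdim M)) (c ` U)) c"
    using assms unfolding manifold_def by auto
  have "topspace (subtopology (mtop M) U) = U" using openin_subset[OF *(1)] by auto
  then show "inj_on c U" using *(3) homeomorphic_imp_injective_map by metis
qed

lemma manifold_charted:
  assumes "manifold M"
  shows "charted M"
  unfolding charted_def
proof (intro conjI)
  show "(\<Union>(U, c) \<in> atlas M. U) = points M" using assms unfolding manifold_def by blast
  have "openin (Euclidean_space (mdim M)) (c ` W)"
    if "(U, c) \<in> atlas M" "openin (mtop M) W" "W \<subseteq> U" for U c W
  proof -
    note c = manifold_chartD[OF assms that(1)]
    have "openin (subtopology (mtop M) U) W"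
      using c(1) that openin_open_subtopology by blast
    then have "openin (subtopology (Euclidean_space (mdim M)) (c ` U)) (c ` W)"
      using homeomorphic_imp_open_map[OF c(3)] open_map_def by blast
    then show ?thesis using c(2) openin_open_subtopology by blast
  qed
  then show "\<forall>(U, c) \<in> atlas M. openin (mtop M) U \<and> inj_on c U \<and>
        (\<forall>W. openin (mtop M) W \<and> W \<subseteq> U \<longrightarrow> openin (Euclidean_space (mdim M)) (c ` W))"
    using manifold_chartD(1)[OF assms] manifold_chartD(4)[OF assms] by auto
qed

text \<open>The coordinate expression of \<open>\<phi>\<close> is an existential witness instead of
  a composite with \<open>inv_into\<close>. Shrinking \<open>W\<close> or changing
  \<open>\<phi>\<close> off \<open>W\<close> is then immediate; the \<open>inv_into\<close> form is
  recovered when the image of \<open>W\<close> is open and \<open>c\<close> is injective.\<close>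

definition smooth_in :: "nat \<Rightarrow> ('a \<Rightarrow> nat \<Rightarrow> real) \<Rightarrow> 'a set \<Rightarrow> ('a \<Rightarrow> real) \<Rightarrow> bool" where
  "smooth_in m c W \<phi> \<longleftrightarrow> (\<exists>g. (\<forall>k. Ck_on k m (c ` W) g) \<and> (\<forall>y\<in>W. g (c y) = \<phi> y))"

lemma smooth_in_mono: "smooth_in m c W \<phi> \<Longrightarrow> W' \<subseteq> W \<Longrightarrow> smooth_in m c W' \<phi>"
  unfolding smooth_in_def by (meson Ck_on_subset image_mono subsetD)

lemma smooth_in_cong: "smooth_in m c W \<phi> \<Longrightarrow> (\<And>y. y \<in> W \<Longrightarrow> \<phi> y = \<psi> y) \<Longrightarrow> smooth_in m c W \<psi>"
  unfolding smooth_in_def by metis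

lemma smooth_in_const: "smooth_in m c W (\<lambda>_. a)"
  unfolding smooth_in_def by (intro exI[of _ "\<lambda>_. a"]) (auto intro: Ck_on_const)

lemma smooth_in_chart: "c ` W \<subseteq> espace m \<Longrightarrow> smooth_in m c W (\<lambda>x. c x j)"
  unfolding smooth_in_def by (intro exI[of _ "\<lambda>x. x j"]) (auto intro: Ck_on_coord)

lemma smooth_in_imp_Ck_on:
  assumes "smooth_in m c W \<phi>" "inj_on c U" "W \<subseteq> U" "openin (Euclidean_space m) (c ` W)"
  shows "Ck_on k m (c ` W) (\<phi> \<circ> inv_into U c)"
proof -
  obtain g where g: "\<And>k. Ck_on k m (c ` W) g" "\<And>y. y \<in> W \<Longrightarrow> g (c y) = \<phi> y"
    using assms unfolding smooth_in_def by auto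
  show ?thesis
    by (rule Ck_on_cong_imp[OF assms(4) _ g(1)]) (use assms g(2) in auto)
qed

lemma smooth_in_Ck_onI:
  assumes "\<And>k. Ck_on k m (c ` W) (\<phi> \<circ> inv_into U c)" "inj_on c U" "W \<subseteq> U"
  shows "smooth_in m c W \<phi>"
  unfolding smooth_in_def by (intro exI[of _ "\<phi> \<circ> inv_into U c"]) (use assms in auto)

text \<open>The local witnesses may differ from each other; each is traded for the one function
  \<open>\<phi> \<circ> inv_into U c\<close>, to which \<open>Ck_on_local\<close> applies.\<close>

lemma smooth_in_local:
  assumes M: "charted M" and c: "(U, c) \<in> atlas M" and W: "W \<subseteq> U"
    and loc: "\<And>x. x \<in> W \<Longrightarrow> \<exists>W'. openin (mtop M) W' \<and> x \<in> W' \<and> W' \<subseteq> W \<and> smooth_in (mdim M) c W' \<phi>"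
  shows "smooth_in (mdim M) c W \<phi>"
proof (rule smooth_in_Ck_onI[OF _ chartedD(2)[OF M c] W])
  fix k
  show "Ck_on k (mdim M) (c ` W) (\<phi> \<circ> inv_into U c)"
  proof (rule Ck_on_local)
    fix a assume "a \<in> c ` W"
    then obtain x where x: "x \<in> W" "a = c x" by auto
    then obtain W' where W': "openin (mtop M) W'" "x \<in> W'" "W' \<subseteq> W" "smooth_in (mdim M) c W' \<phi>"
      using loc by blast
    moreover have op: "openin (Euclidean_space (mdim M)) (c ` W')"
      using W' W chartedD(3)[OF M c] by blast
    moreover have "Ck_on k (mdim M) (c ` W') (\<phi> \<circ> inv_into U c)"
      using smooth_in_imp_Ck_on[OF W'(4) chartedD(2)[OF M c] _ op] W' W by blast
    ultimately show "\<exists>V. openin (Euclidean_space (mdim M)) V \<and> a \<in> V \<and> V \<subseteq> c ` W \<and>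
        Ck_on k (mdim M) V (\<phi> \<circ> inv_into U c)"
      using x by blast
  qed
qed

lemma smooth_in_compose:
  assumes W: "openin (Euclidean_space m) (c ` W)" and V: "openin (Euclidean_space n) V"
    and g: "\<And>k. Ck_on k n V g" and G: "\<And>j. j < n \<Longrightarrow> smooth_in m c W (\<lambda>x. G x j)"
    and GV: "\<And>x. x \<in> W \<Longrightarrow> G x \<in> V" and inj: "inj_on c W"
  shows "smooth_in m c W (\<lambda>x. g (G x))"
proof (rule smooth_in_Ck_onI[OF _ inj])
  fix k
  have "Ck_on k m (c ` W) (\<lambda>a. g ((G \<circ> inv_into W c) a))"
  proof (rule Ck_on_compose[OF W V g])
    fix j assume "j < n"
    from smooth_in_imp_Ck_on[OF G[OF this] inj _ W] show "Ck_on k m (c ` W) (\<lambda>a. (G \<circ> inv_into W c) a j)"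
      by (simp add: o_def)
  qed (use GV inj in auto)
  then show "Ck_on k m (c ` W) ((\<lambda>x. g (G x)) \<circ> inv_into W c)" by (simp add: o_def)
qed simp

lemma openin_chart_preimage:
  assumes "charted M" "charted N" "continuous_map (mtop M) (mtop N) f" "(U, c) \<in> atlas M" "(V, d) \<in> atlas N"
  shows "openin (mtop M) {x \<in> U. f x \<in> V}"
proof -
  note U = chartedD(1)[OF assms(1,4)]
  have "{x \<in> U. f x \<in> V} = U \<inter> {x \<in> points M. f x \<in> V}" using openin_subset[OF U] by auto
  then show ?thesis
    using U openin_continuous_map_preimage[OF assms(3) chartedD(1)[OF assms(2,5)]] by auto
qed

text \<open>The working form of \<open>smooth_map\<close>. Chart preimages under a continuous map
  are open, so their coordinate images are open and \<open>smooth_in\<close> can replace the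
  \<open>inv_into\<close> expressions, one coordinate at a time.\<close>

lemma smooth_map_iff:
  assumes "charted M" "charted N"
  shows "smooth_map M N f \<longleftrightarrow> continuous_map (mtop M) (mtop N) f \<and>
    (\<forall>U c V d i. (U, c) \<in> atlas M \<longrightarrow> (V, d) \<in> atlas N \<longrightarrow> i < mdim N \<longrightarrow>
       smooth_in (mdim M) c {x \<in> U. f x \<in> V} (\<lambda>x. d (f x) i))"
proof (cases "continuous_map (mtop M) (mtop N) f")
  case cont: True
  have "smooth_on (mdim M) (c ` {x \<in> U. f x \<in> V}) (mdim N) (d \<circ> f \<circ> inv_into U c) \<longleftrightarrow>
      (\<forall>i<mdim N. smooth_in (mdim M) c {x \<in> U. f x \<in> V} (\<lambda>x. d (f x) i))"
    if c: "(U, c) \<in> atlas M" and d: "(V, d) \<in> atlas N" for U c V d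
  proof -
    let ?W = "{x \<in> U. f x \<in> V}"
    have op: "openin (Euclidean_space (mdim M)) (c ` ?W)"
      using openin_chart_preimage[OF assms cont c d] chartedD(3)[OF assms(1) c] by blast
    have "smooth_in (mdim M) c ?W (\<lambda>x. d (f x) i) \<longleftrightarrow>
       (\<forall>k. Ck_on k (mdim M) (c ` ?W) ((\<lambda>x. d (f x) i) \<circ> inv_into U c))" for i
      using smooth_in_imp_Ck_on[OF _ chartedD(2)[OF assms(1) c] _ op]
        smooth_in_Ck_onI[OF _ chartedD(2)[OF assms(1) c]] by blast
    then show ?thesis by (auto simp: smooth_on_def o_def)
  qed
  then show ?thesis using cont unfolding smooth_map_def by blast
qed (simp add: smooth_map_def)

lemma smooth_mapD_continuous: "smooth_map M N f \<Longrightarrow> continuous_map (mtop M) (mtop N) f"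
  by (simp add: smooth_map_def)

lemma smooth_map_in_points: "smooth_map M N f \<Longrightarrow> x \<in> points M \<Longrightarrow> f x \<in> points N"
  by (metis smooth_mapD_continuous continuous_map_image_subset_topspace image_subset_iff)

lemma smooth_mapD_smooth_in:
  assumes "smooth_map M N f" "charted M" "charted N" "(U, c) \<in> atlas M" "(V, d) \<in> atlas N" "i < mdim N"
  shows "smooth_in (mdim M) c {x \<in> U. f x \<in> V} (\<lambda>x. d (f x) i)"
  using assms smooth_map_iff by blast

text \<open>Near \<open>x\<close> the coordinate expression factors through a chart of
  \<open>N\<close> around \<open>f x\<close>. Since \<open>smooth_map\<close> tests all pairs of
  charts, both factors are smooth in that chart, and the chain rule applies.\<close>

lemma smooth_map_compose:
  assumes M: "charted M" and N: "charted N" and K: "charted K"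
    and f: "smooth_map M N f" and g: "smooth_map N K g"
  shows "smooth_map M K (g \<circ> f)"
  unfolding smooth_map_iff[OF M K]
proof (intro conjI allI impI)
  show cont: "continuous_map (mtop M) (mtop K) (g \<circ> f)"
    using continuous_map_compose[OF smooth_mapD_continuous[OF f] smooth_mapD_continuous[OF g]] .
  fix U c V d i assume c: "(U, c) \<in> atlas M" and d: "(V, d) \<in> atlas K" and i: "i < mdim K"
  show "smooth_in (mdim M) c {x \<in> U. (g \<circ> f) x \<in> V} (\<lambda>x. d ((g \<circ> f) x) i)"
  proof (rule smooth_in_local[OF M c])
    fix x assume x: "x \<in> {x \<in> U. (g \<circ> f) x \<in> V}"
    then have "x \<in> points M" using chartedD(1)[OF M c] openin_subset by fastforce
    then have "f x \<in> points N" using f smooth_map_in_points by metis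
    then obtain T e where e: "(T, e) \<in> atlas N" "f x \<in> T" using charted_chart N by metis
    let ?W = "{x \<in> U. f x \<in> T} \<inter> {x \<in> U. (g \<circ> f) x \<in> V}"
    let ?T = "{y \<in> T. g y \<in> V}"
    have opT: "openin (Euclidean_space (mdim N)) (e ` ?T)"
      using openin_chart_preimage[OF N K smooth_mapD_continuous[OF g] e(1) d] chartedD(3)[OF N e(1)] by auto
    have opW: "openin (mtop M) ?W"
      using openin_chart_preimage[OF M N smooth_mapD_continuous[OF f] c e(1)]
        openin_chart_preimage[OF M K cont c d] by blast
    have injW: "inj_on c ?W" using chartedD(2)[OF M c] by (rule inj_on_subset) auto
    have "smooth_in (mdim M) c ?W (\<lambda>x. ((\<lambda>y. d (g y) i) \<circ> inv_into T e) (e (f x)))"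
    proof (rule smooth_in_compose[OF _ opT, where G = "\<lambda>x. e (f x)" and g = "(\<lambda>y. d (g y) i) \<circ> inv_into T e"])
      show "openin (Euclidean_space (mdim M)) (c ` ?W)"
        by (rule chartedD(3)[OF M c opW]) auto
      show "Ck_on k (mdim N) (e ` ?T) ((\<lambda>y. d (g y) i) \<circ> inv_into T e)" for k
        by (rule smooth_in_imp_Ck_on[OF smooth_mapD_smooth_in[OF g N K e(1) d i] chartedD(2)[OF N e(1)] _ opT]) auto
      show "smooth_in (mdim M) c ?W (\<lambda>x. e (f x) j)" if "j < mdim N" for j
        using smooth_mapD_smooth_in[OF f M N c e(1) that] by (rule smooth_in_mono) auto
    qed (use injW in auto)
    then have "smooth_in (mdim M) c ?W (\<lambda>x. d ((g \<circ> f) x) i)"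
      by (rule smooth_in_cong) (use chartedD(2)[OF N e(1)] in auto)
    then show "\<exists>W'. openin (mtop M) W' \<and> x \<in> W' \<and> W' \<subseteq> {x \<in> U. (g \<circ> f) x \<in> V} \<and>
        smooth_in (mdim M) c W' (\<lambda>x. d ((g \<circ> f) x) i)"
      using opW x e(2) by (intro exI[of _ ?W]) auto
  qed auto
qed

lemma smooth_map_compose':
  assumes "charted M" "charted N" "charted K" "smooth_map M N f" "smooth_map N K g"
  shows "smooth_map M K (\<lambda>x. g (f x))"
  using smooth_map_compose[OF assms] by (simp add: o_def)

lemma smooth_map_cong:
  assumes M: "charted M" and N: "charted N" and f: "smooth_map M N f"
    and eq: "\<And>x. x \<in> points M \<Longrightarrow> f x = g x"
  shows "smooth_map M N g"
  unfolding smooth_map_iff[OF M N]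
proof (intro conjI allI impI)
  show "continuous_map (mtop M) (mtop N) g"
    using smooth_mapD_continuous[OF f] eq continuous_map_eq by blast
  fix U c V d i assume c: "(U, c) \<in> atlas M" and d: "(V, d) \<in> atlas N" and i: "i < mdim N"
  have "U \<subseteq> points M" using chartedD(1)[OF M c] openin_subset by auto
  then have "{x \<in> U. f x \<in> V} = {x \<in> U. g x \<in> V}" using eq by auto
  then show "smooth_in (mdim M) c {x \<in> U. g x \<in> V} (\<lambda>x. d (g x) i)"
    using smooth_mapD_smooth_in[OF f M N c d i] \<open>U \<subseteq> points M\<close>
    by (auto intro: smooth_in_cong simp: eq subset_iff)
qed

text \<open>The coordinate expressions of the identity are the transition maps. This is the form in
  which compatibility of charts is used from here on.\<close>

lemma smooth_map_id: "manifold M \<Longrightarrow> smooth_map M M (\<lambda>x. x)"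
  unfolding smooth_map_def manifold_def by (auto simp: o_def Int_def)

lemma smooth_map_const:
  assumes "charted M" "charted N" "y \<in> points N"
  shows "smooth_map M N (\<lambda>_. y)"
  unfolding smooth_map_iff[OF assms(1,2)] using assms(3) smooth_in_const by auto

subsection \<open>Open submanifolds\<close>

lemma submfd_simps [simp]:
  "mtop (submfd M U) = subtopology (mtop M) U" "mdim (submfd M U) = mdim M"
  by (simp_all add: submfd_def)

lemma atlas_submfd: "atlas (submfd M U) = {(V \<inter> U, c) | V c. (V, c) \<in> atlas M}"
  by (simp add: submfd_def)

lemma points_submfd [simp]: "openin (mtop M) U \<Longrightarrow> points (submfd M U) = U"
  using openin_subset by auto

lemma charted_submfd:
  assumes M: "charted M" and U: "openin (mtop M) U"
  shows "charted (submfd M U)"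
  unfolding charted_def
proof (intro conjI)
  have "(\<Union>(V, c)\<in>atlas (submfd M U). V) = (\<Union>(V, c)\<in>atlas M. V) \<inter> U"
    by (auto simp: atlas_submfd)
  then show "(\<Union>(V, c)\<in>atlas (submfd M U). V) = points (submfd M U)"
    using M by (auto simp: charted_def)
  show "\<forall>(V, c)\<in>atlas (submfd M U). openin (mtop (submfd M U)) V \<and> inj_on c V \<and>
     (\<forall>W. openin (mtop (submfd M U)) W \<and> W \<subseteq> V \<longrightarrow> openin (Euclidean_space (mdim (submfd M U))) (c ` W))"
    using chartedD[OF M] U by (auto simp: atlas_submfd openin_open_subtopology intro: inj_on_Int[OF disjI1])
qed

lemma smooth_map_submfd_mono:
  assumes M: "charted M" and N: "charted N" and U: "openin (mtop M) U" and W: "openin (mtop M) W" "W \<subseteq> U"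
    and f: "smooth_map (submfd M U) N f"
  shows "smooth_map (submfd M W) N f"
  unfolding smooth_map_iff[OF charted_submfd[OF M W(1)] N]
proof (intro conjI allI impI)
  show "continuous_map (mtop (submfd M W)) (mtop N) f"
    using smooth_mapD_continuous[OF f] W continuous_map_from_subtopology_mono by auto
  fix V c V' d i assume c: "(V, c) \<in> atlas (submfd M W)" and d: "(V', d) \<in> atlas N" and i: "i < mdim N"
  obtain V0 where V0: "V = V0 \<inter> W" "(V0, c) \<in> atlas M" using c by (auto simp: atlas_submfd)
  then have "(V0 \<inter> U, c) \<in> atlas (submfd M U)" by (auto simp: atlas_submfd)
  from smooth_mapD_smooth_in[OF f charted_submfd[OF M U] N this d i]
  show "smooth_in (mdim (submfd M W)) c {x \<in> V. f x \<in> V'} (\<lambda>x. d (f x) i)"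
    by (auto intro: smooth_in_mono simp: V0 W(2)[THEN subsetD])
qed

lemma smooth_map_submfd:
  assumes M: "charted M" and N: "charted N" and W: "openin (mtop M) W" and f: "smooth_map M N f"
  shows "smooth_map (submfd M W) N f"
  unfolding smooth_map_iff[OF charted_submfd[OF M W] N]
proof (intro conjI allI impI)
  show "continuous_map (mtop (submfd M W)) (mtop N) f"
    using smooth_mapD_continuous[OF f] continuous_map_from_subtopology by auto
  fix V c V' d i assume c: "(V, c) \<in> atlas (submfd M W)" and d: "(V', d) \<in> atlas N" and i: "i < mdim N"
  obtain V0 where V0: "V = V0 \<inter> W" "(V0, c) \<in> atlas M" using c by (auto simp: atlas_submfd)
  from smooth_mapD_smooth_in[OF f M N V0(2) d i]
  show "smooth_in (mdim (submfd M W)) c {x \<in> V. f x \<in> V'} (\<lambda>x. d (f x) i)"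
    by (auto intro: smooth_in_mono simp: V0)
qed

lemma smooth_map_into_submfd:
  assumes M: "charted M" and N: "charted N" and W: "openin (mtop N) W" and f: "smooth_map M N f"
    and fW: "\<And>x. x \<in> points M \<Longrightarrow> f x \<in> W"
  shows "smooth_map M (submfd N W) f"
  unfolding smooth_map_iff[OF M charted_submfd[OF N W]]
proof (intro conjI allI impI)
  show "continuous_map (mtop M) (mtop (submfd N W)) f"
    using smooth_mapD_continuous[OF f] fW by (simp add: continuous_map_in_subtopology image_subset_iff)
  fix V c V' d i assume c: "(V, c) \<in> atlas M" and d: "(V', d) \<in> atlas (submfd N W)" and i: "i < mdim (submfd N W)"
  obtain V0 where V0: "V' = V0 \<inter> W" "(V0, d) \<in> atlas N" using d by (auto simp: atlas_submfd)
  from smooth_mapD_smooth_in[OF f M N c V0(2)] i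
  show "smooth_in (mdim M) c {x \<in> V. f x \<in> V'} (\<lambda>x. d (f x) i)"
    by (auto intro: smooth_in_mono simp: V0)
qed

lemma smooth_map_from_submfd:
  assumes M: "charted M" and N: "charted N" and W: "openin (mtop N) W" and f: "smooth_map M (submfd N W) f"
  shows "smooth_map M N f"
  unfolding smooth_map_iff[OF M N]
proof (intro conjI allI impI)
  show "continuous_map (mtop M) (mtop N) f"
    using smooth_mapD_continuous[OF f] by (simp add: continuous_map_in_subtopology)
  fix V c V' d i assume c: "(V, c) \<in> atlas M" and d: "(V', d) \<in> atlas N" and i: "i < mdim N"
  have d': "(V' \<inter> W, d) \<in> atlas (submfd N W)" using d by (auto simp: atlas_submfd)
  have "V \<subseteq> points M" using chartedD(1)[OF M c] openin_subset by auto
  then have "{x \<in> V. f x \<in> V'} = {x \<in> V. f x \<in> V' \<inter> W}"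
    using smooth_map_in_points[OF f] by fastforce
  with smooth_mapD_smooth_in[OF f M charted_submfd[OF N W] c d'] i
  show "smooth_in (mdim M) c {x \<in> V. f x \<in> V'} (\<lambda>x. d (f x) i)" by simp
qed

lemma smooth_map_local:
  assumes M: "charted M" and N: "charted N"
    and loc: "\<And>x. x \<in> points M \<Longrightarrow> \<exists>W. openin (mtop M) W \<and> x \<in> W \<and> smooth_map (submfd M W) N f"
  shows "smooth_map M N f"
proof -
  have cont: "continuous_map (mtop M) (mtop N) f"
    unfolding continuous_map
  proof (intro conjI allI impI)
    show "f ` points M \<subseteq> points N"
    proof clarify
      fix x assume "x \<in> points M"
      then obtain W where "openin (mtop M) W" "x \<in> W" "smooth_map (submfd M W) N f" using loc by blast
      then show "f x \<in> points N" using smooth_map_in_points[of "submfd M W" N f x] points_submfd by metis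
    qed
    fix T assume T: "openin (mtop N) T"
    show "openin (mtop M) {x \<in> points M. f x \<in> T}"
    proof (subst openin_subopen, clarify)
      fix x assume x: "x \<in> points M" "f x \<in> T"
      then obtain W where W: "openin (mtop M) W" "x \<in> W" "smooth_map (submfd M W) N f" using loc by blast
      have "openin (subtopology (mtop M) W) {x \<in> points (submfd M W). f x \<in> T}"
        using openin_continuous_map_preimage[OF smooth_mapD_continuous[OF W(3)] T] by simp
      then have "openin (mtop M) {x \<in> W. f x \<in> T}"
        using W(1) openin_open_subtopology points_submfd[OF W(1)] by metis
      then show "\<exists>S. openin (mtop M) S \<and> x \<in> S \<and> S \<subseteq> {x \<in> points M. f x \<in> T}"
        using x W openin_subset[OF W(1)] by (intro exI[of _ "{x \<in> W. f x \<in> T}"]) auto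
    qed
  qed
  show ?thesis
    unfolding smooth_map_iff[OF M N]
  proof (intro conjI allI impI)
    fix V c V' d i assume c: "(V, c) \<in> atlas M" and d: "(V', d) \<in> atlas N" and i: "i < mdim N"
    show "smooth_in (mdim M) c {x \<in> V. f x \<in> V'} (\<lambda>x. d (f x) i)"
    proof (rule smooth_in_local[OF M c])
      fix x assume x: "x \<in> {x \<in> V. f x \<in> V'}"
      have "x \<in> points M" using x chartedD(1)[OF M c] openin_subset by auto
      then obtain W where W: "openin (mtop M) W" "x \<in> W" "smooth_map (submfd M W) N f" using loc by blast
      have c': "(V \<inter> W, c) \<in> atlas (submfd M W)" using c by (auto simp: atlas_submfd)
      have "smooth_in (mdim M) c {x \<in> V \<inter> W. f x \<in> V'} (\<lambda>x. d (f x) i)"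
        using smooth_mapD_smooth_in[OF W(3) charted_submfd[OF M W(1)] N c' d i] by simp
      moreover have "openin (mtop M) {x \<in> V \<inter> W. f x \<in> V'}"
      proof -
        have "{x \<in> V \<inter> W. f x \<in> V'} = {x \<in> V. f x \<in> V'} \<inter> W" by auto
        then show ?thesis using W(1) openin_chart_preimage[OF M N cont c d] by auto
      qed
      ultimately show "\<exists>W'. openin (mtop M) W' \<and> x \<in> W' \<and> W' \<subseteq> {x \<in> V. f x \<in> V'} \<and>
          smooth_in (mdim M) c W' (\<lambda>x. d (f x) i)"
        using x W(2) by blast
    qed auto
  qed (rule cont)
qed

text \<open>For outer maps that are controlled only on an open set, such as local trivializations
  and test functions near a point.\<close>

lemma smooth_map_compose_submfd:
  assumes M: "charted M" and N: "charted N" and K: "charted K" and W: "openin (mtop N) W"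
    and f: "smooth_map M N f" and fW: "\<And>x. x \<in> points M \<Longrightarrow> f x \<in> W"
    and g: "smooth_map (submfd N W) K g"
  shows "smooth_map M K (\<lambda>x. g (f x))"
  by (rule smooth_map_compose'[OF M charted_submfd[OF N W] K smooth_map_into_submfd[OF M N W f fW] g])

lemma smooth_map_incl: "manifold M \<Longrightarrow> openin (mtop M) W \<Longrightarrow> smooth_map (submfd M W) M (\<lambda>x. x)"
  by (simp add: manifold_charted smooth_map_id smooth_map_submfd)

lemma openin_smooth_preimage:
  assumes "smooth_map M N f" "openin (mtop N) W"
  shows "openin (mtop M) {x \<in> points M. f x \<in> W}"
  by (rule openin_continuous_map_preimage[OF smooth_mapD_continuous[OF assms(1)] assms(2)])

subsection \<open>Products\<close>

lemma prod_mfd_simps [simp]: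
  "mtop (prod_mfd M N) = prod_topology (mtop M) (mtop N)" "mdim (prod_mfd M N) = mdim M + mdim N"
  by (simp_all add: prod_mfd_def)

lemma atlas_prod: "atlas (prod_mfd M N) = {(U \<times> V, \<lambda>(x, y). coord_join (mdim M) (c x) (d y)) | U c V d.
    (U, c) \<in> atlas M \<and> (V, d) \<in> atlas N}"
  by (simp add: prod_mfd_def)

lemma coord_join_inject:
  assumes "coord_join m u v = coord_join m u' v'" "u \<in> espace m" "u' \<in> espace m"
  shows "u = u' \<and> v = v'"
proof
  show "u = u'"
  proof
    fix i show "u i = u' i" using fun_cong[OF assms(1), of i] assms(2,3)
      by (cases "i < m") (auto simp: coord_join_def mem_espace)
  qed
  show "v = v'"
  proof
    fix i show "v i = v' i" using fun_cong[OF assms(1), of "i + m"] by (auto simp: coord_join_def)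
  qed
qed

lemma coord_join_espace: "v \<in> espace n \<Longrightarrow> coord_join m u v \<in> espace (m + n)"
  by (auto simp: coord_join_def mem_espace)

text \<open>Splitting off the first \<open>m\<close> coordinates and shifting the others are
  continuous, so the joined set is the trace on \<open>espace (m + n)\<close> of an open
  preimage.\<close>

lemma openin_coord_join:
  assumes A: "openin (Euclidean_space m) A" and B: "openin (Euclidean_space n) B"
  shows "openin (Euclidean_space (m + n)) {coord_join m a b | a b. a \<in> A \<and> b \<in> B}"
proof -
  define left where "left z = (\<lambda>i. if i < m then z i else 0)" for z :: "nat \<Rightarrow> real"
  define right where "right z = (\<lambda>i. z (i + m))" for z :: "nat \<Rightarrow> real"
  obtain S T where S: "open S" "A = S \<inter> espace m" and T: "open T" "B = T \<inter> espace n"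
    using A B openin_Euclidean_space_open by metis
  have "continuous_on UNIV left"
  proof (rule continuous_on_coordinatewise_then_product)
    fix i show "continuous_on UNIV (\<lambda>z. left z i)"
      by (cases "i < m") (auto simp: left_def)
  qed
  moreover have "continuous_on UNIV right"
    by (rule continuous_on_coordinatewise_then_product) (auto simp: right_def)
  ultimately have "open (left -` S \<inter> right -` T)"
    using S(1) T(1) by (intro open_Int open_vimage)
  moreover have "{coord_join m a b | a b. a \<in> A \<and> b \<in> B} = (left -` S \<inter> right -` T) \<inter> espace (m + n)"
    (is "?L = ?R")
  proof (intro equalityI subsetI)
    fix z assume "z \<in> {coord_join m a b | a b. a \<in> A \<and> b \<in> B}"
    then obtain a b where z: "z = coord_join m a b" "a \<in> A" "b \<in> B" by auto
    have "left z = a" "right z = b"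
      using z S by (auto simp: left_def right_def coord_join_def mem_espace fun_eq_iff)
    then show "z \<in> (left -` S \<inter> right -` T) \<inter> espace (m + n)"
      using z S T coord_join_espace by auto
  next
    fix z assume z: "z \<in> (left -` S \<inter> right -` T) \<inter> espace (m + n)"
    have "z = coord_join m (left z) (right z)" by (auto simp: left_def right_def coord_join_def)
    moreover have "left z \<in> A" "right z \<in> B" using z S T by (auto simp: left_def right_def mem_espace)
    ultimately show "z \<in> {coord_join m a b | a b. a \<in> A \<and> b \<in> B}" by blast
  qed
  ultimately show ?thesis using openin_Euclidean_space_open by blast
qed

lemma chart_espace: "charted M \<Longrightarrow> (U, c) \<in> atlas M \<Longrightarrow> x \<in> U \<Longrightarrow> c x \<in> espace (mdim M)"
  using chartedD openin_Euclidean_space_subset by (metis image_subset_iff order_refl)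

lemma charted_prod:
  assumes M: "charted M" and N: "charted N"
  shows "charted (prod_mfd M N)"
  unfolding charted_def
proof (intro conjI)
  show "(\<Union>(U, c)\<in>atlas (prod_mfd M N). U) = points (prod_mfd M N)" (is "?L = ?R")
  proof
    show "?L \<subseteq> ?R"
      using chartedD(1)[OF M, THEN openin_subset] chartedD(1)[OF N, THEN openin_subset]
      by (fastforce simp: atlas_prod)
    show "?R \<subseteq> ?L"
    proof clarify
      fix x y assume "(x, y) \<in> ?R"
      then have "x \<in> points M" "y \<in> points N" by auto
      then obtain U c V d where "(U, c) \<in> atlas M" "x \<in> U" "(V, d) \<in> atlas N" "y \<in> V"
        using charted_chart M N by metis
      then have "(U \<times> V, \<lambda>(x, y). coord_join (mdim M) (c x) (d y)) \<in> atlas (prod_mfd M N)" "(x, y) \<in> U \<times> V"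
        by (auto simp: atlas_prod)
      then show "(x, y) \<in> ?L" by blast
    qed
  qed
  have "openin (mtop (prod_mfd M N)) (U \<times> V) \<and> inj_on (\<lambda>(x, y). coord_join (mdim M) (c x) (d y)) (U \<times> V) \<and>
     (\<forall>W. openin (mtop (prod_mfd M N)) W \<and> W \<subseteq> U \<times> V \<longrightarrow>
       openin (Euclidean_space (mdim M + mdim N)) ((\<lambda>(x, y). coord_join (mdim M) (c x) (d y)) ` W))"
    if c: "(U, c) \<in> atlas M" and d: "(V, d) \<in> atlas N" for U c V d
  proof (intro conjI allI impI)
    show "openin (mtop (prod_mfd M N)) (U \<times> V)"
      using chartedD(1)[OF M c] chartedD(1)[OF N d] by (simp add: openin_prod_Times_iff)
    show "inj_on (\<lambda>(x, y). coord_join (mdim M) (c x) (d y)) (U \<times> V)"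
    proof (rule inj_onI, clarify)
      fix x y x' y'
      assume xy: "x \<in> U" "y \<in> V" "x' \<in> U" "y' \<in> V"
        "coord_join (mdim M) (c x) (d y) = coord_join (mdim M) (c x') (d y')"
      then have "c x = c x' \<and> d y = d y'"
        using coord_join_inject chart_espace[OF M c] by metis
      then show "x = x' \<and> y = y'" using xy chartedD(2)[OF M c] chartedD(2)[OF N d] by (auto dest: inj_onD)
    qed
    fix W assume W: "openin (mtop (prod_mfd M N)) W \<and> W \<subseteq> U \<times> V"
    show "openin (Euclidean_space (mdim M + mdim N)) ((\<lambda>(x, y). coord_join (mdim M) (c x) (d y)) ` W)"
    proof (subst openin_subopen, clarify)
      fix x y assume "(x, y) \<in> W"
      then obtain A B where AB: "openin (mtop M) A" "openin (mtop N) B" "x \<in> A" "y \<in> B" "A \<times> B \<subseteq> W"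
        using W unfolding prod_mfd_simps openin_prod_topology_alt by blast
      then have "A \<subseteq> U" "B \<subseteq> V" using W by auto
      then have op: "openin (Euclidean_space (mdim M + mdim N))
          {coord_join (mdim M) a b | a b. a \<in> c ` A \<and> b \<in> d ` B}"
        using AB chartedD(3)[OF M c] chartedD(3)[OF N d] by (intro openin_coord_join) auto
      moreover have "{coord_join (mdim M) a b | a b. a \<in> c ` A \<and> b \<in> d ` B}
          \<subseteq> (\<lambda>(x, y). coord_join (mdim M) (c x) (d y)) ` W"
        using AB(5) by auto
      moreover have "coord_join (mdim M) (c x) (d y) \<in> {coord_join (mdim M) a b | a b. a \<in> c ` A \<and> b \<in> d ` B}"
        using AB by auto
      ultimately show "\<exists>T. openin (Euclidean_space (mdim M + mdim N)) T \<and> coord_join (mdim M) (c x) (d y) \<in> T \<and>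
          T \<subseteq> (\<lambda>(x, y). coord_join (mdim M) (c x) (d y)) ` W"
        by blast
    qed
  qed
  then show "\<forall>(V, c)\<in>atlas (prod_mfd M N). openin (mtop (prod_mfd M N)) V \<and> inj_on c V \<and>
     (\<forall>W. openin (mtop (prod_mfd M N)) W \<and> W \<subseteq> V \<longrightarrow> openin (Euclidean_space (mdim (prod_mfd M N))) (c ` W))"
    by (auto simp: atlas_prod)
qed

lemma smooth_map_pair:
  assumes K: "charted K" and M: "charted M" and N: "charted N" and f: "smooth_map K M f" and g: "smooth_map K N g"
  shows "smooth_map K (prod_mfd M N) (\<lambda>x. (f x, g x))"
  unfolding smooth_map_iff[OF K charted_prod[OF M N]]
proof (intro conjI allI impI)
  show "continuous_map (mtop K) (mtop (prod_mfd M N)) (\<lambda>x. (f x, g x))"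
    using smooth_mapD_continuous[OF f] smooth_mapD_continuous[OF g] by (simp add: continuous_map_pairedI)
  fix U c V e i assume c: "(U, c) \<in> atlas K" and e: "(V, e) \<in> atlas (prod_mfd M N)" and i: "i < mdim (prod_mfd M N)"
  obtain A a B b where ab: "(A, a) \<in> atlas M" "(B, b) \<in> atlas N" "V = A \<times> B"
      "e = (\<lambda>(x, y). coord_join (mdim M) (a x) (b y))"
    using e by (auto simp: atlas_prod)
  show "smooth_in (mdim K) c {x \<in> U. (f x, g x) \<in> V} (\<lambda>x. e (f x, g x) i)"
  proof (cases "i < mdim M")
    case True
    have "smooth_in (mdim K) c {x \<in> U. (f x, g x) \<in> V} (\<lambda>x. a (f x) i)"
      by (rule smooth_in_mono[OF smooth_mapD_smooth_in[OF f K M c ab(1) True]]) (auto simp: ab)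
    then show ?thesis using True by (simp add: ab coord_join_def)
  next
    case False
    then have i': "i - mdim M < mdim N" using i by auto
    have "smooth_in (mdim K) c {x \<in> U. (f x, g x) \<in> V} (\<lambda>x. b (g x) (i - mdim M))"
      by (rule smooth_in_mono[OF smooth_mapD_smooth_in[OF g K N c ab(2) i']]) (auto simp: ab)
    then show ?thesis using False by (simp add: ab coord_join_def)
  qed
qed

text \<open>The leading coordinates of a product chart are those of a chart \<open>a\<close> of
  \<open>M\<close>, but \<open>fst\<close> is tested against every chart \<open>c'\<close>. The
  passage from \<open>a\<close> to \<open>c'\<close> is a transition map, which is why
  \<open>M\<close> is a manifold and not merely charted.\<close>

lemma smooth_map_fst:
  assumes M: "manifold M" and N: "charted N"
  shows "smooth_map (prod_mfd M N) M fst"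
  unfolding smooth_map_iff[OF charted_prod[OF manifold_charted[OF M] N] manifold_charted[OF M]]
proof (intro conjI allI impI)
  note M' = manifold_charted[OF M]
  note MN = charted_prod[OF M' N]
  show cont: "continuous_map (mtop (prod_mfd M N)) (mtop M) fst"
    by (simp add: continuous_map_fst)
  fix V e U' c' i assume e: "(V, e) \<in> atlas (prod_mfd M N)" and c': "(U', c') \<in> atlas M" and i: "i < mdim M"
  obtain A a B b where ab: "(A, a) \<in> atlas M" "(B, b) \<in> atlas N" "V = A \<times> B"
      "e = (\<lambda>(x, y). coord_join (mdim M) (a x) (b y))"
    using e by (auto simp: atlas_prod)
  let ?W = "{z \<in> V. fst z \<in> U'}"
  have opA: "openin (Euclidean_space (mdim M)) (a ` (A \<inter> U'))"
    by (rule chartedD(3)[OF M' ab(1)]) (use chartedD(1)[OF M'] ab(1) c' in auto)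
  have opW: "openin (Euclidean_space (mdim M + mdim N)) (e ` ?W)"
    using chartedD(3)[OF MN e openin_chart_preimage[OF MN M' cont e c']] by auto
  have "smooth_in (mdim M + mdim N) e ?W (\<lambda>z. ((\<lambda>x. c' x i) \<circ> inv_into A a) (a (fst z)))"
  proof (rule smooth_in_compose[OF opW opA, where G = "\<lambda>z. a (fst z)" and g = "(\<lambda>x. c' x i) \<circ> inv_into A a"])
    show "Ck_on k (mdim M) (a ` (A \<inter> U')) ((\<lambda>x. c' x i) \<circ> inv_into A a)" for k
      using smooth_in_imp_Ck_on[OF _ chartedD(2)[OF M' ab(1)] _ opA]
        smooth_mapD_smooth_in[OF smooth_map_id[OF M] M' M' ab(1) c' i] by (auto simp: Int_def)
    show "inj_on e ?W" by (rule inj_on_subset[OF chartedD(2)[OF MN e]]) auto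
    show "smooth_in (mdim M + mdim N) e ?W (\<lambda>x. a (fst x) j)" if "j < mdim M" for j
    proof -
      have "smooth_in (mdim M + mdim N) e ?W (\<lambda>x. e x j)"
        by (rule smooth_in_chart[OF openin_Euclidean_space_subset[OF opW]])
      then show ?thesis
        by (rule smooth_in_cong) (use that in \<open>auto simp: ab coord_join_def\<close>)
    qed
  qed (auto simp: ab)
  then have "smooth_in (mdim M + mdim N) e ?W (\<lambda>x. c' (fst x) i)"
    by (rule smooth_in_cong) (use chartedD(2)[OF M' ab(1)] ab(3) in auto)
  then show "smooth_in (mdim (prod_mfd M N)) e ?W (\<lambda>x. c' (fst x) i)" by simp
qed

lemma smooth_map_snd:
  assumes M: "charted M" and N: "manifold N"
  shows "smooth_map (prod_mfd M N) N snd"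
  unfolding smooth_map_iff[OF charted_prod[OF M manifold_charted[OF N]] manifold_charted[OF N]]
proof (intro conjI allI impI)
  note N' = manifold_charted[OF N]
  note MN = charted_prod[OF M N']
  show cont: "continuous_map (mtop (prod_mfd M N)) (mtop N) snd"
    by (simp add: continuous_map_snd)
  fix V e U' c' i assume e: "(V, e) \<in> atlas (prod_mfd M N)" and c': "(U', c') \<in> atlas N" and i: "i < mdim N"
  obtain A a B b where ab: "(A, a) \<in> atlas M" "(B, b) \<in> atlas N" "V = A \<times> B"
      "e = (\<lambda>(x, y). coord_join (mdim M) (a x) (b y))"
    using e by (auto simp: atlas_prod)
  let ?W = "{z \<in> V. snd z \<in> U'}"
  have opB: "openin (Euclidean_space (mdim N)) (b ` (B \<inter> U'))"
    by (rule chartedD(3)[OF N' ab(2)]) (use chartedD(1)[OF N'] ab(2) c' in auto)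
  have opW: "openin (Euclidean_space (mdim M + mdim N)) (e ` ?W)"
    using chartedD(3)[OF MN e openin_chart_preimage[OF MN N' cont e c']] by auto
  have "smooth_in (mdim M + mdim N) e ?W (\<lambda>z. ((\<lambda>x. c' x i) \<circ> inv_into B b) (b (snd z)))"
  proof (rule smooth_in_compose[OF opW opB, where G = "\<lambda>z. b (snd z)" and g = "(\<lambda>x. c' x i) \<circ> inv_into B b"])
    show "Ck_on k (mdim N) (b ` (B \<inter> U')) ((\<lambda>x. c' x i) \<circ> inv_into B b)" for k
      using smooth_in_imp_Ck_on[OF _ chartedD(2)[OF N' ab(2)] _ opB]
        smooth_mapD_smooth_in[OF smooth_map_id[OF N] N' N' ab(2) c' i] by (auto simp: Int_def)
    show "inj_on e ?W" by (rule inj_on_subset[OF chartedD(2)[OF MN e]]) auto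
    show "smooth_in (mdim M + mdim N) e ?W (\<lambda>x. b (snd x) j)" if "j < mdim N" for j
    proof -
      have "smooth_in (mdim M + mdim N) e ?W (\<lambda>x. e x (mdim M + j))"
        by (rule smooth_in_chart[OF openin_Euclidean_space_subset[OF opW]])
      then show ?thesis
        by (rule smooth_in_cong) (auto simp: ab coord_join_def)
    qed
  qed (auto simp: ab)
  then have "smooth_in (mdim M + mdim N) e ?W (\<lambda>x. c' (snd x) i)"
    by (rule smooth_in_cong) (use chartedD(2)[OF N' ab(2)] ab(3) in auto)
  then show "smooth_in (mdim (prod_mfd M N)) e ?W (\<lambda>x. c' (snd x) i)" by simp
qed

subsection \<open>Curves and real functions\<close>

abbreviation real_chart :: "real \<Rightarrow> nat \<Rightarrow> real" where
  "real_chart \<equiv> \<lambda>t i. if i = 0 then t else 0"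

lemma real_mfd_simps [simp]: "mtop real_mfd = euclideanreal" "mdim real_mfd = 1"
  "atlas real_mfd = {(UNIV, real_chart)}"
  by (simp_all add: real_mfd_def)

lemma charted_real: "charted real_mfd"
proof -
  have "openin (Euclidean_space (Suc 0)) (real_chart ` W)" if "open W" for W
  proof -
    have "open ((\<lambda>z::nat \<Rightarrow> real. z 0) -` W)"
      by (intro open_vimage that continuous_on_product_coordinates)
    moreover have "real_chart ` W = ((\<lambda>z. z 0) -` W) \<inter> espace (Suc 0)"
    proof
      show "((\<lambda>z. z 0) -` W) \<inter> espace (Suc 0) \<subseteq> real_chart ` W"
      proof
        fix z :: "nat \<Rightarrow> real" assume z: "z \<in> ((\<lambda>z. z 0) -` W) \<inter> espace (Suc 0)"
        then have "z = real_chart (z 0)" by (auto simp: mem_espace fun_eq_iff)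
        then show "z \<in> real_chart ` W" using z by blast
      qed
    qed (auto simp: mem_espace)
    ultimately show ?thesis using openin_Euclidean_space_open by blast
  qed
  moreover have "inj real_chart" by (rule injI) (metis (full_types))
  ultimately show ?thesis by (simp add: charted_def)
qed

lemma charted_interval: "open I \<Longrightarrow> charted (submfd real_mfd I)"
  by (simp add: charted_submfd charted_real)

lemma smooth_map_real_iff:
  assumes "charted M"
  shows "smooth_map M real_mfd \<phi> \<longleftrightarrow> continuous_map (mtop M) euclideanreal \<phi> \<and>
    (\<forall>U c. (U, c) \<in> atlas M \<longrightarrow> smooth_in (mdim M) c U \<phi>)"
  unfolding smooth_map_iff[OF assms charted_real] by auto

text \<open>Coordinate functions serve as test functions for reading off components of a tangent
  vector. In the other charts they are components of transition maps.\<close>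

lemma smooth_map_chart:
  assumes M: "manifold M" and c: "(U, c) \<in> atlas M" and i: "i < mdim M"
  shows "smooth_map (submfd M U) real_mfd (\<lambda>x. c x i)"
  unfolding smooth_map_real_iff[OF charted_submfd[OF manifold_charted[OF M] manifold_chartD(1)[OF M c]]]
proof (intro conjI allI impI)
  note M' = manifold_charted[OF M]
  have "continuous_map (subtopology (mtop M) U) (subtopology (Euclidean_space (mdim M)) (c ` U)) c"
    using manifold_chartD(3)[OF M c] homeomorphic_imp_continuous_map by blast
  then have "continuous_map (subtopology (mtop M) U) (Euclidean_space (mdim M)) c"
    by (simp add: continuous_map_in_subtopology)
  then have "continuous_map (subtopology (mtop M) U) (powertop_real UNIV) c"
    by (simp add: Euclidean_space_def continuous_map_in_subtopology)
  then show "continuous_map (mtop (submfd M U)) euclideanreal (\<lambda>x. c x i)"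
    by (simp add: continuous_map_componentwise_UNIV)
  fix V d assume "(V, d) \<in> atlas (submfd M U)"
  then obtain V0 where V0: "V = V0 \<inter> U" "(V0, d) \<in> atlas M" by (auto simp: atlas_submfd)
  from smooth_mapD_smooth_in[OF smooth_map_id[OF M] M' M' V0(2) c i]
  show "smooth_in (mdim (submfd M U)) d V (\<lambda>x. c x i)" by (simp add: V0 Int_def)
qed

lemma smooth_in_real_differentiable:
  assumes \<phi>: "smooth_in 1 real_chart W \<phi>" and W: "open W" "t \<in> W"
  obtains D where "(\<phi> has_real_derivative D) (at t)"
proof -
  obtain g where g: "Ck_on 1 1 (real_chart ` W) g" "\<And>s. s \<in> W \<Longrightarrow> g (real_chart s) = \<phi> s"
    using \<phi> unfolding smooth_in_def by blast
  have op: "openin (Euclidean_space 1) (real_chart ` W)"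
    using chartedD(3)[OF charted_real, of UNIV real_chart W] W by simp
  have "((\<lambda>s. g ((real_chart t)(0 := s))) has_real_derivative pderiv_at 0 g (real_chart t)) (at (real_chart t 0))"
    using g(1) W(2) Ck_on_Suc_pderiv[OF op, of 0 g] by auto
  moreover have "(real_chart t)(0 := s) = real_chart s" for s by auto
  ultimately have 1: "((\<lambda>s. g (real_chart s)) has_real_derivative pderiv_at 0 g (real_chart t)) (at t)"
    by simp
  have 2: "\<forall>\<^sub>F s in nhds t. g (real_chart s) = \<phi> s"
    using eventually_nhds_in_open[OF W] by eventually_elim (rule g(2))
  show thesis using DERIV_cong_ev[OF refl 2 refl, THEN iffD1, OF 1] that by blast
qed

lemma curve_germI:
  assumes M: "charted M" and I: "open I" "0 \<in> I" and \<gamma>: "smooth_map (submfd real_mfd I) M \<gamma>"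
  shows "curve_germ M \<gamma>"
proof -
  obtain \<epsilon> where e: "\<epsilon> > 0" "ball 0 \<epsilon> \<subseteq> I" using I open_contains_ball by blast
  then have "{-\<epsilon><..<\<epsilon>} \<subseteq> I" by (auto simp: subset_iff dist_real_def)
  then have "smooth_map (submfd real_mfd {-\<epsilon><..<\<epsilon>}) M \<gamma>"
    by (intro smooth_map_submfd_mono[OF charted_real M _ _ _ \<gamma>]) (use I in auto)
  then show ?thesis unfolding curve_germ_def using e by blast
qed

text \<open>The preimage of \<open>W\<close> under the curve is an open set of times containing 0,
  so the interval can be shrunk into it.\<close>

lemma curve_germE:
  assumes M: "charted M" and \<gamma>: "curve_germ M \<gamma>" and W: "openin (mtop M) W" "\<gamma> 0 \<in> W"
  obtains \<epsilon> where "\<epsilon> > 0" "smooth_map (submfd real_mfd {-\<epsilon><..<\<epsilon>}) M \<gamma>"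
    "\<And>s. s \<in> {-\<epsilon><..<\<epsilon>} \<Longrightarrow> \<gamma> s \<in> W"
proof -
  obtain e where e: "e > 0" "smooth_map (submfd real_mfd {-e<..<e}) M \<gamma>"
    using \<gamma> unfolding curve_germ_def by blast
  have "openin (subtopology euclideanreal {-e<..<e}) {s \<in> {-e<..<e}. \<gamma> s \<in> W}"
    using openin_smooth_preimage[OF e(2) W(1)] by simp
  then have "open {s \<in> {-e<..<e}. \<gamma> s \<in> W}"
    using openin_open_subtopology[of euclideanreal "{-e<..<e}"] by simp
  moreover have "0 \<in> {s \<in> {-e<..<e}. \<gamma> s \<in> W}" using e W by auto
  ultimately obtain d where d: "d > 0" "ball 0 d \<subseteq> {s \<in> {-e<..<e}. \<gamma> s \<in> W}"
    using open_contains_ball by blast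
  have sub: "{-d<..<d} \<subseteq> {s \<in> {-e<..<e}. \<gamma> s \<in> W}"
    using d(2) by (auto simp: subset_iff dist_real_def)
  show thesis
  proof
    show "smooth_map (submfd real_mfd {-d<..<d}) M \<gamma>"
      by (rule smooth_map_submfd_mono[OF charted_real M _ _ _ e(2)]) (use sub in auto)
  qed (use d sub in auto)
qed

lemma curve_germ_points: "curve_germ M \<gamma> \<Longrightarrow> \<gamma> 0 \<in> points M"
  unfolding curve_germ_def using smooth_map_in_points by fastforce

lemma curve_germ_eventually:
  assumes "charted M" "curve_germ M \<gamma>" "openin (mtop M) W" "\<gamma> 0 \<in> W"
  shows "\<forall>\<^sub>F s in nhds 0. \<gamma> s \<in> W"
proof -
  obtain \<epsilon> where e: "\<epsilon> > 0" "\<And>s. s \<in> {-\<epsilon><..<\<epsilon>} \<Longrightarrow> \<gamma> s \<in> W"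
    using curve_germE assms by metis
  have "\<forall>\<^sub>F s in nhds 0. s \<in> {-\<epsilon><..<\<epsilon>}"
    by (rule eventually_nhds_in_open) (use e in auto)
  then show ?thesis by eventually_elim (rule e(2))
qed

lemma curve_germ_compose:
  assumes M: "charted M" and N: "charted N" and \<gamma>: "curve_germ M \<gamma>"
    and W: "openin (mtop M) W" "\<gamma> 0 \<in> W" and g: "smooth_map (submfd M W) N g"
  shows "curve_germ N (\<lambda>s. g (\<gamma> s))"
proof -
  obtain \<epsilon> where e: "\<epsilon> > 0" "smooth_map (submfd real_mfd {-\<epsilon><..<\<epsilon>}) M \<gamma>"
    "\<And>s. s \<in> {-\<epsilon><..<\<epsilon>} \<Longrightarrow> \<gamma> s \<in> W"
    using curve_germE M \<gamma> W by metis
  have "smooth_map (submfd real_mfd {-\<epsilon><..<\<epsilon>}) N (\<lambda>s. g (\<gamma> s))"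
    by (rule smooth_map_compose_submfd[OF charted_interval M N W(1) e(2) _ g]) (use e(3) in auto)
  then show ?thesis unfolding curve_germ_def using e(1) by blast
qed

lemma curve_germ_compose':
  assumes M: "charted M" and N: "charted N" and \<gamma>: "curve_germ M \<gamma>" and g: "smooth_map M N g"
  shows "curve_germ N (\<lambda>s. g (\<gamma> s))"
  by (rule curve_germ_compose[OF M N \<gamma> _ curve_germ_points[OF \<gamma>] smooth_map_submfd[OF M N _ g]]) auto

lemma curve_germ_coord_differentiable:
  assumes M: "charted M" and c: "(U, c) \<in> atlas M" and \<gamma>: "curve_germ M \<gamma>" "\<gamma> 0 \<in> U" and i: "i < mdim M"
  shows "((\<lambda>s. c (\<gamma> s) i) has_real_derivative deriv (\<lambda>s. c (\<gamma> s) i) 0) (at 0)"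
proof -
  obtain \<epsilon> where e: "\<epsilon> > 0" "smooth_map (submfd real_mfd {-\<epsilon><..<\<epsilon>}) M \<gamma>"
    "\<And>s. s \<in> {-\<epsilon><..<\<epsilon>} \<Longrightarrow> \<gamma> s \<in> U"
    using curve_germE[OF M \<gamma>(1) chartedD(1)[OF M c] \<gamma>(2)] by metis
  let ?I = "{-\<epsilon><..<\<epsilon>}"
  have I: "(?I, real_chart) \<in> atlas (submfd real_mfd ?I)" by (auto simp: atlas_submfd)
  have "{s \<in> ?I. \<gamma> s \<in> U} = ?I" using e by auto
  then have "smooth_in 1 real_chart ?I (\<lambda>s. c (\<gamma> s) i)"
    using smooth_mapD_smooth_in[OF e(2) charted_interval M I c i] by simp
  then obtain D where "((\<lambda>s. c (\<gamma> s) i) has_real_derivative D) (at 0)"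
    by (rule smooth_in_real_differentiable[of ?I _ 0]) (use e(1) in auto)
  then show ?thesis by (metis DERIV_imp_deriv)
qed

text \<open>Every coordinate vector \<open>w\<close> is realized by a curve: the straight line
  through \<open>d y\<close> with slope \<open>w\<close>, read back through the chart.\<close>

lemma smooth_chart_line:
  assumes N: "manifold N" and d: "(V, d) \<in> atlas N" and y: "y \<in> V" and w: "w \<in> espace (mdim N)"
  obtains \<gamma> where "curve_germ N \<gamma>" "\<gamma> 0 = y" "\<forall>\<^sub>F s in nhds 0. \<gamma> s \<in> V"
    "\<forall>\<^sub>F s in nhds 0. d (\<gamma> s) = (\<lambda>i. d y i + s * w i)"
proof -
  note N' = manifold_charted[OF N]
  define L where "L s = (\<lambda>i. d y i + s * w i)" for s
  define \<gamma> where "\<gamma> s = inv_into V d (L s)" for s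
  note opV = chartedD(1)[OF N' d] and inj = chartedD(2)[OF N' d]
  have LE: "L s \<in> espace (mdim N)" for s
    using chart_espace[OF N' d y] w by (auto simp: L_def mem_espace)
  have contL: "continuous_on UNIV L"
    by (rule continuous_on_coordinatewise_then_product) (auto simp: L_def intro!: continuous_intros)
  have opL: "open {s. L s \<in> A}" if A: "openin (Euclidean_space (mdim N)) A" for A
  proof -
    obtain T where T: "open T" "A = T \<inter> espace (mdim N)" using A openin_Euclidean_space_open by blast
    have "{s. L s \<in> A} = L -` T" unfolding T(2) using LE by blast
    then show ?thesis using open_vimage[OF T(1) contL] by simp
  qed
  \<comment> \<open>The times at which the line is in the chart image. This set is open around 0,
    though not always an interval; \<open>curve_germI\<close> shrinks it.\<close>
  define I where "I = {s. L s \<in> d ` V}"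
  have I: "open I" "0 \<in> I"
    unfolding I_def using opL chartedD(3)[OF N' d opV] y by (auto simp: L_def)
  have \<gamma>V: "\<gamma> s \<in> V" "d (\<gamma> s) = L s" if "s \<in> I" for s
    using that unfolding I_def \<gamma>_def by (auto intro: inv_into_into simp: f_inv_into_f)
  \<comment> \<open>Injectivity of \<open>d\<close> turns membership of the curve in
    \<open>T\<close> into a condition on the line, so continuity of the curve comes from that of
    \<open>L\<close> and openness of charts.\<close>
  have \<gamma>T: "\<gamma> s \<in> T \<longleftrightarrow> L s \<in> d ` (V \<inter> T)" if "s \<in> I" for s T
  proof
    assume "L s \<in> d ` (V \<inter> T)"
    then obtain x where x: "x \<in> V" "x \<in> T" "L s = d x" by blast
    then have "\<gamma> s = x" using inj_onD[OF inj] \<gamma>V[OF that] by metis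
    then show "\<gamma> s \<in> T" using x by simp
  next
    assume "\<gamma> s \<in> T"
    then show "L s \<in> d ` (V \<inter> T)" using \<gamma>V[OF that] by (metis IntI imageI)
  qed
  have "smooth_map (submfd real_mfd I) N \<gamma>"
    unfolding smooth_map_iff[OF charted_interval[OF I(1)] N']
  proof (intro conjI allI impI)
    show "continuous_map (mtop (submfd real_mfd I)) (mtop N) \<gamma>"
      unfolding continuous_map
    proof (intro conjI allI impI)
      show "\<gamma> ` points (submfd real_mfd I) \<subseteq> points N"
        using \<gamma>V(1) openin_subset[OF opV] I by auto
      fix T assume T: "openin (mtop N) T"
      have "{s \<in> I. \<gamma> s \<in> T} = {s. L s \<in> d ` (V \<inter> T)} \<inter> I" using \<gamma>T by auto
      moreover have "open {s. L s \<in> d ` (V \<inter> T)}"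
        by (rule opL, rule chartedD(3)[OF N' d]) (use T opV in auto)
      ultimately have "open {s \<in> I. \<gamma> s \<in> T}" using I(1) by auto
      then show "openin (mtop (submfd real_mfd I)) {x \<in> points (submfd real_mfd I). \<gamma> x \<in> T}"
        using I(1) by (simp add: openin_open_subtopology subset_iff)
    qed
    fix I' r V' e i
    assume r: "(I', r) \<in> atlas (submfd real_mfd I)" and e: "(V', e) \<in> atlas N" and i: "i < mdim N"
    have r': "I' = I" "r = real_chart" using r by (auto simp: atlas_submfd)
    let ?W = "{s \<in> I. \<gamma> s \<in> V'}"
    have W: "?W = {s. L s \<in> d ` (V \<inter> V')} \<inter> I" using \<gamma>T by auto
    have opVV: "openin (Euclidean_space (mdim N)) (d ` (V \<inter> V'))"
      by (rule chartedD(3)[OF N' d]) (use opV chartedD(1)[OF N' e] in auto)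
    then have "open ?W" unfolding W using opL I(1) by auto
    then have op: "openin (Euclidean_space 1) (real_chart ` ?W)"
      using chartedD(3)[OF charted_real, of UNIV real_chart ?W] by simp
    have "smooth_in 1 real_chart ?W (\<lambda>s. ((\<lambda>x. e x i) \<circ> inv_into V d) (L s))"
    proof (rule smooth_in_compose[OF op opVV, where G = L and g = "(\<lambda>x. e x i) \<circ> inv_into V d"])
      show "Ck_on k (mdim N) (d ` (V \<inter> V')) ((\<lambda>x. e x i) \<circ> inv_into V d)" for k
        using smooth_in_imp_Ck_on[OF _ inj _ opVV]
          smooth_mapD_smooth_in[OF smooth_map_id[OF N] N' N' d e i] by (auto simp: Int_def)
      have "Ck_on k 1 (real_chart ` ?W) (\<lambda>z. d y j + z 0 * w j)" for k j
        by (intro Ck_on_add Ck_on_mult Ck_on_const Ck_on_coord openin_Euclidean_space_subset[OF op])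
      then show "smooth_in 1 real_chart ?W (\<lambda>s. L s j)" for j
        unfolding smooth_in_def L_def by (intro exI[of _ "\<lambda>z. d y j + z 0 * w j"]) auto
      show "inj_on real_chart ?W" by (rule inj_onI) (metis (full_types))
      show "L s \<in> d ` (V \<inter> V')" if "s \<in> ?W" for s using that W by blast
    qed
    then have "smooth_in 1 real_chart ?W (\<lambda>s. e (\<gamma> s) i)"
      by (rule smooth_in_cong) (simp add: \<gamma>_def)
    then show "smooth_in (mdim (submfd real_mfd I)) r {x \<in> I'. \<gamma> x \<in> V'} (\<lambda>x. e (\<gamma> x) i)"
      by (simp add: r')
  qed
  then have 1: "curve_germ N \<gamma>" using curve_germI[OF N' I] by blast
  have 2: "\<gamma> 0 = y" using inj y by (simp add: \<gamma>_def L_def)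
  have ev: "\<forall>\<^sub>F s in nhds 0. s \<in> I" using I eventually_nhds_in_open by blast
  then have 3: "\<forall>\<^sub>F s in nhds 0. \<gamma> s \<in> V" by eventually_elim (rule \<gamma>V)
  from ev have 4: "\<forall>\<^sub>F s in nhds 0. d (\<gamma> s) = L s" by eventually_elim (rule \<gamma>V)
  show thesis by (rule that[OF 1 2 3 4[unfolded L_def]])
qed

subsection \<open>Tangent vectors\<close>

text \<open>Guarantees that a test function pulled back along \<open>g\<close> is still one on which
  \<open>velocity\<close> and \<open>tmap\<close> take their genuine values and not the default
  0.\<close>

lemma smooth_near_compose:
  assumes M: "charted M" and N: "charted N" and W: "openin (mtop M) W" "x \<in> W"
    and g: "smooth_map (submfd M W) N g" and \<phi>: "smooth_near N (g x) \<phi>"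
  shows "smooth_near M x (\<phi> \<circ> g)"
proof -
  obtain U where U: "openin (mtop N) U" "g x \<in> U" "smooth_map (submfd N U) real_mfd \<phi>"
    using \<phi> unfolding smooth_near_def by blast
  have "openin (subtopology (mtop M) W) {y \<in> W. g y \<in> U}"
    using openin_smooth_preimage[OF g U(1)] unfolding points_submfd[OF W(1)] by simp
  then have op: "openin (mtop M) {y \<in> W. g y \<in> U}" using W(1) openin_open_subtopology by blast
  have "smooth_map (submfd M {y \<in> W. g y \<in> U}) real_mfd (\<lambda>y. \<phi> (g y))"
  proof (rule smooth_map_compose_submfd[OF charted_submfd[OF M op] N charted_real U(1) _ _ U(3)])
    show "smooth_map (submfd M {y \<in> W. g y \<in> U}) N g"
      by (rule smooth_map_submfd_mono[OF M N W(1) op _ g]) auto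
  qed (use op in auto)
  then show ?thesis
    unfolding smooth_near_def using op W(2) U(2) by (intro exI[of _ "{y \<in> W. g y \<in> U}"]) (auto simp: o_def)
qed

lemma smooth_near_compose':
  assumes M: "charted M" and N: "charted N" and x: "x \<in> points M"
    and g: "smooth_map M N g" and \<phi>: "smooth_near N (g x) \<phi>"
  shows "smooth_near M x (\<phi> \<circ> g)"
  by (rule smooth_near_compose[OF M N _ x smooth_map_submfd[OF M N _ g] \<phi>]) auto

lemma velocity_cong:
  assumes "\<forall>\<^sub>F s in nhds t. \<gamma> s = \<gamma>' s"
  shows "velocity M \<gamma> t = velocity (M :: 'a mfd) \<gamma>' t"
proof
  fix \<phi> :: "'a \<Rightarrow> real"
  have "\<forall>\<^sub>F s in nhds t. \<phi> (\<gamma> s) = \<phi> (\<gamma>' s)"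
    using assms by eventually_elim simp
  then have "deriv (\<lambda>s. \<phi> (\<gamma> s)) t = deriv (\<lambda>s. \<phi> (\<gamma>' s)) t" by (intro deriv_cong_ev) auto
  moreover have "\<gamma> t = \<gamma>' t" using assms eventually_nhds_x_imp_x by blast
  ultimately show "velocity M \<gamma> t \<phi> = velocity M \<gamma>' t \<phi>" by (simp add: velocity_def)
qed

lemma tmap_velocity:
  assumes "charted M" "charted N" "openin (mtop M) W" "\<gamma> t \<in> W" "smooth_map (submfd M W) N g"
  shows "tmap N g (\<gamma> t) (velocity M \<gamma> t) = velocity N (\<lambda>s. g (\<gamma> s)) t"
proof
  fix \<phi>
  show "tmap N g (\<gamma> t) (velocity M \<gamma> t) \<phi> = velocity N (\<lambda>s. g (\<gamma> s)) t \<phi>"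
    using smooth_near_compose[OF assms, of \<phi>] by (simp add: tmap_def velocity_def)
qed

lemma tmap_velocity':
  assumes "charted M" "charted N" "\<gamma> t \<in> points M" "smooth_map M N g"
  shows "tmap N g (\<gamma> t) (velocity M \<gamma> t) = velocity N (\<lambda>s. g (\<gamma> s)) t"
  by (rule tmap_velocity[where W = "points M"]) (use assms in \<open>auto intro: smooth_map_submfd simp del: submfd_simps\<close>)

text \<open>The chain rule for the coordinate expression of \<open>\<phi>\<close> along the
  coordinate curve. For a fixed base point the velocity thus depends linearly on the derivatives of
  the chart coordinates, and on nothing else of the curve.\<close>

lemma velocity_in_chart:
  assumes M: "charted M" and c: "(U, c) \<in> atlas M" and \<gamma>: "curve_germ M \<gamma>" "\<gamma> 0 \<in> U"
    and \<phi>: "smooth_near M (\<gamma> 0) \<phi>"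
  shows "velocity M \<gamma> 0 \<phi> =
    (\<Sum>j<mdim M. pderiv_at j (\<phi> \<circ> inv_into U c) (c (\<gamma> 0)) * deriv (\<lambda>s. c (\<gamma> s) j) 0)"
proof -
  obtain W where W: "openin (mtop M) W" "\<gamma> 0 \<in> W" "smooth_map (submfd M W) real_mfd \<phi>"
    using \<phi> unfolding smooth_near_def by blast
  have opUW: "openin (mtop M) (U \<inter> W)" using chartedD(1)[OF M c] W(1) by auto
  have op: "openin (Euclidean_space (mdim M)) (c ` (U \<inter> W))"
    by (rule chartedD(3)[OF M c opUW]) auto
  have "(U \<inter> W, c) \<in> atlas (submfd M W)" using c by (auto simp: atlas_submfd)
  then have "smooth_in (mdim M) c (U \<inter> W) \<phi>"
    using W(3) smooth_map_real_iff[OF charted_submfd[OF M W(1)]] by auto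
  then have Ck: "Ck_on 1 (mdim M) (c ` (U \<inter> W)) (\<phi> \<circ> inv_into U c)"
    using smooth_in_imp_Ck_on[OF _ chartedD(2)[OF M c] _ op] by blast
  have ev: "\<forall>\<^sub>F s in nhds 0. \<gamma> s \<in> U"
    using curve_germ_eventually[OF M \<gamma>(1) chartedD(1)[OF M c] \<gamma>(2)] .
  have 1: "((\<lambda>s. (\<phi> \<circ> inv_into U c) (c (\<gamma> s))) has_real_derivative
      (\<Sum>j<mdim M. pderiv_at j (\<phi> \<circ> inv_into U c) (c (\<gamma> 0)) * deriv (\<lambda>s. c (\<gamma> s) j) 0)) (at 0)"
  proof (rule has_real_derivative_along_curve[OF op Ck, where G = "\<lambda>s. c (\<gamma> s)"])
    show "c (\<gamma> 0) \<in> c ` (U \<inter> W)" using \<gamma>(2) W(2) by blast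
    show "\<forall>\<^sub>F s in nhds 0. c (\<gamma> s) \<in> espace (mdim M)"
      using ev by eventually_elim (rule chart_espace[OF M c])
  qed (rule curve_germ_coord_differentiable[OF M c \<gamma>])
  have 2: "\<forall>\<^sub>F s in nhds 0. (\<phi> \<circ> inv_into U c) (c (\<gamma> s)) = \<phi> (\<gamma> s)"
    using ev by eventually_elim (use chartedD(2)[OF M c] in auto)
  show ?thesis
    using DERIV_imp_deriv[OF DERIV_cong_ev[OF refl 2 refl, THEN iffD1, OF 1]] \<phi> by (simp add: velocity_def)
qed

text \<open>Recognizes a difference of tangent vectors as the velocity of a curve by comparing
  finitely many coordinate derivatives.\<close>

lemma velocity_diff_in_chart:
  assumes M: "charted M" and c: "(U, c) \<in> atlas M" and z: "z \<in> U"
    and \<gamma>: "curve_germ M \<gamma>\<^sub>1" "curve_germ M \<gamma>\<^sub>2" "curve_germ M \<gamma>\<^sub>3" "\<gamma>\<^sub>1 0 = z" "\<gamma>\<^sub>2 0 = z" "\<gamma>\<^sub>3 0 = z"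
    and D: "\<And>j. j < mdim M \<Longrightarrow>
      deriv (\<lambda>s. c (\<gamma>\<^sub>3 s) j) 0 = deriv (\<lambda>s. c (\<gamma>\<^sub>1 s) j) 0 - deriv (\<lambda>s. c (\<gamma>\<^sub>2 s) j) 0"
  shows "(\<lambda>\<phi>. velocity M \<gamma>\<^sub>1 0 \<phi> - velocity M \<gamma>\<^sub>2 0 \<phi>) = velocity M \<gamma>\<^sub>3 0"
proof
  fix \<phi>
  show "velocity M \<gamma>\<^sub>1 0 \<phi> - velocity M \<gamma>\<^sub>2 0 \<phi> = velocity M \<gamma>\<^sub>3 0 \<phi>"
  proof (cases "smooth_near M z \<phi>")
    case True
    then show ?thesis
      using velocity_in_chart[OF M c, of \<gamma>\<^sub>1 \<phi>] velocity_in_chart[OF M c, of \<gamma>\<^sub>2 \<phi>]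
        velocity_in_chart[OF M c, of \<gamma>\<^sub>3 \<phi>] \<gamma> z D
      by (simp add: sum_subtractf[symmetric] right_diff_distrib)
  \<comment> \<open>On test functions not smooth near \<open>z\<close> all three velocities have the
    default value 0.\<close>
  qed (use \<gamma> in \<open>simp add: velocity_def\<close>)
qed

section \<open>Associated bundles\<close>

lemma openin_smooth_preimage_submfd:
  assumes "openin (mtop M) U" "smooth_map (submfd M U) N f" "openin (mtop N) W"
  shows "openin (mtop M) {x \<in> U. f x \<in> W}"
  using openin_smooth_preimage[OF assms(2,3)] assms(1) openin_open_subtopology[of "mtop M" U]
  unfolding points_submfd[OF assms(1)] by simp

section \<open>Principal bundles and their local sections\<close>

locale principal =
  fixes P :: "('p, 'm, 'g) principal_bundle"
  assumes principal: "is_principal_bundle P"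
begin

abbreviation G where "G \<equiv> pb_group P"
abbreviation E where "E \<equiv> pb_total P"
abbreviation M where "M \<equiv> pb_base P"

lemma manifolds: "manifold E" "manifold M" "manifold (grp_mfd G)"
  and G_group: "group G" and points_G: "points (grp_mfd G) = carrier G"
  using principal unfolding is_principal_bundle_def is_lie_group_def by auto

lemma charteds: "charted E" "charted M" "charted (grp_mfd G)"
  using manifolds manifold_charted by auto

lemma proj_smooth: "smooth_map E M (pb_proj P)"
  and action_smooth: "smooth_map (prod_mfd E (grp_mfd G)) E (\<lambda>(p, a). pb_act P p a)"
  using principal unfolding is_principal_bundle_def by auto

lemma act_one: "p \<in> points E \<Longrightarrow> pb_act P p \<one>\<^bsub>G\<^esub> = p"
  and act_mult: "p \<in> points E \<Longrightarrow> a \<in> carrier G \<Longrightarrow> b \<in> carrier G \<Longrightarrow>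
      pb_act P p (a \<otimes>\<^bsub>G\<^esub> b) = pb_act P (pb_act P p a) b"
  and proj_act: "p \<in> points E \<Longrightarrow> a \<in> carrier G \<Longrightarrow> pb_proj P (pb_act P p a) = pb_proj P p"
  using principal unfolding is_principal_bundle_def by auto

lemma act_closed: "p \<in> points E \<Longrightarrow> a \<in> carrier G \<Longrightarrow> pb_act P p a \<in> points E"
  using smooth_map_in_points[OF action_smooth, of "(p, a)"] by (simp add: points_G)

lemma act_smooth: 
  assumes "a \<in> carrier G"
  shows "smooth_map E E (\<lambda>p. pb_act P p a)"
proof -
  have "smooth_map E E (\<lambda>p. (\<lambda>(p, a). pb_act P p a) (p, a))"
    by (rule smooth_map_compose'[OF charteds(1) charted_prod[OF charteds(1,3)] charteds(1) _ action_smooth],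
        rule smooth_map_pair[OF charteds(1,1,3) smooth_map_id smooth_map_const])
      (use assms manifolds charteds points_G in auto)
  then show ?thesis by simp
qed

lemma proj_closed: "p \<in> points E \<Longrightarrow> pb_proj P p \<in> points M"
  using smooth_map_in_points[OF proj_smooth] .

lemma triv_exists:
  assumes "x \<in> points M"
  obtains U \<psi> where "x \<in> U" "equivariant_triv P U \<psi>"
  using assms principal unfolding is_principal_bundle_def by blast

lemma openin_over:
  "equivariant_triv P U \<psi> \<Longrightarrow> openin (mtop M) U"
  "equivariant_triv P U \<psi> \<Longrightarrow> openin (mtop E) {p \<in> points E. pb_proj P p \<in> U}"
  using openin_smooth_preimage[OF proj_smooth] unfolding equivariant_triv_def local_triv_def by auto

lemma triv_act:
  assumes "equivariant_triv P U \<psi>" "p \<in> points E" "pb_proj P p \<in> U" "a \<in> carrier G"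
  shows "snd (\<psi> (pb_act P p a)) = snd (\<psi> p) \<otimes>\<^bsub>G\<^esub> a"
  using assms unfolding equivariant_triv_def by blast

lemma triv_smooth:
  assumes t: "equivariant_triv P U \<psi>"
  shows "smooth_map (submfd E {p \<in> points E. pb_proj P p \<in> U}) (grp_mfd G) (\<lambda>p. snd (\<psi> p))"
proof -
  note op = openin_over[OF t]
  have "smooth_map (submfd E {p \<in> points E. pb_proj P p \<in> U}) (prod_mfd (submfd M U) (grp_mfd G)) \<psi>"
    using t unfolding equivariant_triv_def local_triv_def diffeo_def by blast
  from smooth_map_compose'[OF charted_submfd[OF charteds(1) op(2)]
      charted_prod[OF charted_submfd[OF charteds(2) op(1)] charteds(3)] charteds(3) this
      smooth_map_snd[OF charted_submfd[OF charteds(2) op(1)] manifolds(3)]]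
  show ?thesis .
qed

lemma triv_closed:
  assumes "equivariant_triv P U \<psi>" "p \<in> points E" "pb_proj P p \<in> U"
  shows "snd (\<psi> p) \<in> carrier G"
  using smooth_map_in_points[OF triv_smooth[OF assms(1)], of p] assms points_submfd[OF openin_over(2)[OF assms(1)]]
  by (simp add: points_G)

text \<open>A trivialization is invertible over \<open>U\<close> and its first component is the base
  point, so base point and group coordinate together determine \<open>p\<close>.\<close>

lemma triv_inj:
  assumes t: "equivariant_triv P U \<psi>" and p: "p \<in> points E" "pb_proj P p \<in> U"
    and q: "q \<in> points E" "pb_proj P q = pb_proj P p" and eq: "snd (\<psi> p) = snd (\<psi> q)"
  shows "p = q"
proof -
  let ?O = "{p \<in> points E. pb_proj P p \<in> U}"
  have "diffeo (submfd E ?O) (prod_mfd (submfd M U) (grp_mfd G)) \<psi>" 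
    and f: "\<And>p. p \<in> points E \<Longrightarrow> pb_proj P p \<in> U \<Longrightarrow> fst (\<psi> p) = pb_proj P p"
    using t unfolding equivariant_triv_def local_triv_def by blast+
  then obtain h where h: "\<And>p. p \<in> points (submfd E ?O) \<Longrightarrow> h (\<psi> p) = p"
    unfolding diffeo_def by blast
  have "\<psi> p = \<psi> q" using f[of p] f[of q] p q eq by (simp add: prod_eq_iff)
  moreover have "p \<in> points (submfd E ?O)" "q \<in> points (submfd E ?O)"
    using p q unfolding points_submfd[OF openin_over(2)[OF t]] by auto
  ultimately show ?thesis using h by metis
qed

text \<open>The inverse of the trivialization evaluated at the constant group coordinate 1.\<close>

lemma unit_section:
  assumes t: "equivariant_triv P U \<psi>"
  obtains \<sigma> where "smooth_map (submfd M U) E \<sigma>"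
    "\<And>x. x \<in> U \<Longrightarrow> \<sigma> x \<in> points E" "\<And>x. x \<in> U \<Longrightarrow> pb_proj P (\<sigma> x) = x"
    "\<And>x. x \<in> U \<Longrightarrow> snd (\<psi> (\<sigma> x)) = \<one>\<^bsub>G\<^esub>"
proof -
  interpret group G by (rule G_group)
  note op = openin_over[OF t]
  let ?O = "{p \<in> points E. pb_proj P p \<in> U}"
  note MU = charted_submfd[OF charteds(2) op(1)] and EO = charted_submfd[OF charteds(1) op(2)]
  have "diffeo (submfd E ?O) (prod_mfd (submfd M U) (grp_mfd G)) \<psi>" 
    and f: "\<And>p. p \<in> points E \<Longrightarrow> pb_proj P p \<in> U \<Longrightarrow> fst (\<psi> p) = pb_proj P p"
    using t unfolding equivariant_triv_def local_triv_def by blast+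
  then obtain h where h: "smooth_map (prod_mfd (submfd M U) (grp_mfd G)) (submfd E ?O) h"
    "\<And>z. z \<in> points (prod_mfd (submfd M U) (grp_mfd G)) \<Longrightarrow> \<psi> (h z) = z"
    unfolding diffeo_def by blast
  define \<sigma> where "\<sigma> x = h (x, \<one>\<^bsub>G\<^esub>)" for x
  have z: "(x, \<one>\<^bsub>G\<^esub>) \<in> points (prod_mfd (submfd M U) (grp_mfd G))" if "x \<in> U" for x
    using that openin_subset[OF op(1)] points_G by auto
  have sO: "\<sigma> x \<in> ?O" if "x \<in> U" for x
    using smooth_map_in_points[OF h(1) z[OF that]] unfolding points_submfd[OF op(2)] \<sigma>_def .
  have \<psi>: "\<psi> (\<sigma> x) = (x, \<one>\<^bsub>G\<^esub>)" if "x \<in> U" for x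
    using h(2)[OF z[OF that]] by (simp add: \<sigma>_def)
  have \<pi>: "pb_proj P (\<sigma> x) = x" if "x \<in> U" for x
    using f[of "\<sigma> x"] sO[OF that] \<psi>[OF that] by simp
  have "smooth_map (submfd M U) (submfd E ?O) \<sigma>"
    unfolding \<sigma>_def
    by (rule smooth_map_compose'[OF MU charted_prod[OF MU charteds(3)] EO _ h(1)],
        rule smooth_map_pair[OF MU MU charteds(3) _ smooth_map_const[OF MU charteds(3)]],
        rule smooth_map_into_submfd[OF MU charteds(2) op(1) smooth_map_incl[OF manifolds(2) op(1)]])
      (auto simp: points_G)
  then have "smooth_map (submfd M U) E \<sigma>" by (rule smooth_map_from_submfd[OF MU charteds(1) op(2)])
  then show thesis
    by (rule that) (use sO \<psi> f in \<open>auto simp: \<pi>\<close>)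
qed

text \<open>\<open>S\<close> is \<open>points N\<close> for an action on a manifold and the carrier \<open>V\<close> for a representation.\<close>

lemma assoc_class_act:
  assumes one: "\<And>y. y \<in> S \<Longrightarrow> l \<one>\<^bsub>G\<^esub> y = y"
    and mult: "\<And>a b y. a \<in> carrier G \<Longrightarrow> b \<in> carrier G \<Longrightarrow> y \<in> S \<Longrightarrow> l (a \<otimes>\<^bsub>G\<^esub> b) y = l a (l b y)"
    and p: "p \<in> points E" and a: "a \<in> carrier G" and y: "y \<in> S"
  shows "assoc_class P l (pb_act P p a) (l (inv\<^bsub>G\<^esub> a) y) = assoc_class P l p y"
proof -
  interpret group G by (rule G_group)
  have eq: "(pb_act P (pb_act P p a) b, l (inv\<^bsub>G\<^esub> b) (l (inv\<^bsub>G\<^esub> a) y)) =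
      (pb_act P p (a \<otimes>\<^bsub>G\<^esub> b), l (inv\<^bsub>G\<^esub> (a \<otimes>\<^bsub>G\<^esub> b)) y)" if "b \<in> carrier G" for b
    using that p a y act_mult mult by (simp add: inv_mult_group)
  \<comment> \<open>Left translation by \<open>a\<close> permutes the group, so it only
    reparametrizes the orbit.\<close>
  have "(\<lambda>b. a \<otimes>\<^bsub>G\<^esub> b) ` carrier G = carrier G"
    using a surj_const_mult by auto
  then have "assoc_class P l p y = (\<lambda>b. (pb_act P p b, l (inv\<^bsub>G\<^esub> b) y)) ` (\<lambda>b. a \<otimes>\<^bsub>G\<^esub> b) ` carrier G"
    by (simp add: assoc_class_def)
  also have "\<dots> = assoc_class P l (pb_act P p a) (l (inv\<^bsub>G\<^esub> a) y)"
    unfolding assoc_class_def image_image by (rule image_cong) (use eq in auto)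
  finally show ?thesis ..
qed

end

locale associated = principal P for P :: "('p, 'm, 'g) principal_bundle" +
  fixes N :: "'n mfd" and l :: "'g \<Rightarrow> 'n \<Rightarrow> 'n"
  assumes N: "manifold N" and left_action: "left_action (pb_group P) N l"
begin

abbreviation EN where "EN \<equiv> prod_mfd E N"
abbreviation MN where "MN \<equiv> prod_mfd M N"
abbreviation A where "A \<equiv> assoc_mfd P N l"
abbreviation cls where "cls \<equiv> assoc_class P l"
abbreviation quot where "quot \<equiv> \<lambda>(p, y). assoc_class P l p y"

lemma charted_N: "charted N" and charted_EN: "charted EN" and charted_MN: "charted MN"
  using N manifold_charted charted_prod charteds by auto

lemma left_one: "y \<in> points N \<Longrightarrow> l \<one>\<^bsub>G\<^esub> y = y"
  and left_mult: "a \<in> carrier G \<Longrightarrow> b \<in> carrier G \<Longrightarrow> y \<in> points N \<Longrightarrow> l (a \<otimes>\<^bsub>G\<^esub> b) y = l a (l b y)"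
  and action_N_smooth: "smooth_map (prod_mfd (grp_mfd G) N) N (\<lambda>(a, y). l a y)"
  using left_action unfolding left_action_def by auto

lemma l_closed: "a \<in> carrier G \<Longrightarrow> y \<in> points N \<Longrightarrow> l a y \<in> points N"
  using smooth_map_in_points[OF action_N_smooth, of "(a, y)"] by (simp add: points_G)

lemma left_inverse: "a \<in> carrier G \<Longrightarrow> y \<in> points N \<Longrightarrow> l (inv\<^bsub>G\<^esub> a) (l a y) = y"
  "a \<in> carrier G \<Longrightarrow> y \<in> points N \<Longrightarrow> l a (l (inv\<^bsub>G\<^esub> a) y) = y"
proof -
  interpret group G by (rule G_group)
  show "a \<in> carrier G \<Longrightarrow> y \<in> points N \<Longrightarrow> l (inv\<^bsub>G\<^esub> a) (l a y) = y"
    "a \<in> carrier G \<Longrightarrow> y \<in> points N \<Longrightarrow> l a (l (inv\<^bsub>G\<^esub> a) y) = y"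
    by (simp_all add: left_mult[symmetric] left_one)
qed

lemma l_smooth2:
  assumes K: "charted K" and a: "smooth_map K (grp_mfd G) a" and y: "smooth_map K N y"
  shows "smooth_map K N (\<lambda>x. l (a x) (y x))"
  using smooth_map_compose'[OF K charted_prod[OF charteds(3) charted_N] charted_N
      smooth_map_pair[OF K charteds(3) charted_N a y] action_N_smooth] by simp

lemma l_smooth: "a \<in> carrier G \<Longrightarrow> smooth_map N N (l a)"
  using l_smooth2[OF charted_N smooth_map_const[OF charted_N charteds(3)] smooth_map_id[OF N]] points_G by simp

lemma cls_act:
  assumes "p \<in> points E" "a \<in> carrier G" "y \<in> points N"
  shows "cls (pb_act P p a) (l (inv\<^bsub>G\<^esub> a) y) = cls p y"
  by (rule assoc_class_act[of "points N"]) (use assms left_one left_mult in auto)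

lemma mem_cls_self: "p \<in> points E \<Longrightarrow> y \<in> points N \<Longrightarrow> (p, y) \<in> cls p y"
proof -
  interpret group G by (rule G_group)
  show "p \<in> points E \<Longrightarrow> y \<in> points N \<Longrightarrow> (p, y) \<in> cls p y"
    unfolding assoc_class_def by (rule image_eqI[of _ _ "\<one>\<^bsub>G\<^esub>"]) (auto simp: act_one left_one)
qed

lemma cls_eqD:
  assumes "q \<in> points E" "n \<in> points N" "cls p y = cls q n"
  obtains a where "a \<in> carrier G" "q = pb_act P p a" "n = l (inv\<^bsub>G\<^esub> a) y"
proof -
  have "(q, n) \<in> cls p y" using mem_cls_self[OF assms(1,2)] unfolding assms(3) .
  then show thesis using that unfolding assoc_class_def by auto
qed

text \<open>Functions on the associated bundle are defined through a representative picked by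
  \<open>SOME\<close>. Every member of the class has the form
  \<open>(pb_act P p a, l (inv a) y)\<close>, so invariance makes the choice irrelevant.\<close>

lemma cls_choice:
  assumes p: "p \<in> points E" and y: "y \<in> points N"
    and inv: "\<And>a. a \<in> carrier G \<Longrightarrow> H (pb_act P p a) (l (inv\<^bsub>G\<^esub> a) y) = H p y"
  shows "(case SOME q. q \<in> cls p y of (p, y) \<Rightarrow> H p y) = H p y"
proof -
  have "(SOME q. q \<in> cls p y) \<in> cls p y" using mem_cls_self[OF p y] by (rule someI)
  then show ?thesis using inv unfolding assoc_class_def by auto
qed

section \<open>Topology and atlas of the associated bundle\<close>

lemma assoc_simps: "mdim A = mdim M + mdim N"
  by (simp add: assoc_mfd_def)

text \<open>Taking preimages under \<open>quot\<close> commutes with unions and finite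
  intersections, so the predicate in \<open>assoc_mfd\<close> really is a topology, and only then
  does \<open>topology\<close> return it.\<close>

lemma openin_assoc:
  "openin (mtop A) W \<longleftrightarrow> W \<subseteq> assoc_space P N l \<and> openin (mtop EN) {w \<in> points EN. quot w \<in> W}"
proof -
  have eq: "{(p, y). p \<in> points E \<and> y \<in> points N \<and> cls p y \<in> W} = {w \<in> points EN. quot w \<in> W}" for W
    by auto
  have "istopology (\<lambda>W. W \<subseteq> assoc_space P N l \<and> openin (mtop EN) {w \<in> points EN. quot w \<in> W})"
    unfolding istopology_def
  proof (intro conjI allI impI)
    fix S T assume "S \<subseteq> assoc_space P N l \<and> openin (mtop EN) {w \<in> points EN. quot w \<in> S}"
      "T \<subseteq> assoc_space P N l \<and> openin (mtop EN) {w \<in> points EN. quot w \<in> T}"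
    moreover have "{w \<in> points EN. quot w \<in> S \<inter> T} =
        {w \<in> points EN. quot w \<in> S} \<inter> {w \<in> points EN. quot w \<in> T}" by auto
    ultimately show "S \<inter> T \<subseteq> assoc_space P N l" "openin (mtop EN) {w \<in> points EN. quot w \<in> S \<inter> T}"
      by (auto simp del: prod_mfd_simps)
  next
    fix \<K> assume "\<forall>S\<in>\<K>. S \<subseteq> assoc_space P N l \<and> openin (mtop EN) {w \<in> points EN. quot w \<in> S}"
    moreover have "{w \<in> points EN. quot w \<in> \<Union>\<K>} = (\<Union>S\<in>\<K>. {w \<in> points EN. quot w \<in> S})" by auto
    ultimately show "\<Union>\<K> \<subseteq> assoc_space P N l" "openin (mtop EN) {w \<in> points EN. quot w \<in> \<Union>\<K>}"
      by (auto simp del: prod_mfd_simps)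
  qed
  then show ?thesis by (simp add: assoc_mfd_def eq topology_inverse' del: topspace_prod_topology)
qed

lemma cls_in_space: "p \<in> points E \<Longrightarrow> y \<in> points N \<Longrightarrow> cls p y \<in> assoc_space P N l"
  unfolding assoc_space_def by blast

lemma assoc_spaceE:
  assumes "z \<in> assoc_space P N l"
  obtains p y where "p \<in> points E" "y \<in> points N" "z = cls p y"
  using assms unfolding assoc_space_def by blast

lemma points_assoc: "points A = assoc_space P N l"
proof
  show "points A \<subseteq> assoc_space P N l" using openin_assoc openin_topspace by metis
  have "{w \<in> points EN. quot w \<in> assoc_space P N l} = points EN"
    using cls_in_space by auto
  then have "openin (mtop A) (assoc_space P N l)"
    unfolding openin_assoc using openin_topspace[of "mtop EN"] by (simp del: prod_mfd_simps)
  then show "assoc_space P N l \<subseteq> points A" by (rule openin_subset)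
qed

lemma quot_continuous: "continuous_map (mtop EN) (mtop A) quot"
  unfolding continuous_map points_assoc using openin_assoc cls_in_space by auto

definition over where "over U = {w \<in> points EN. pb_proj P (fst w) \<in> U}"
text \<open>The trivialization of the associated bundle over \<open>U\<close>, lifted to
  \<open>E \<times> N\<close>; it is constant on orbits by \<open>triv_l_act\<close>. Working with
  the lift avoids choosing representatives.\<close>

definition triv_map where "triv_map \<psi> = (\<lambda>(p, y). (pb_proj P p, l (snd (\<psi> p)) y))"
definition chart_dom where
  "chart_dom U \<psi> V W = {cls p y | p y. p \<in> points E \<and> pb_proj P p \<in> U \<inter> V \<and> y \<in> points N \<and> l (snd (\<psi> p)) y \<in> W}"
definition chart_map where
  "chart_map \<psi> c d = (\<lambda>z. case SOME q. q \<in> z of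
     (p, y) \<Rightarrow> coord_join (mdim M) (c (pb_proj P p)) (d (l (snd (\<psi> p)) y)))"

lemma atlas_assoc: "atlas A = {(chart_dom U \<psi> V W, chart_map \<psi> c d) | U \<psi> V c W d.
    equivariant_triv P U \<psi> \<and> (V, c) \<in> atlas M \<and> (W, d) \<in> atlas N}"
  by (simp add: assoc_mfd_def chart_dom_def chart_map_def)

text \<open>The group coordinate of \<open>pb_act P p a\<close> is that of \<open>p\<close> times
  \<open>a\<close>, and this \<open>a\<close> cancels against the inverse acting on
  \<open>y\<close>.\<close>

lemma triv_l_act:
  assumes t: "equivariant_triv P U \<psi>" and p: "p \<in> points E" "pb_proj P p \<in> U" and y: "y \<in> points N"
    and a: "a \<in> carrier G"
  shows "l (snd (\<psi> (pb_act P p a))) (l (inv\<^bsub>G\<^esub> a) y) = l (snd (\<psi> p)) y"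
proof -
  interpret group G by (rule G_group)
  show ?thesis
    using triv_act[OF t p a] triv_closed[OF t p] a y by (simp add: left_mult l_closed left_inverse)
qed

text \<open>\<open>chart_dom\<close> asks for some representative with the stated properties; by
  invariance any given one can be tested instead.\<close>

lemma mem_chart_dom:
  assumes t: "equivariant_triv P U \<psi>" and p: "p \<in> points E" and y: "y \<in> points N"
  shows "cls p y \<in> chart_dom U \<psi> V W \<longleftrightarrow> pb_proj P p \<in> U \<inter> V \<and> l (snd (\<psi> p)) y \<in> W"
proof
  assume "cls p y \<in> chart_dom U \<psi> V W"
  then obtain q n where q: "cls q n = cls p y" "q \<in> points E" "pb_proj P q \<in> U \<inter> V" "n \<in> points N"
    "l (snd (\<psi> q)) n \<in> W" unfolding chart_dom_def by auto
  obtain a where a: "a \<in> carrier G" "p = pb_act P q a" "y = l (inv\<^bsub>G\<^esub> a) n"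
    by (rule cls_eqD[OF p y q(1)])
  show "pb_proj P p \<in> U \<inter> V \<and> l (snd (\<psi> p)) y \<in> W"
    using q a proj_act triv_l_act[OF t q(2)] by auto
qed (use p y in \<open>auto simp: chart_dom_def\<close>)

lemma chart_map_cls:
  assumes t: "equivariant_triv P U \<psi>" and p: "p \<in> points E" "pb_proj P p \<in> U" and y: "y \<in> points N"
  shows "chart_map \<psi> c d (cls p y) = coord_join (mdim M) (c (pb_proj P p)) (d (l (snd (\<psi> p)) y))"
  unfolding chart_map_def
  by (rule cls_choice[OF p(1) y]) (use triv_l_act[OF t p y] proj_act[OF p(1)] in simp)

lemma openin_over_EN:
  assumes t: "equivariant_triv P U \<psi>"
  shows "openin (mtop EN) (over U)"
  unfolding over_def
  using openin_smooth_preimage[OF smooth_map_compose'[OF charted_EN charteds(1,2)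
      smooth_map_fst[OF manifolds(1) charted_N] proj_smooth] openin_over(1)[OF t]] .

lemma triv_map_smooth:
  assumes t: "equivariant_triv P U \<psi>"
  shows "smooth_map (submfd EN (over U)) MN (triv_map \<psi>)"
proof -
  note opo = openin_over_EN[OF t]
  note K = charted_submfd[OF charted_EN opo]
  have f: "smooth_map (submfd EN (over U)) E fst"
    by (rule smooth_map_submfd[OF charted_EN charteds(1) opo smooth_map_fst[OF manifolds(1) charted_N]])
  have s: "smooth_map (submfd EN (over U)) N snd"
    by (rule smooth_map_submfd[OF charted_EN charted_N opo smooth_map_snd[OF charteds(1) N]])
  have g: "smooth_map (submfd EN (over U)) (grp_mfd G) (\<lambda>w. snd (\<psi> (fst w)))"
    by (rule smooth_map_compose_submfd[OF K charteds(1,3) openin_over(2)[OF t] f _ triv_smooth[OF t]])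
      (auto simp: over_def)
  have "smooth_map (submfd EN (over U)) MN (\<lambda>w. (pb_proj P (fst w), l (snd (\<psi> (fst w))) (snd w)))"
    by (intro smooth_map_pair[OF K charteds(2) charted_N] l_smooth2[OF K g s]
        smooth_map_compose'[OF K charteds(1,2) f proj_smooth])
  then show ?thesis by (simp add: triv_map_def case_prod_beta')
qed

lemma openin_Times_N: "openin (mtop M) U \<Longrightarrow> openin (mtop MN) (U \<times> points N)"
  by (simp add: openin_prod_Times_iff)

text \<open>A local section of \<open>E\<close> through the unit of \<open>G\<close> inverts the trivialization of the associated bundle.\<close>

lemma triv_map_section:
  assumes t: "equivariant_triv P U \<psi>"
  obtains s where "smooth_map (submfd MN (U \<times> points N)) EN s"
    "\<And>w. w \<in> U \<times> points N \<Longrightarrow> s w \<in> over U"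
    "\<And>w. w \<in> U \<times> points N \<Longrightarrow> triv_map \<psi> (s w) = w"
    "\<And>w. w \<in> over U \<Longrightarrow> quot (s (triv_map \<psi> w)) = quot w"
    "\<And>w. w \<in> over U \<Longrightarrow> triv_map \<psi> w \<in> U \<times> points N"
proof -
  interpret group G by (rule G_group)
  obtain \<sigma> where \<sigma>: "smooth_map (submfd M U) E \<sigma>"
    "\<And>x. x \<in> U \<Longrightarrow> \<sigma> x \<in> points E" "\<And>x. x \<in> U \<Longrightarrow> pb_proj P (\<sigma> x) = x"
    "\<And>x. x \<in> U \<Longrightarrow> snd (\<psi> (\<sigma> x)) = \<one>\<^bsub>G\<^esub>"
    using unit_section[OF t] by blast
  define s where "s = (\<lambda>w. (\<sigma> (fst w), snd w :: 'n))"
  note opU = openin_over(1)[OF t]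
  note opT = openin_Times_N[OF opU]
  note K = charted_submfd[OF charted_MN opT]
  have f: "smooth_map (submfd MN (U \<times> points N)) M fst"
    by (rule smooth_map_submfd[OF charted_MN charteds(2) opT smooth_map_fst[OF manifolds(2) charted_N]])
  have "smooth_map (submfd MN (U \<times> points N)) E (\<lambda>w. \<sigma> (fst w))"
    by (rule smooth_map_compose_submfd[OF K charteds(2,1) opU f _ \<sigma>(1)]) auto
  then have 1: "smooth_map (submfd MN (U \<times> points N)) EN s"
    unfolding s_def
    by (intro smooth_map_pair[OF K charteds(1) charted_N]
        smooth_map_submfd[OF charted_MN charted_N opT smooth_map_snd[OF charteds(2) N]])
  have 2: "s w \<in> over U" "triv_map \<psi> (s w) = w" if "w \<in> U \<times> points N" for w
    using that \<sigma> left_one by (auto simp: s_def over_def triv_map_def)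
  have 3: "triv_map \<psi> w \<in> U \<times> points N" if "w \<in> over U" for w
    using that triv_closed[OF t] l_closed by (auto simp: over_def triv_map_def)
  have 4: "quot (s (triv_map \<psi> w)) = quot w" if wU: "w \<in> over U" for w
  proof -
    obtain p y where w: "w = (p, y)" "p \<in> points E" "y \<in> points N" "pb_proj P p \<in> U"
      using wU by (cases w) (auto simp: over_def)
    let ?x = "pb_proj P p" and ?g = "snd (\<psi> p)"
    have g: "?g \<in> carrier G" using triv_closed[OF t w(2,4)] .
    \<comment> \<open>Moving the section point by the group coordinate of \<open>p\<close> gives a
      point with the base point and group coordinate of \<open>p\<close>, hence \<open>p\<close>
      itself. The group element then passes from the first entry of the class to the second.\<close>
    have "snd (\<psi> (pb_act P (\<sigma> ?x) ?g)) = ?g"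
      using triv_act[OF t, of "\<sigma> ?x" ?g] \<sigma> w g by simp
    then have "pb_act P (\<sigma> ?x) ?g = p"
      by (intro triv_inj[OF t]) (use \<sigma> w g act_closed proj_act in auto)
    then have "cls p y = cls (\<sigma> ?x) (l ?g y)"
      using cls_act[of "\<sigma> ?x" ?g "l ?g y"] \<sigma>(2) w g l_closed left_inverse(1) by auto
    then show ?thesis by (simp add: w s_def triv_map_def)
  qed
  show thesis by (rule that[OF 1 2 4 3])
qed

text \<open>On representatives a bundle chart is a product chart of \<open>M \<times> N\<close>
  after \<open>triv_map\<close>; this reduces questions about the atlas of \<open>A\<close> to the
  product atlas.\<close>

lemma chart_map_quot:
  assumes "equivariant_triv P U \<psi>" "w \<in> over U"
  shows "chart_map \<psi> c d (quot w) = (\<lambda>(x, y). coord_join (mdim M) (c x) (d y)) (triv_map \<psi> w)"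
  using assms chart_map_cls by (auto simp: over_def triv_map_def)

lemma quot_in_chart_dom:
  assumes "equivariant_triv P U \<psi>" "w \<in> points EN" "V \<subseteq> points M" 
  shows "quot w \<in> chart_dom U \<psi> V W \<longleftrightarrow> w \<in> over U \<and> triv_map \<psi> w \<in> V \<times> W"
  using assms mem_chart_dom by (auto simp: over_def triv_map_def)

lemma chart_dom_quot:
  assumes "z \<in> chart_dom U \<psi> V W"
  obtains w where "w \<in> over U" "z = quot w"
  using assms unfolding chart_dom_def over_def by fastforce

text \<open>Domains are open because \<open>triv_map\<close> is continuous, charts are injective
  because the section recovers a class from its trivialized point, and images are open because the
  section pulls open sets of classes back to open sets of \<open>M \<times> N\<close>.\<close>

lemma charted_assoc: "charted A"
  unfolding charted_def
proof (intro conjI)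
  have main: "openin (mtop A) (chart_dom U \<psi> V W)" "inj_on (chart_map \<psi> c d) (chart_dom U \<psi> V W)"
    "\<And>O'. openin (mtop A) O' \<Longrightarrow> O' \<subseteq> chart_dom U \<psi> V W \<Longrightarrow>
       openin (Euclidean_space (mdim A)) (chart_map \<psi> c d ` O')"
    if t: "equivariant_triv P U \<psi>" and c: "(V, c) \<in> atlas M" and d: "(W, d) \<in> atlas N" for U \<psi> V c W d
  proof -
    let ?e = "\<lambda>(x, y). coord_join (mdim M) (c x) (d y)"
    have e: "(V \<times> W, ?e) \<in> atlas MN" using c d by (auto simp: atlas_prod)
    have VM: "V \<subseteq> points M" using chartedD(1)[OF charteds(2) c] openin_subset by auto
    note opU = openin_over(1)[OF t] and opo = openin_over_EN[OF t]
    note T = triv_map_smooth[OF t]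
    obtain s where s: "smooth_map (submfd MN (U \<times> points N)) EN s"
      "\<And>w. w \<in> U \<times> points N \<Longrightarrow> s w \<in> over U"
      "\<And>w. w \<in> U \<times> points N \<Longrightarrow> triv_map \<psi> (s w) = w"
      "\<And>w. w \<in> over U \<Longrightarrow> quot (s (triv_map \<psi> w)) = quot w"
      "\<And>w. w \<in> over U \<Longrightarrow> triv_map \<psi> w \<in> U \<times> points N"
      using triv_map_section[OF t] by blast
    have "openin (mtop EN) {w \<in> over U. triv_map \<psi> w \<in> V \<times> W}"
      by (rule openin_smooth_preimage_submfd[OF opo T chartedD(1)[OF charted_MN e]])
    moreover have "{w \<in> over U. triv_map \<psi> w \<in> V \<times> W} = {w \<in> points EN. quot w \<in> chart_dom U \<psi> V W}"
      using quot_in_chart_dom[OF t _ VM] by (auto simp: over_def)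
    moreover have "chart_dom U \<psi> V W \<subseteq> assoc_space P N l"
      unfolding chart_dom_def assoc_space_def by blast
    ultimately show "openin (mtop A) (chart_dom U \<psi> V W)" by (simp add: openin_assoc)
    have overEN: "w \<in> over U \<Longrightarrow> w \<in> points EN" for w by (simp add: over_def)
    show "inj_on (chart_map \<psi> c d) (chart_dom U \<psi> V W)"
    proof (rule inj_onI)
      fix z z' assume z: "z \<in> chart_dom U \<psi> V W" "z' \<in> chart_dom U \<psi> V W"
        "chart_map \<psi> c d z = chart_map \<psi> c d z'"
      obtain w w' where w: "w \<in> over U" "z = quot w" "w' \<in> over U" "z' = quot w'"
        using chart_dom_quot z(1,2) by metis
      have 1: "triv_map \<psi> w \<in> V \<times> W" "triv_map \<psi> w' \<in> V \<times> W"
        using z w quot_in_chart_dom[OF t overEN VM] by auto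
      have "?e (triv_map \<psi> w) = ?e (triv_map \<psi> w')"
        using z(3) w chart_map_quot[OF t] by simp
      from inj_onD[OF chartedD(2)[OF charted_MN e] this 1]
      have "triv_map \<psi> w = triv_map \<psi> w'" .
      then show "z = z'" using s(4) w by metis
    qed
    fix O' assume O': "openin (mtop A) O'" "O' \<subseteq> chart_dom U \<psi> V W"
    \<comment> \<open>The trivialized points of classes in \<open>O'\<close>, obtained by pulling
      back along the section; the product chart maps this open set onto the image of
      \<open>O'\<close>.\<close>
    let ?S = "{w \<in> U \<times> points N. quot (s w) \<in> O'} \<inter> (V \<times> W)"
    note opT = openin_Times_N[OF opU]
    have "openin (mtop EN) {w \<in> points EN. quot w \<in> O'}" using O'(1) by (simp add: openin_assoc)
    from openin_smooth_preimage_submfd[OF opT s(1) this]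
    have "openin (mtop MN) {w \<in> U \<times> points N. s w \<in> {w \<in> points EN. quot w \<in> O'}}" .
    moreover have "{w \<in> U \<times> points N. s w \<in> {w \<in> points EN. quot w \<in> O'}} =
        {w \<in> U \<times> points N. quot (s w) \<in> O'}"
      using s(2) overEN by blast
    ultimately have "openin (mtop MN) {w \<in> U \<times> points N. quot (s w) \<in> O'}" by simp
    then have "openin (mtop MN) ?S" using chartedD(1)[OF charted_MN e] by (intro openin_Int)
    then have "openin (Euclidean_space (mdim MN)) (?e ` ?S)"
      by (rule chartedD(3)[OF charted_MN e]) auto
    moreover have "?e ` ?S = chart_map \<psi> c d ` O'"
    proof (intro equalityI subsetI)
      fix a assume "a \<in> ?e ` ?S"
      then obtain w where w: "w \<in> U \<times> points N" "quot (s w) \<in> O'" "a = ?e w" by blast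
      then have "a = chart_map \<psi> c d (quot (s w))"
        using chart_map_quot[OF t s(2)] s(3) by simp
      then show "a \<in> chart_map \<psi> c d ` O'" using w(2) by blast
    next
      fix a assume "a \<in> chart_map \<psi> c d ` O'"
      then obtain z where z: "z \<in> O'" "a = chart_map \<psi> c d z" by blast
      obtain w where w: "w \<in> over U" "z = quot w" using chart_dom_quot z(1) O'(2) by blast
      have "triv_map \<psi> w \<in> V \<times> W"
        using quot_in_chart_dom[OF t overEN[OF w(1)] VM] z(1) w(2) O'(2) by blast
      then have 1: "triv_map \<psi> w \<in> ?S" using s(4,5)[OF w(1)] z(1) w(2) by simp
      have "a = ?e (triv_map \<psi> w)" using chart_map_quot[OF t w(1)] z w by simp
      from this 1 show "a \<in> ?e ` ?S" by (rule image_eqI)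
    qed
    ultimately show "openin (Euclidean_space (mdim A)) (chart_map \<psi> c d ` O')"
      by (simp add: assoc_simps)
  qed
  show "\<forall>(V, c)\<in>atlas A. openin (mtop A) V \<and> inj_on c V \<and>
     (\<forall>W. openin (mtop A) W \<and> W \<subseteq> V \<longrightarrow> openin (Euclidean_space (mdim A)) (c ` W))"
  proof (intro ballI case_prodI2)
    fix Dk D k assume "Dk \<in> atlas A" "Dk = (D, k)"
    then obtain U \<psi> V c W d where t: "equivariant_triv P U \<psi>" "(V, c) \<in> atlas M" "(W, d) \<in> atlas N"
      and Dk: "D = chart_dom U \<psi> V W" "k = chart_map \<psi> c d"
      unfolding atlas_assoc by blast
    show "openin (mtop A) D \<and> inj_on k D \<and>
        (\<forall>W. openin (mtop A) W \<and> W \<subseteq> D \<longrightarrow> openin (Euclidean_space (mdim A)) (k ` W))"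
      unfolding Dk using main[OF t] by simp
  qed
  show "(\<Union>(V, c)\<in>atlas A. V) = points A"
  proof (intro equalityI subsetI)
    fix z assume "z \<in> (\<Union>(V, c)\<in>atlas A. V)"
    then show "z \<in> points A" unfolding atlas_assoc using main(1) openin_subset by blast
  next
    fix z assume "z \<in> points A"
    then obtain p y where z: "p \<in> points E" "y \<in> points N" "z = cls p y"
      unfolding points_assoc by (rule assoc_spaceE)
    obtain U \<psi> where t: "pb_proj P p \<in> U" "equivariant_triv P U \<psi>"
      using triv_exists proj_closed z by metis
    obtain V c where c: "(V, c) \<in> atlas M" "pb_proj P p \<in> V"
      using charted_chart charteds(2) proj_closed z by metis
    obtain W d where d: "(W, d) \<in> atlas N" "l (snd (\<psi> p)) y \<in> W"
      using charted_chart[OF charted_N] l_closed triv_closed[OF t(2)] z t by metis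
    have "z \<in> chart_dom U \<psi> V W" using mem_chart_dom[OF t(2) z(1,2)] z(3) c d t(1) by simp
    moreover have "(chart_dom U \<psi> V W, chart_map \<psi> c d) \<in> atlas A"
      unfolding atlas_assoc using t(2) c(1) d(1) by blast
    ultimately show "z \<in> (\<Union>(V, c)\<in>atlas A. V)" by blast
  qed
qed

text \<open>By \<open>chart_map_quot\<close> the coordinate expression of \<open>quot\<close> is
  that of \<open>triv_map\<close>.\<close>

lemma quot_smooth: "smooth_map EN A quot"
  unfolding smooth_map_iff[OF charted_EN charted_assoc]
proof (intro conjI allI impI)
  fix B b D k i assume b: "(B, b) \<in> atlas EN" and k: "(D, k) \<in> atlas A" and i: "i < mdim A"
  obtain U \<psi> V c W d where t: "equivariant_triv P U \<psi>" and c: "(V, c) \<in> atlas M" and d: "(W, d) \<in> atlas N"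
    and Dk: "D = chart_dom U \<psi> V W" "k = chart_map \<psi> c d"
    using k unfolding atlas_assoc by blast
  let ?e = "\<lambda>(x, y). coord_join (mdim M) (c x) (d y)"
  have e: "(V \<times> W, ?e) \<in> atlas MN" using c d by (auto simp: atlas_prod)
  have VM: "V \<subseteq> points M" using chartedD(1)[OF charteds(2) c] openin_subset by auto
  have BEN: "B \<subseteq> points EN" using chartedD(1)[OF charted_EN b] openin_subset by blast
  note opo = openin_over_EN[OF t]
  have b': "(B \<inter> over U, b) \<in> atlas (submfd EN (over U))" using b by (auto simp: atlas_submfd)
  have i': "i < mdim MN" using i by (simp add: assoc_simps)
  have "quot w \<in> D \<longleftrightarrow> w \<in> over U \<and> triv_map \<psi> w \<in> V \<times> W" if "w \<in> B" for w
    unfolding Dk(1) by (rule quot_in_chart_dom[OF t subsetD[OF BEN that] VM])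
  then have "{w \<in> B. quot w \<in> D} = {w \<in> B \<inter> over U. triv_map \<psi> w \<in> V \<times> W}"
    by (simp add: Int_def cong: conj_cong)
  moreover have "smooth_in (mdim EN) b {w \<in> B \<inter> over U. triv_map \<psi> w \<in> V \<times> W} (\<lambda>w. ?e (triv_map \<psi> w) i)"
    using smooth_mapD_smooth_in[OF triv_map_smooth[OF t] charted_submfd[OF charted_EN opo] charted_MN b' e i'] by simp
  then have "smooth_in (mdim EN) b {w \<in> B \<inter> over U. triv_map \<psi> w \<in> V \<times> W} (\<lambda>w. k (quot w) i)"
    by (rule smooth_in_cong) (use chart_map_quot[OF t] Dk in auto)
  ultimately show "smooth_in (mdim EN) b {w \<in> B. quot w \<in> D} (\<lambda>w. k (quot w) i)" by simp
qed (rule quot_continuous)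

text \<open>The universal property of a quotient map with smooth local sections: locally
  \<open>\<Phi>\<close> is the smooth map \<open>\<Phi> \<circ> quot\<close> after the section, read
  in a trivialization.\<close>

lemma smooth_from_assoc:
  assumes K: "charted K" and W0: "openin (mtop A) W0"
    and \<Phi>: "smooth_map (submfd EN {w \<in> points EN. quot w \<in> W0}) K (\<lambda>w. \<Phi> (quot w))"
  shows "smooth_map (submfd A W0) K \<Phi>"
  unfolding smooth_map_iff[OF charted_submfd[OF charted_assoc W0] K]
proof (intro conjI allI impI)
  let ?Q = "{w \<in> points EN. quot w \<in> W0}"
  have opQ: "openin (mtop EN) ?Q" using W0 by (simp add: openin_assoc)
  have W0s: "W0 \<subseteq> assoc_space P N l" using W0 by (simp add: openin_assoc)
  show "continuous_map (mtop (submfd A W0)) (mtop K) \<Phi>"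
    unfolding continuous_map points_submfd[OF W0]
  proof (intro conjI allI impI)
    show "\<Phi> ` W0 \<subseteq> points K"
    proof clarify
      fix z assume z: "z \<in> W0"
      then obtain p y where "p \<in> points E" "y \<in> points N" "z = cls p y"
        using W0s assoc_spaceE by blast
      then have "(p, y) \<in> points (submfd EN ?Q)" unfolding points_submfd[OF opQ] using z by auto
      then show "\<Phi> z \<in> points K" using smooth_map_in_points[OF \<Phi>] \<open>z = cls p y\<close> by fastforce
    qed
    fix T assume T: "openin (mtop K) T"
    have "openin (mtop EN) {w \<in> ?Q. \<Phi> (quot w) \<in> T}"
      by (rule openin_smooth_preimage_submfd[OF opQ \<Phi> T])
    moreover have "{w \<in> ?Q. \<Phi> (quot w) \<in> T} = {w \<in> points EN. quot w \<in> {z \<in> W0. \<Phi> z \<in> T}}" by blast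
    ultimately have "openin (mtop A) {z \<in> W0. \<Phi> z \<in> T}"
      unfolding openin_assoc using W0s by auto
    then show "openin (mtop (submfd A W0)) {z \<in> W0. \<Phi> z \<in> T}"
      using W0 by (auto simp: openin_open_subtopology)
  qed
  fix D k T e' i assume k: "(D, k) \<in> atlas (submfd A W0)" and e': "(T, e') \<in> atlas K" and i: "i < mdim K"
  obtain D' where D': "D = D' \<inter> W0" "(D', k) \<in> atlas A" using k by (auto simp: atlas_submfd)
  obtain U \<psi> V c W d where t: "equivariant_triv P U \<psi>" and c: "(V, c) \<in> atlas M" and d: "(W, d) \<in> atlas N"
    and Dk: "D' = chart_dom U \<psi> V W" "k = chart_map \<psi> c d"
    using D'(2) unfolding atlas_assoc by blast
  let ?e = "\<lambda>(x, y). coord_join (mdim M) (c x) (d y)"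
  have e: "(V \<times> W, ?e) \<in> atlas MN" using c d by (auto simp: atlas_prod)
  have VM: "V \<subseteq> points M" using chartedD(1)[OF charteds(2) c] openin_subset by auto
  obtain s where s: "smooth_map (submfd MN (U \<times> points N)) EN s"
    "\<And>w. w \<in> U \<times> points N \<Longrightarrow> s w \<in> over U"
    "\<And>w. w \<in> U \<times> points N \<Longrightarrow> triv_map \<psi> (s w) = w"
    "\<And>w. w \<in> over U \<Longrightarrow> quot (s (triv_map \<psi> w)) = quot w"
    "\<And>w. w \<in> over U \<Longrightarrow> triv_map \<psi> w \<in> U \<times> points N"
    using triv_map_section[OF t] by blast
  note opT = openin_Times_N[OF openin_over(1)[OF t]]
  \<comment> \<open>The part of the trivialized region over which the section stays above
    \<open>W0\<close>, where smoothness of the composite is given.\<close>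
  define R where "R = {w \<in> U \<times> points N. s w \<in> ?Q}"
  have opR: "openin (mtop MN) R"
    unfolding R_def
    by (rule openin_smooth_preimage_submfd[OF opT s(1) opQ])
  have "smooth_map (submfd MN R) K (\<lambda>w. \<Phi> (quot (s w)))"
    by (rule smooth_map_compose_submfd[OF charted_submfd[OF charted_MN opR] charted_EN K opQ
        smooth_map_submfd_mono[OF charted_MN charted_EN opT opR _ s(1)] _ \<Phi>])
      (use points_submfd[OF opR] in \<open>auto simp: R_def\<close>)
  then have "smooth_in (mdim MN) ?e {w \<in> V \<times> W \<inter> R. \<Phi> (quot (s w)) \<in> T} (\<lambda>w. e' (\<Phi> (quot (s w))) i)"
    using smooth_mapD_smooth_in[OF _ charted_submfd[OF charted_MN opR] K _ e' i, of "\<lambda>w. \<Phi> (quot (s w))" "V \<times> W \<inter> R" ?e]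
      e by (auto simp: atlas_submfd)
  \<comment> \<open>This coordinate expression comes from the product chart and is reused unchanged
    for \<open>k\<close>, since the \<open>k\<close>-coordinates of a class are the product
    coordinates of its trivialized point.\<close>
  then obtain g where g: "\<And>k. Ck_on k (mdim MN) (?e ` {w \<in> V \<times> W \<inter> R. \<Phi> (quot (s w)) \<in> T}) g"
      "\<And>w. w \<in> V \<times> W \<inter> R \<Longrightarrow> \<Phi> (quot (s w)) \<in> T \<Longrightarrow> g (?e w) = e' (\<Phi> (quot (s w))) i"
    unfolding smooth_in_def by blast
  have z: "\<exists>w \<in> V \<times> W \<inter> R. quot (s w) = z \<and> k z = ?e w" if zD: "z \<in> D' \<inter> W0" for z
  proof -
    obtain w where w: "w \<in> over U" "z = quot w" using zD Dk(1) chart_dom_quot by blast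
    have "w \<in> points EN" using w(1) by (simp add: over_def)
    then have "triv_map \<psi> w \<in> V \<times> W" using quot_in_chart_dom[OF t _ VM] zD w Dk by blast
    moreover have "triv_map \<psi> w \<in> R"
      unfolding R_def using s(2,4,5) w that by (auto simp: over_def)
    ultimately have "triv_map \<psi> w \<in> V \<times> W \<inter> R" by blast
    moreover have "quot (s (triv_map \<psi> w)) = z" using s(4)[OF w(1)] w(2) by simp
    moreover have "k z = ?e (triv_map \<psi> w)"
      unfolding Dk(2) w(2) by (rule chart_map_quot[OF t w(1)])
    ultimately show ?thesis by (intro bexI[of _ "triv_map \<psi> w"] conjI)
  qed
  have "smooth_in (mdim A) k {z \<in> D. \<Phi> z \<in> T} (\<lambda>z. e' (\<Phi> z) i)"
    unfolding smooth_in_def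
  proof (intro exI[of _ g] conjI allI ballI)
    show "Ck_on j (mdim A) (k ` {z \<in> D. \<Phi> z \<in> T}) g" for j
    proof -
      have "k ` {z \<in> D. \<Phi> z \<in> T} \<subseteq> ?e ` {w \<in> V \<times> W \<inter> R. \<Phi> (quot (s w)) \<in> T}"
        using z unfolding D'(1) by blast
      then show ?thesis using Ck_on_subset[OF g(1)] by (simp add: assoc_simps)
    qed
    fix y assume "y \<in> {z \<in> D. \<Phi> z \<in> T}"
    then show "g (k y) = e' (\<Phi> y) i" using z[of y] g(2) D'(1) by auto
  qed
  then show "smooth_in (mdim (submfd A W0)) k {z \<in> D. \<Phi> z \<in> T} (\<lambda>z. e' (\<Phi> z) i)" by simp
qed

end

text \<open>The projection is constant on an orbit and the group is nonempty, so
  \<open>the_elem\<close> meets a singleton.\<close>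

lemma (in principal) assoc_proj_class: "p \<in> points E \<Longrightarrow> assoc_proj P (assoc_class P l p y) = pb_proj P p"
proof -
  interpret group G by (rule G_group)
  assume p: "p \<in> points E"
  then have "(\<lambda>(p, y). pb_proj P p) ` assoc_class P l p y = (\<lambda>a. pb_proj P p) ` carrier G"
    unfolding assoc_class_def image_image using proj_act by (intro image_cong) auto
  then show ?thesis using one_closed by (auto simp: assoc_proj_def image_constant_conv)
qed

lemma (in principal) integral_curve_germ: "integral_curve E Xt I c \<Longrightarrow> curve_germ E c"
  unfolding integral_curve_def using curve_germI charteds by blast

section \<open>Smooth maps and tangent vectors of the associated bundle\<close>

context associated
begin

lemma smooth_from_assoc':
  assumes "charted K" "smooth_map EN K (\<lambda>w. \<Phi> (quot w))"
  shows "smooth_map A K \<Phi>"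
proof (rule smooth_map_local[OF charted_assoc assms(1)])
  fix z assume z: "z \<in> points A"
  have "{w \<in> points EN. quot w \<in> points A} = points EN"
    using cls_in_space unfolding points_assoc by auto
  then have "smooth_map (submfd A (points A)) K \<Phi>"
    using assms by (intro smooth_from_assoc)
      (auto intro: smooth_map_submfd[OF charted_EN] simp del: prod_mfd_simps submfd_simps)
  then show "\<exists>W. openin (mtop A) W \<and> z \<in> W \<and> smooth_map (submfd A W) K \<Phi>"
    using z by blast
qed

lemma assoc_proj_smooth: "smooth_map A M (assoc_proj P)"
proof (rule smooth_from_assoc'[OF charteds(2)])
  have "smooth_map EN M (\<lambda>w. pb_proj P (fst w))"
    by (rule smooth_map_compose'[OF charted_EN charteds(1,2) smooth_map_fst[OF manifolds(1) charted_N] proj_smooth])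
  then show "smooth_map EN M (\<lambda>w. assoc_proj P (quot w))"
    by (rule smooth_map_cong[OF charted_EN charteds(2)]) (auto simp: assoc_proj_class)
qed

lemma cls_smooth_left:
  assumes "y \<in> points N"
  shows "smooth_map E A (\<lambda>p. cls p y)"
  using smooth_map_compose'[OF charteds(1) charted_EN charted_assoc
      smooth_map_pair[OF charteds(1,1) charted_N smooth_map_id[OF manifolds(1)]
        smooth_map_const[OF charteds(1) charted_N assms]] quot_smooth] by simp

lemma cls_smooth_right:
  assumes "p \<in> points E"
  shows "smooth_map N A (cls p)"
  using smooth_map_compose'[OF charted_N charted_EN charted_assoc
      smooth_map_pair[OF charted_N charteds(1) charted_N smooth_map_const[OF charted_N charteds(1) assms]
        smooth_map_id[OF N]] quot_smooth] by simp

lemma curve_germ_points_ev: "charted K \<Longrightarrow> curve_germ K \<gamma> \<Longrightarrow> \<forall>\<^sub>F s in nhds 0. \<gamma> s \<in> points K"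
  by (rule curve_germ_eventually) (auto simp: curve_germ_points)

text \<open>Two presentations of \<open>z\<close> differ by some \<open>a\<close>. Invariance
  carries \<open>Xt p\<close> to \<open>Xt (pb_act P p a)\<close>, so \<open>c'\<close> and the
  translate of \<open>c\<close> by \<open>a\<close> have the same velocity at 0; the translation is
  then absorbed by the class. Only velocities at 0 are compared, not the integral curves.\<close>

lemma assoc_field_value_unique:
  assumes X: "invariant_vector_field P Xt"
    and v: "assoc_field_value P N l Xt z v" and v': "assoc_field_value P N l Xt z v'"
  shows "v = v'"
proof -
  obtain p y I c where p: "p \<in> points E" "y \<in> points N" "z = cls p y" "integral_curve E Xt I c" "c 0 = p"
      "v = velocity A (\<lambda>t. cls (c t) y) 0"
    using v unfolding assoc_field_value_def by blast
  obtain p' y' I' c' where p': "p' \<in> points E" "y' \<in> points N" "z = cls p' y'" "integral_curve E Xt I' c'" "c' 0 = p'"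
      "v' = velocity A (\<lambda>t. cls (c' t) y') 0"
    using v' unfolding assoc_field_value_def by blast
  obtain a where a: "a \<in> carrier G" "p' = pb_act P p a" "y' = l (inv\<^bsub>G\<^esub> a) y"
    by (rule cls_eqD[OF p'(1,2)]) (use p(3) p'(3) in auto)
  have vel: "velocity E c 0 = Xt p" "velocity E c' 0 = Xt p'"
    using p(4,5) p'(4,5) unfolding integral_curve_def by auto
  note q' = cls_smooth_left[OF p'(2)]
  have "v' = tmap A (\<lambda>q. cls q y') p' (Xt p')"
    using tmap_velocity'[OF charteds(1) charted_assoc _ q', of c' 0] p' vel by simp
  also have "Xt p' = tmap E (\<lambda>q. pb_act P q a) p (Xt p)"
    using X p(1) a unfolding invariant_vector_field_def by simp
  also have "\<dots> = velocity E (\<lambda>t. pb_act P (c t) a) 0"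
    using tmap_velocity'[OF charteds(1,1) _ act_smooth[OF a(1)], of c 0] p vel by simp
  also have "tmap A (\<lambda>q. cls q y') p' \<dots> = velocity A (\<lambda>t. cls (pb_act P (c t) a) y') 0"
    using tmap_velocity'[OF charteds(1) charted_assoc _ q', of "\<lambda>t. pb_act P (c t) a" 0] p(5) p'(1) a(2) by simp
  also have "\<dots> = v"
    unfolding p(6)
  proof (rule velocity_cong)
    show "\<forall>\<^sub>F t in nhds 0. cls (pb_act P (c t) a) y' = cls (c t) y"
      using curve_germ_points_ev[OF charteds(1) integral_curve_germ[OF p(4)]]
      by eventually_elim (use cls_act a p(2) in auto)
  qed
  finally show ?thesis ..
qed

text \<open>The fiber inclusion \<open>y \<mapsto> [p, y]\<close> has a smooth left inverse near the fiber, namely a local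
  trivialization followed by an action map.\<close>

lemma fiber_velocity_inject:
  assumes p: "p \<in> points E" and \<gamma>: "curve_germ N \<gamma>" and \<delta>: "curve_germ N \<delta>" and eq0: "\<gamma> 0 = \<delta> 0"
    and eq: "velocity A (\<lambda>s. cls p (\<gamma> s)) 0 = velocity A (\<lambda>s. cls p (\<delta> s)) 0"
  shows "velocity N \<gamma> 0 = velocity N \<delta> 0"
proof -
  interpret group G by (rule G_group)
  obtain U \<psi> where t: "pb_proj P p \<in> U" "equivariant_triv P U \<psi>"
    using triv_exists proj_closed p by metis
  let ?g = "snd (\<psi> p)"
  have g: "?g \<in> carrier G" "inv\<^bsub>G\<^esub> ?g \<in> carrier G" using triv_closed[OF t(2) p t(1)] by auto
  \<comment> \<open>The fiber component of the trivialization as a function of classes.\<close>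
  define R where "R z = (case SOME q. q \<in> z of (q, n) \<Rightarrow> l (snd (\<psi> q)) n)" for z
  define W where "W = {z \<in> points A. assoc_proj P z \<in> U}"
  have W: "openin (mtop A) W"
    unfolding W_def by (rule openin_smooth_preimage[OF assoc_proj_smooth openin_over(1)[OF t(2)]])
  have R: "R (cls q n) = l (snd (\<psi> q)) n" if "q \<in> points E" "pb_proj P q \<in> U" "n \<in> points N" for q n
    unfolding R_def by (rule cls_choice[OF that(1,3)]) (use triv_l_act[OF t(2) that] in simp)
  note opo = openin_over_EN[OF t(2)]
  note K = charted_submfd[OF charted_EN opo]
  have "smooth_map (submfd EN (over U)) N (\<lambda>w. snd (triv_map \<psi> w))"
    by (rule smooth_map_compose'[OF K charted_MN charted_N triv_map_smooth[OF t(2)] smooth_map_snd[OF charteds(2) N]])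
  then have "smooth_map (submfd EN (over U)) N (\<lambda>w. R (quot w))"
    by (rule smooth_map_cong[OF K charted_N])
      (unfold points_submfd[OF opo], auto simp: over_def triv_map_def R)
  moreover have "{w \<in> points EN. quot w \<in> W} = over U"
    by (auto simp: W_def over_def assoc_proj_class points_assoc cls_in_space)
  ultimately have Rs: "smooth_map (submfd A W) N R"
    by (intro smooth_from_assoc[OF charted_N W]) simp
  \<comment> \<open>On the fiber through \<open>p\<close> the map \<open>R\<close> is the action of
    \<open>?g\<close>, which its inverse undoes. The right-hand side involves the curve only through
    its initial point and the velocity of the class curve, and this gives injectivity.\<close>
  have recover: "velocity N \<eta> 0 = tmap N (l (inv\<^bsub>G\<^esub> ?g)) (R (cls p (\<eta> 0)))
      (tmap N R (cls p (\<eta> 0)) (velocity A (\<lambda>s. cls p (\<eta> s)) 0))" if \<eta>: "curve_germ N \<eta>" for \<eta>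
  proof -
    have \<eta>0: "\<eta> 0 \<in> points N" using curve_germ_points[OF \<eta>] .
    have in_W: "cls p (\<eta> 0) \<in> W"
      using p t(1) \<eta>0 by (simp add: W_def assoc_proj_class points_assoc cls_in_space)
    have RN: "R (cls p (\<eta> 0)) \<in> points N" using R[OF p t(1) \<eta>0] l_closed g \<eta>0 by simp
    have "velocity N \<eta> 0 = velocity N (\<lambda>s. l (inv\<^bsub>G\<^esub> ?g) (R (cls p (\<eta> s)))) 0"
    proof (rule velocity_cong)
      show "\<forall>\<^sub>F s in nhds 0. \<eta> s = l (inv\<^bsub>G\<^esub> ?g) (R (cls p (\<eta> s)))"
        using curve_germ_points_ev[OF charted_N \<eta>]
        by eventually_elim (simp add: R[OF p t(1)] left_inverse g)
    qed
    also have "\<dots> = tmap N (l (inv\<^bsub>G\<^esub> ?g)) (R (cls p (\<eta> 0))) (velocity N (\<lambda>s. R (cls p (\<eta> s))) 0)"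
      using tmap_velocity'[OF charted_N charted_N _ l_smooth[OF g(2)], of "\<lambda>s. R (cls p (\<eta> s))" 0] RN by simp
    also have "velocity N (\<lambda>s. R (cls p (\<eta> s))) 0 = tmap N R (cls p (\<eta> 0)) (velocity A (\<lambda>s. cls p (\<eta> s)) 0)"
      using tmap_velocity[OF charted_assoc charted_N W _ Rs, of "\<lambda>s. cls p (\<eta> s)" 0] in_W by simp
    finally show ?thesis .
  qed
  show ?thesis using recover[OF \<gamma>] recover[OF \<delta>] eq eq0 by simp
qed

end

section \<open>Values of the Darboux-Lie derivative\<close>

text \<open>The predicate inside the definite description of \<open>darboux_lie\<close>, named so
  that existence and uniqueness of its values can be treated apart from the description.\<close>

definition darboux_lie_value ::
  "('m, 'f) bundle_functor \<Rightarrow> ('p, 'm, 'g) principal_bundle \<Rightarrow> 'n mfd \<Rightarrow> ('g \<Rightarrow> 'n \<Rightarrow> 'n) \<Rightarrow>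
   ('g \<Rightarrow> 'v \<Rightarrow> 'v) \<Rightarrow> ('n \<Rightarrow> 'n tvec \<Rightarrow> 'v::euclidean_space) \<Rightarrow> ('p \<Rightarrow> 'p tvec) \<Rightarrow>
   ('f \<Rightarrow> ('p \<times> 'n) set) \<Rightarrow> 'f \<Rightarrow> ('p \<times> 'v) set \<Rightarrow> bool" where
  "darboux_lie_value F B N l \<rho> \<omega> Xt h e r \<longleftrightarrow>
     (\<exists>u v p \<gamma>.
        u = canonical_lift F (pb_base B) (base_field B Xt) e \<and>
        u \<in> tangent_space (fb_obj F (pb_base B)) e \<and>
        assoc_field_value B N l Xt (h e) v \<and>
        p \<in> points (pb_total B) \<and> curve_germ N \<gamma> \<and> assoc_class B l p (\<gamma> 0) = h e \<and>
        (\<lambda>\<phi>. tmap (assoc_mfd B N l) h e u \<phi> - v \<phi>) =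
          velocity (assoc_mfd B N l) (\<lambda>t. assoc_class B l p (\<gamma> t)) 0 \<and>
        r = assoc_class B \<rho> p (\<omega> (\<gamma> 0) (velocity N \<gamma> 0)))"

lemma darboux_lie_eq_The:
  "darboux_lie F B N l \<rho> \<omega> Xt h e = (THE r. darboux_lie_value F B N l \<rho> \<omega> Xt h e r)"
  unfolding darboux_lie_def darboux_lie_value_def ..

context associated
begin

text \<open>Two presentations differ by some \<open>a\<close>. Translating the second curve by
  \<open>a\<close> brings both over the same \<open>p\<close>, where
  \<open>fiber_velocity_inject\<close> identifies their velocities. Equivariance of the form turns
  the translation into \<open>\<rho> a\<close>, which the class absorbs.\<close>

lemma darboux_lie_value_unique:
  assumes X: "invariant_vector_field P Xt"
    and V: "g_module G V \<rho>" and \<omega>: "one_form N V \<omega>" "equivariant_form G N l \<rho> \<omega>"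
    and r: "darboux_lie_value F P N l \<rho> \<omega> Xt h e r" and r': "darboux_lie_value F P N l \<rho> \<omega> Xt h e r'"
  shows "r = r'"
proof -
  interpret group G by (rule G_group)
  let ?u = "canonical_lift F M (base_field P Xt) e"
  obtain v p \<gamma> where 1: "assoc_field_value P N l Xt (h e) v" "p \<in> points E" "curve_germ N \<gamma>" "cls p (\<gamma> 0) = h e"
    "(\<lambda>\<phi>. tmap A h e ?u \<phi> - v \<phi>) = velocity A (\<lambda>t. cls p (\<gamma> t)) 0"
    "r = assoc_class P \<rho> p (\<omega> (\<gamma> 0) (velocity N \<gamma> 0))"
    using r unfolding darboux_lie_value_def by blast
  obtain v' p' \<gamma>' where 2: "assoc_field_value P N l Xt (h e) v'" "p' \<in> points E" "curve_germ N \<gamma>'" "cls p' (\<gamma>' 0) = h e"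
    "(\<lambda>\<phi>. tmap A h e ?u \<phi> - v' \<phi>) = velocity A (\<lambda>t. cls p' (\<gamma>' t)) 0"
    "r' = assoc_class P \<rho> p' (\<omega> (\<gamma>' 0) (velocity N \<gamma>' 0))"
    using r' unfolding darboux_lie_value_def by blast
  have "v = v'" using assoc_field_value_unique[OF X 1(1) 2(1)] .
  then have vel: "velocity A (\<lambda>t. cls p (\<gamma> t)) 0 = velocity A (\<lambda>t. cls p' (\<gamma>' t)) 0"
    using 1(5) 2(5) by simp
  have \<gamma>0: "\<gamma> 0 \<in> points N" and \<gamma>'0: "\<gamma>' 0 \<in> points N"
    using curve_germ_points 1(3) 2(3) by metis+
  obtain a where a: "a \<in> carrier G" "p' = pb_act P p a" "\<gamma>' 0 = l (inv\<^bsub>G\<^esub> a) (\<gamma> 0)"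
    by (rule cls_eqD[OF 2(2) \<gamma>'0]) (use 1(4) 2(4) in auto)
  define \<delta> where "\<delta> s = l a (\<gamma>' s)" for s
  have \<delta>: "curve_germ N \<delta>"
    unfolding \<delta>_def by (rule curve_germ_compose'[OF charted_N charted_N 2(3) l_smooth[OF a(1)]])
  have \<delta>0: "\<delta> 0 = \<gamma> 0" by (simp add: \<delta>_def a left_inverse \<gamma>0)
  have "velocity A (\<lambda>t. cls p' (\<gamma>' t)) 0 = velocity A (\<lambda>t. cls p (\<delta> t)) 0"
  proof (rule velocity_cong)
    show "\<forall>\<^sub>F s in nhds 0. cls p' (\<gamma>' s) = cls p (\<delta> s)"
      using curve_germ_points_ev[OF charted_N 2(3)]
    proof eventually_elim
      case (elim s)
      then show ?case
        using cls_act[OF 1(2) a(1), of "\<delta> s"] a l_closed left_inverse by (simp add: \<delta>_def)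
    qed
  qed
  then have "velocity N \<gamma> 0 = velocity N \<delta> 0"
    using fiber_velocity_inject[OF 1(2,3) \<delta> \<delta>0[symmetric]] vel by simp
  also have "\<dots> = tmap N (l a) (\<gamma>' 0) (velocity N \<gamma>' 0)"
    unfolding \<delta>_def using tmap_velocity'[OF charted_N charted_N _ l_smooth[OF a(1)], of \<gamma>' 0] \<gamma>'0 by simp
  finally have v: "velocity N \<gamma> 0 = tmap N (l a) (\<gamma>' 0) (velocity N \<gamma>' 0)" .
  have tan: "velocity N \<gamma>' 0 \<in> tangent_space N (\<gamma>' 0)"
    unfolding tangent_space_def using 2(3) by blast
  let ?w = "\<omega> (\<gamma>' 0) (velocity N \<gamma>' 0)"
  have w: "?w \<in> V" using \<omega>(1) \<gamma>'0 tan unfolding one_form_def by blast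
  have "\<omega> (\<gamma> 0) (velocity N \<gamma> 0) = \<rho> a ?w"
    using \<omega>(2) a(1) \<gamma>'0 tan unfolding equivariant_form_def v \<delta>0[symmetric] \<delta>_def by blast
  then have "r = assoc_class P \<rho> p (\<rho> a ?w)" using 1(6) by simp
  also have "\<dots> = assoc_class P \<rho> (pb_act P p a) (\<rho> (inv\<^bsub>G\<^esub> a) (\<rho> a ?w))"
    by (rule assoc_class_act[symmetric, of V]) (use V 1(2) a(1) w in \<open>auto simp: g_module_def\<close>)
  also have "\<rho> (inv\<^bsub>G\<^esub> a) (\<rho> a ?w) = \<rho> (inv\<^bsub>G\<^esub> a \<otimes>\<^bsub>G\<^esub> a) ?w"
    using V a(1) w inv_closed unfolding g_module_def by metis
  also have "\<dots> = ?w" using V a(1) w unfolding g_module_def by simp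
  finally show ?thesis using 2(6) a(2) by simp
qed

end

section \<open>The bundle map induced by an equivariant map\<close>

locale associated_map = src: associated P N l + tgt: associated P N' l'
  for P :: "('p, 'm, 'g) principal_bundle" and N :: "'n mfd" and l N' and l' :: "'g \<Rightarrow> 'k \<Rightarrow> 'k" +
  fixes f :: "'n \<Rightarrow> 'k"
  assumes f_smooth: "smooth_map N N' f"
    and f_equivariant: "\<And>a y. a \<in> carrier (pb_group P) \<Longrightarrow> y \<in> points N \<Longrightarrow> f (l a y) = l' a (f y)"
begin

abbreviation E where "E \<equiv> pb_total P"
abbreviation M where "M \<equiv> pb_base P"
abbreviation G where "G \<equiv> pb_group P"

lemma f_points: "y \<in> points N \<Longrightarrow> f y \<in> points N'"
  by (rule smooth_map_in_points[OF f_smooth])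

lemma assoc_map_cls: "y \<in> points N \<Longrightarrow> assoc_map f (src.cls p y) = tgt.cls p (f y)"
proof -
  interpret group G by (rule src.G_group)
  show "y \<in> points N \<Longrightarrow> assoc_map f (src.cls p y) = tgt.cls p (f y)"
    unfolding assoc_map_def assoc_class_def image_image
    by (rule image_cong) (auto simp: f_equivariant)
qed

text \<open>Lifted to \<open>E \<times> N\<close> the map is the product of the identity and
  \<open>f\<close>, and smoothness descends by \<open>smooth_from_assoc'\<close>.\<close>

lemma assoc_map_smooth: "smooth_map src.A tgt.A (assoc_map f)"
proof (rule src.smooth_from_assoc'[OF tgt.charted_assoc])
  have "smooth_map src.EN tgt.EN (\<lambda>w. (fst w, f (snd w)))"
    by (intro smooth_map_pair[OF src.charted_EN src.charteds(1) tgt.charted_N]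
      smooth_map_fst[OF src.manifolds(1) src.charted_N]
      smooth_map_compose'[OF src.charted_EN src.charted_N tgt.charted_N
        smooth_map_snd[OF src.charteds(1) src.N] f_smooth])
  from smooth_map_compose'[OF src.charted_EN tgt.charted_EN tgt.charted_assoc this tgt.quot_smooth]
  have "smooth_map src.EN tgt.A (\<lambda>w. tgt.cls (fst w) (f (snd w)))" by simp
  then show "smooth_map src.EN tgt.A (\<lambda>w. assoc_map f (src.quot w))"
    by (rule smooth_map_cong[OF src.charted_EN tgt.charted_assoc]) (auto simp: assoc_map_cls)
qed

lemma assoc_proj_map: "z \<in> points src.A \<Longrightarrow> assoc_proj P (assoc_map f z) = assoc_proj P z"
  unfolding src.points_assoc
  by (erule src.assoc_spaceE) (simp add: assoc_map_cls src.assoc_proj_class)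

lemma velocity_assoc_map:
  assumes "smooth_near tgt.A (assoc_map f (\<gamma> 0)) \<phi>" "\<gamma> 0 \<in> points src.A"
  shows "velocity src.A \<gamma> 0 (\<phi> \<circ> assoc_map f) = velocity tgt.A (\<lambda>s. assoc_map f (\<gamma> s)) 0 \<phi>"
  using smooth_near_compose'[OF src.charted_assoc tgt.charted_assoc assms(2) assoc_map_smooth assms(1)] assms(1)
  by (simp add: velocity_def)

text \<open>The same lift, the same \<open>p\<close> and the same integral curve serve for the
  composite; \<open>\<gamma>\<close> becomes \<open>f \<circ> \<gamma>\<close>, whose velocity is
  exactly the vector fed to the form by \<open>pullback_form\<close>.\<close>

lemma darboux_lie_value_map:
  assumes r: "darboux_lie_value F P N l \<rho> (pullback_form N' f \<omega>) Xt h e r"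
  shows "darboux_lie_value F P N' l' \<rho> \<omega> Xt (assoc_map f \<circ> h) e r"
proof -
  let ?u = "canonical_lift F M (base_field P Xt) e"
  obtain v p \<gamma> where 1: "?u \<in> tangent_space (fb_obj F M) e"
    "assoc_field_value P N l Xt (h e) v" "p \<in> points E" "curve_germ N \<gamma>" "src.cls p (\<gamma> 0) = h e"
    "(\<lambda>\<phi>. tmap src.A h e ?u \<phi> - v \<phi>) = velocity src.A (\<lambda>t. src.cls p (\<gamma> t)) 0"
    "r = assoc_class P \<rho> p (pullback_form N' f \<omega> (\<gamma> 0) (velocity N \<gamma> 0))"
    using r unfolding darboux_lie_value_def by blast
  obtain q y I c where 2: "q \<in> points E" "y \<in> points N" "h e = src.cls q y" "integral_curve E Xt I c" "c 0 = q"
      "v = velocity src.A (\<lambda>t. src.cls (c t) y) 0"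
    using 1(2) unfolding assoc_field_value_def by blast
  have \<gamma>0: "\<gamma> 0 \<in> points N" using curve_germ_points 1(4) .
  let ?v = "velocity tgt.A (\<lambda>t. tgt.cls (c t) (f y)) 0"
  have "(\<lambda>\<phi>. tmap tgt.A (assoc_map f \<circ> h) e ?u \<phi> - ?v \<phi>) = velocity tgt.A (\<lambda>t. tgt.cls p (f (\<gamma> t))) 0"
  proof
    fix \<phi>
    show "tmap tgt.A (assoc_map f \<circ> h) e ?u \<phi> - ?v \<phi> = velocity tgt.A (\<lambda>t. tgt.cls p (f (\<gamma> t))) 0 \<phi>"
    \<comment> \<open>For smooth \<open>\<phi>\<close> the claim is the given equation evaluated at
      the test function \<open>\<phi> \<circ> assoc_map f\<close>.\<close>
    proof (cases "smooth_near tgt.A (assoc_map f (h e)) \<phi>")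
      case True
      have heA: "h e \<in> points src.A" unfolding 2(3) src.points_assoc by (rule src.cls_in_space[OF 2(1,2)])
      have "smooth_near src.A (h e) (\<phi> \<circ> assoc_map f)"
        by (rule smooth_near_compose'[OF src.charted_assoc tgt.charted_assoc heA assoc_map_smooth True])
      then have "tmap tgt.A (assoc_map f \<circ> h) e ?u \<phi> = tmap src.A h e ?u (\<phi> \<circ> assoc_map f)"
        using True by (simp add: tmap_def o_assoc)
      moreover have "?v \<phi> = v (\<phi> \<circ> assoc_map f)"
        unfolding 2(6) using velocity_assoc_map[of "\<lambda>t. src.cls (c t) y" \<phi>] True heA 2(3,5)
        by (simp add: assoc_map_cls[OF 2(2)])
      moreover have "velocity src.A (\<lambda>t. src.cls p (\<gamma> t)) 0 (\<phi> \<circ> assoc_map f) =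
          velocity tgt.A (\<lambda>t. assoc_map f (src.cls p (\<gamma> t))) 0 \<phi>"
        using velocity_assoc_map[of "\<lambda>t. src.cls p (\<gamma> t)" \<phi>] True heA 1(5) by simp
      moreover have "velocity tgt.A (\<lambda>t. assoc_map f (src.cls p (\<gamma> t))) 0 = velocity tgt.A (\<lambda>t. tgt.cls p (f (\<gamma> t))) 0"
      proof (rule velocity_cong)
        show "\<forall>\<^sub>F t in nhds 0. assoc_map f (src.cls p (\<gamma> t)) = tgt.cls p (f (\<gamma> t))"
          using src.curve_germ_points_ev[OF src.charted_N 1(4)] by eventually_elim (rule assoc_map_cls)
      qed
      ultimately show ?thesis using fun_cong[OF 1(6), of "\<phi> \<circ> assoc_map f"] by simp
    next
      \<comment> \<open>All terms are 0 by default; the two equations below are needed because each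
        term decides smoothness at its own expression for the base point.\<close>
      case False
      moreover have "assoc_map f (h e) = tgt.cls p (f (\<gamma> 0))"
        unfolding 1(5)[symmetric] by (rule assoc_map_cls[OF \<gamma>0])
      moreover have "assoc_map f (h e) = tgt.cls (c 0) (f y)"
        unfolding 2(3,5) by (rule assoc_map_cls[OF 2(2)])
      ultimately show ?thesis by (simp add: tmap_def velocity_def)
    qed
  qed
  moreover have "assoc_field_value P N' l' Xt ((assoc_map f \<circ> h) e) ?v"
    unfolding assoc_field_value_def
    using 2 f_points assoc_map_cls[OF 2(2)] by (intro bexI[of _ q] bexI[of _ "f y"] exI[of _ I] exI[of _ c]) auto
  moreover have "curve_germ N' (\<lambda>s. f (\<gamma> s))"
    by (rule curve_germ_compose'[OF src.charted_N tgt.charted_N 1(4) f_smooth])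
  moreover have "tgt.cls p (f (\<gamma> 0)) = (assoc_map f \<circ> h) e"
    using 1(5) assoc_map_cls[OF \<gamma>0, of p] by simp
  moreover have "r = assoc_class P \<rho> p (\<omega> (f (\<gamma> 0)) (velocity N' (\<lambda>s. f (\<gamma> s)) 0))"
    unfolding 1(7) pullback_form_def
    using tmap_velocity'[OF src.charted_N tgt.charted_N _ f_smooth, of \<gamma> 0] \<gamma>0 by simp
  ultimately show ?thesis
    unfolding darboux_lie_value_def using 1(1,3)
    by (intro exI[of _ ?u] exI[of _ ?v] exI[of _ p] exI[of _ "\<lambda>s. f (\<gamma> s)"]) auto
qed

text \<open>Only the base components of \<open>T h (\<F> X)\<close> and of the value of the lifted field matter for verticality,
  and these are the same for \<open>h\<close> and for \<open>(id \<times>\<^sub>G f) \<circ> h\<close>.\<close>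

lemma darboux_lie_value_reflect:
  assumes Fb: "manifold (fb_obj F M)" and h: "smooth_map (fb_obj F M) src.A h"
    and r': "darboux_lie_value F P N' l' \<rho>' \<omega>' Xt (assoc_map f \<circ> h) e r'"
  shows "\<exists>r. darboux_lie_value F P N l \<rho> \<omega> Xt h e r"
proof -
  interpret group G by (rule src.G_group)
  let ?F = "fb_obj F M"
  let ?u = "canonical_lift F M (base_field P Xt) e"
  let ?m = "mdim M"
  note Fb' = manifold_charted[OF Fb]
  obtain v' p' \<gamma>' where 1: "?u \<in> tangent_space ?F e"
    "assoc_field_value P N' l' Xt (assoc_map f (h e)) v'" "p' \<in> points E" "curve_germ N' \<gamma>'"
    "tgt.cls p' (\<gamma>' 0) = assoc_map f (h e)"
    "(\<lambda>\<phi>. tmap tgt.A (assoc_map f \<circ> h) e ?u \<phi> - v' \<phi>) = velocity tgt.A (\<lambda>t. tgt.cls p' (\<gamma>' t)) 0"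
    using r' unfolding darboux_lie_value_def by auto
  obtain \<beta> where \<beta>: "curve_germ ?F \<beta>" "\<beta> 0 = e" "?u = velocity ?F \<beta> 0"
    using 1(1) unfolding tangent_space_def by blast
  obtain q y' I c where 2: "q \<in> points E" "y' \<in> points N'" "assoc_map f (h e) = tgt.cls q y'"
      "integral_curve E Xt I c" "c 0 = q" "v' = velocity tgt.A (\<lambda>t. tgt.cls (c t) y') 0"
    using 1(2) unfolding assoc_field_value_def by blast
  note cg = src.integral_curve_germ[OF 2(4)]
  have eF: "e \<in> points ?F" using curve_germ_points[OF \<beta>(1)] \<beta>(2) by simp
  have heA: "h e \<in> points src.A" using smooth_map_in_points[OF h eF] .
  then obtain p0 y0 where 3: "p0 \<in> points E" "y0 \<in> points N" "h e = src.cls p0 y0"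
    unfolding src.points_assoc by (rule src.assoc_spaceE)
  \<comment> \<open>The only integral curve at hand starts at \<open>q\<close>, so
    \<open>h e\<close> needs a representative over \<open>q\<close>. Both \<open>p0\<close> and
    \<open>q\<close> occur in the class \<open>assoc_map f (h e)\<close>, hence they differ by a
    group element, and \<open>y0\<close> is shifted along.\<close>
  have "tgt.cls p0 (f y0) = tgt.cls q y'" using 2(3) 3 assoc_map_cls by simp
  from tgt.cls_eqD[OF 2(1,2) this]
  obtain a where a: "a \<in> carrier G" "q = pb_act P p0 a" by metis
  define y where "y = l (inv\<^bsub>G\<^esub> a) y0"
  have y: "y \<in> points N" unfolding y_def using a(1) 3(2) by (intro src.l_closed) auto
  have z: "h e = src.cls q y" unfolding y_def a(2) 3(3) by (rule src.cls_act[symmetric]) (use 3 a in auto)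

  obtain U \<psi> where t: "pb_proj P q \<in> U" "equivariant_triv P U \<psi>"
    using src.triv_exists src.proj_closed 2(1) by metis
  let ?g = "snd (\<psi> q)"
  have g: "?g \<in> carrier G" "inv\<^bsub>G\<^esub> ?g \<in> carrier G" using src.triv_closed[OF t(2) 2(1) t(1)] by auto
  define n0 where "n0 = l ?g y"
  have n0: "n0 \<in> points N" unfolding n0_def by (rule src.l_closed[OF g(1) y])
  obtain V ch where ch: "(V, ch) \<in> atlas M" "pb_proj P q \<in> V"
    using charted_chart[OF src.charteds(2) src.proj_closed[OF 2(1)]] by blast
  obtain W d where d: "(W, d) \<in> atlas N" "n0 \<in> W" using charted_chart[OF src.charted_N n0] by blast
  let ?D = "src.chart_dom U \<psi> V W" and ?k = "src.chart_map \<psi> ch d"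
  have k: "(?D, ?k) \<in> atlas src.A" unfolding src.atlas_assoc using t(2) ch(1) d(1) by blast
  have zD: "h e \<in> ?D" unfolding z src.mem_chart_dom[OF t(2) 2(1) y] using t(1) ch(2) d(2) by (simp add: n0_def)

  define \<gamma>1 where "\<gamma>1 s = h (\<beta> s)" for s
  define \<gamma>2 where "\<gamma>2 s = src.cls (c s) y" for s
  have \<gamma>1: "curve_germ src.A \<gamma>1" "\<gamma>1 0 = h e"
    unfolding \<gamma>1_def using curve_germ_compose'[OF Fb' src.charted_assoc \<beta>(1) h] \<beta>(2) by auto
  have \<gamma>2: "curve_germ src.A \<gamma>2" "\<gamma>2 0 = h e"
    unfolding \<gamma>2_def using curve_germ_compose'[OF src.charteds(1) src.charted_assoc cg src.cls_smooth_left[OF y]] 2(5) z by auto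
  \<comment> \<open>The fiber coordinates of the difference of the two velocities; they occupy the
    indices from \<open>?m\<close> on in the bundle chart. The value 0 beyond \<open>mdim N\<close>
    puts \<open>w\<close> into the model space.\<close>
  define w where "w i = (if i < mdim N then
      deriv (\<lambda>s. ?k (\<gamma>1 s) (?m + i)) 0 - deriv (\<lambda>s. ?k (\<gamma>2 s) (?m + i)) 0 else 0)" for i
  have "w \<in> espace (mdim N)" by (simp add: w_def mem_espace)
  then obtain \<eta> where \<eta>: "curve_germ N \<eta>" "\<eta> 0 = n0" "\<forall>\<^sub>F s in nhds 0. d (\<eta> s) = (\<lambda>i. d n0 i + s * w i)"
    by (rule smooth_chart_line[OF src.N d])
  \<comment> \<open>Translating by the inverse of \<open>?g\<close> makes the fiber coordinate of
    \<open>[q, \<gamma> s]\<close> in the trivialization equal to the chart line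
    \<open>\<eta> s\<close>.\<close>
  define \<gamma> where "\<gamma> s = l (inv\<^bsub>G\<^esub> ?g) (\<eta> s)" for s
  define \<gamma>3 where "\<gamma>3 s = src.cls q (\<gamma> s)" for s
  have \<gamma>: "curve_germ N \<gamma>"
    unfolding \<gamma>_def by (rule curve_germ_compose'[OF src.charted_N src.charted_N \<eta>(1) src.l_smooth[OF g(2)]])
  have "\<gamma> 0 = y" by (simp add: \<gamma>_def \<eta>(2) n0_def src.left_inverse g y)
  then have \<gamma>3: "curve_germ src.A \<gamma>3" "\<gamma>3 0 = h e"
    unfolding \<gamma>3_def using curve_germ_compose'[OF src.charted_N src.charted_assoc \<gamma> src.cls_smooth_right[OF 2(1)]] z by auto

  have k_cls: "?k (src.cls p n) = coord_join ?m (ch (pb_proj P p)) (d (l (snd (\<psi> p)) n))"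
    if "p \<in> points E" "pb_proj P p \<in> U" "n \<in> points N" for p n
    by (rule src.chart_map_cls[OF t(2) that])
  have k3: "\<forall>\<^sub>F s in nhds 0. ?k (\<gamma>3 s) = coord_join ?m (ch (pb_proj P q)) (\<lambda>i. d n0 i + s * w i)"
    using \<eta>(3) src.curve_germ_points_ev[OF src.charted_N \<eta>(1)]
    by eventually_elim
      (simp add: \<gamma>3_def \<gamma>_def k_cls[OF 2(1) t(1)] src.l_closed src.left_inverse g)
  \<comment> \<open>The first \<open>?m\<close> coordinates of a class depend on its base point
    only, so they can be computed in the target bundle as well.\<close>
  have k_base: "?k z j = ch (assoc_proj P z) j" if zU: "z \<in> ?D" and j: "j < ?m" for z j
  proof -
    obtain p n where "p \<in> points E" "pb_proj P p \<in> U" "n \<in> points N" "z = src.cls p n"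
      using zU unfolding src.chart_dom_def by blast
    then show ?thesis using k_cls j by (simp add: coord_join_def src.assoc_proj_class)
  qed
  have ev1: "\<forall>\<^sub>F s in nhds 0. \<gamma>1 s \<in> ?D" and ev2: "\<forall>\<^sub>F s in nhds 0. \<gamma>2 s \<in> ?D"
    using curve_germ_eventually[OF src.charted_assoc _ chartedD(1)[OF src.charted_assoc k]] \<gamma>1 \<gamma>2 zD by auto
  have evA: "\<forall>\<^sub>F s in nhds 0. \<gamma>1 s \<in> points src.A"
    by (rule src.curve_germ_points_ev[OF src.charted_assoc \<gamma>1(1)])
  have evE: "\<forall>\<^sub>F s in nhds 0. c s \<in> points E" by (rule src.curve_germ_points_ev[OF src.charteds(1) cg])

  \<comment> \<open>The hypothesis for the composite is evaluated at the base coordinate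
    \<open>\<phi>\<close> of the target bundle. As \<open>assoc_map f\<close> preserves base points,
    \<open>\<phi>\<close> gives the same derivatives as coordinate \<open>j\<close> along
    \<open>\<gamma>1\<close> and \<open>\<gamma>2\<close>.\<close>
  have base: "deriv (\<lambda>s. ?k (\<gamma>1 s) j) 0 = deriv (\<lambda>s. ?k (\<gamma>2 s) j) 0" if j: "j < ?m" for j
  proof -
    define \<phi> where "\<phi> z = ch (assoc_proj P z) j" for z :: "('p \<times> 'k) set"
    have "smooth_near M (assoc_proj P (assoc_map f (h e))) (\<lambda>x. ch x j)"
      unfolding smooth_near_def 2(3) src.assoc_proj_class[OF 2(1)]
      using smooth_map_chart[OF src.manifolds(2) ch(1) j] chartedD(1)[OF src.charteds(2) ch(1)] ch(2) by blast
    moreover have fhe: "assoc_map f (h e) \<in> points tgt.A" by (rule smooth_map_in_points[OF assoc_map_smooth heA])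
    ultimately have \<phi>: "smooth_near tgt.A (assoc_map f (h e)) \<phi>"
      using smooth_near_compose'[OF tgt.charted_assoc src.charteds(2) _ tgt.assoc_proj_smooth, of "assoc_map f (h e)" "\<lambda>x. ch x j"]
      by (simp add: o_def \<phi>_def[abs_def])
    have "smooth_map ?F tgt.A (assoc_map f \<circ> h)"
      by (rule smooth_map_compose[OF Fb' src.charted_assoc tgt.charted_assoc h assoc_map_smooth])
    then have "smooth_near ?F e (\<phi> \<circ> (assoc_map f \<circ> h))"
      using smooth_near_compose'[OF Fb' tgt.charted_assoc eF] \<phi> by simp
    then have L: "tmap tgt.A (assoc_map f \<circ> h) e ?u \<phi> = deriv (\<lambda>s. \<phi> (assoc_map f (\<gamma>1 s))) 0"
      using \<phi> \<beta>(2) unfolding \<beta>(3) by (simp add: tmap_def velocity_def \<gamma>1_def)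
    have "\<forall>\<^sub>F s in nhds 0. \<phi> (assoc_map f (\<gamma>1 s)) = ?k (\<gamma>1 s) j"
      using ev1 evA by eventually_elim (simp add: \<phi>_def assoc_proj_map k_base j)
    with L have L: "tmap tgt.A (assoc_map f \<circ> h) e ?u \<phi> = deriv (\<lambda>s. ?k (\<gamma>1 s) j) 0"
      using deriv_cong_ev by metis
    have "v' \<phi> = deriv (\<lambda>s. \<phi> (tgt.cls (c s) y')) 0"
      using \<phi> unfolding 2(6) velocity_def 2(5) 2(3)[symmetric] by simp
    also have "\<dots> = deriv (\<lambda>s. ?k (\<gamma>2 s) j) 0"
    proof (rule deriv_cong_ev[OF _ refl])
      show "\<forall>\<^sub>F s in nhds 0. \<phi> (tgt.cls (c s) y') = ?k (\<gamma>2 s) j"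
        using ev2 evE
        by eventually_elim (simp add: \<phi>_def src.assoc_proj_class k_base j \<gamma>2_def)
    qed
    finally have R: "v' \<phi> = deriv (\<lambda>s. ?k (\<gamma>2 s) j) 0" .
    \<comment> \<open>The curve stays in the fiber through \<open>p'\<close>, so the base coordinate
      is constant along it.\<close>
    have "velocity tgt.A (\<lambda>t. tgt.cls p' (\<gamma>' t)) 0 \<phi> = 0"
      by (simp add: velocity_def \<phi>_def src.assoc_proj_class[OF 1(3)])
    then show ?thesis using fun_cong[OF 1(6), of \<phi>] L R by simp
  qed
  \<comment> \<open>Base coordinates: the curve \<open>\<gamma>3\<close> stays in one fiber and the
    difference vanishes by \<open>base\<close>. Fiber coordinates: the slope \<open>w\<close> was
    chosen to be the difference.\<close>
  have D: "deriv (\<lambda>s. ?k (\<gamma>3 s) j) 0 = deriv (\<lambda>s. ?k (\<gamma>1 s) j) 0 - deriv (\<lambda>s. ?k (\<gamma>2 s) j) 0"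
    if j: "j < mdim src.A" for j
  proof (cases "j < ?m")
    case True
    have "\<forall>\<^sub>F s in nhds 0. ?k (\<gamma>3 s) j = ch (pb_proj P q) j"
      using k3 by eventually_elim (simp add: coord_join_def True)
    then have "deriv (\<lambda>s. ?k (\<gamma>3 s) j) 0 = deriv (\<lambda>s. ch (pb_proj P q) j) (0::real)"
      by (intro deriv_cong_ev) auto
    then show ?thesis using base[OF True] by simp
  next
    case False
    let ?i = "j - ?m"
    have i: "?i < mdim N" "?m + ?i = j" using False j by (auto simp: src.assoc_simps)
    have "\<forall>\<^sub>F s in nhds 0. ?k (\<gamma>3 s) j = d n0 ?i + s * w ?i"
      using k3 by eventually_elim (simp add: coord_join_def False)
    then have "deriv (\<lambda>s. ?k (\<gamma>3 s) j) 0 = deriv (\<lambda>s. d n0 ?i + s * w ?i) 0"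
      by (intro deriv_cong_ev) auto
    also have "\<dots> = w ?i"
      by (rule DERIV_imp_deriv) (auto intro!: derivative_eq_intros)
    finally show ?thesis using i by (simp add: w_def)
  qed
  have "(\<lambda>\<phi>. velocity src.A \<gamma>1 0 \<phi> - velocity src.A \<gamma>2 0 \<phi>) = velocity src.A \<gamma>3 0"
    by (rule velocity_diff_in_chart[OF src.charted_assoc k zD \<gamma>1(1) \<gamma>2(1) \<gamma>3(1) \<gamma>1(2) \<gamma>2(2) \<gamma>3(2) D])
  moreover have "tmap src.A h e ?u = velocity src.A \<gamma>1 0"
    using tmap_velocity'[OF Fb' src.charted_assoc _ h, of \<beta> 0] eF \<beta>(2) unfolding \<beta>(3) \<gamma>1_def by simp
  ultimately have "(\<lambda>\<phi>. tmap src.A h e ?u \<phi> - velocity src.A \<gamma>2 0 \<phi>) = velocity src.A (\<lambda>t. src.cls q (\<gamma> t)) 0"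
    by (simp add: \<gamma>3_def[abs_def])
  moreover have "assoc_field_value P N l Xt (h e) (velocity src.A \<gamma>2 0)"
    unfolding assoc_field_value_def \<gamma>2_def[abs_def] using 2(1,4,5) y z by blast
  moreover have "src.cls q (\<gamma> 0) = h e" using \<gamma>3(2) by (simp add: \<gamma>3_def)
  ultimately show ?thesis
    unfolding darboux_lie_value_def using 1(1) 2(1) \<gamma> by blast
qed

text \<open>Uniqueness is needed on the target side alone: every value for \<open>h\<close> is also
  a value for the composite by \<open>darboux_lie_value_map\<close>, so uniqueness for
  \<open>h\<close> is inherited.\<close>

lemma darboux_lie_postcompose:
  assumes Fb: "manifold (fb_obj F M)" and h: "smooth_map (fb_obj F M) src.A h"
    and X: "invariant_vector_field P Xt"
    and V: "g_module G V \<rho>" and \<omega>: "one_form N' V \<omega>" "equivariant_form G N' l' \<rho> \<omega>"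
  shows "darboux_lie F P N' l' \<rho> \<omega> Xt (assoc_map f \<circ> h) e =
    darboux_lie F P N l \<rho> (pullback_form N' f \<omega>) Xt h e"
proof (cases "\<exists>r. darboux_lie_value F P N l \<rho> (pullback_form N' f \<omega>) Xt h e r")
  case True
  then obtain r where r: "darboux_lie_value F P N l \<rho> (pullback_form N' f \<omega>) Xt h e r" ..
  note r' = darboux_lie_value_map[OF r]
  note unique = tgt.darboux_lie_value_unique[OF X V \<omega> _ r']
  have "(THE r. darboux_lie_value F P N l \<rho> (pullback_form N' f \<omega>) Xt h e r) = r"
    by (rule the_equality, rule r) (rule unique[OF darboux_lie_value_map])
  moreover have "(THE r. darboux_lie_value F P N' l' \<rho> \<omega> Xt (assoc_map f \<circ> h) e r) = r"
    by (rule the_equality, rule r') (rule unique)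
  ultimately show ?thesis by (simp add: darboux_lie_eq_The)
next
  \<comment> \<open>Both descriptions then range over the everywhere false predicate and denote the
    same unspecified value.\<close>
  case False
  then have "darboux_lie_value F P N l \<rho> (pullback_form N' f \<omega>) Xt h e = (\<lambda>_. False)"
    by blast
  moreover have "darboux_lie_value F P N' l' \<rho> \<omega> Xt (assoc_map f \<circ> h) e = (\<lambda>_. False)"
    using darboux_lie_value_reflect[OF Fb h] False by blast
  ultimately show ?thesis by (simp add: darboux_lie_eq_The)
qed

end

theorem mainTheorem10:
  fixes F :: "('m, 'f) bundle_functor"
    and M :: "'m mfd"
    and P :: "('p, 'm, 'g) principal_bundle"
    and N :: "'n mfd" and N' :: "'k mfd"
    and l :: "'g \<Rightarrow> 'n \<Rightarrow> 'n" and l' :: "'g \<Rightarrow> 'k \<Rightarrow> 'k"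
    and f :: "'n \<Rightarrow> 'k"
    and V' :: "'v::euclidean_space set" and \<rho>' :: "'g \<Rightarrow> 'v \<Rightarrow> 'v"
    and \<omega>' :: "'k \<Rightarrow> 'k tvec \<Rightarrow> 'v"
    and h :: "'f \<Rightarrow> ('p \<times> 'n) set"
    and Xt :: "'p \<Rightarrow> 'p tvec"
    and n :: nat
  assumes "natural_bundle n F"
    and "manifold M" and "mdim M = n"
    and "is_principal_bundle P" and "pb_base P = M"
    and "manifold N" and "left_action (pb_group P) N l"
    and "manifold N'" and "left_action (pb_group P) N' l'"
    and "smooth_map N N' f"
    and "\<forall>a\<in>carrier (pb_group P). \<forall>y\<in>points N. f (l a y) = l' a (f y)"
    and "g_module (pb_group P) V' \<rho>'"
    and "one_form N' V' \<omega>'" and "equivariant_form (pb_group P) N' l' \<rho>' \<omega>'"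
    and "smooth_map (fb_obj F M) (assoc_mfd P N l) h"
    and "\<forall>e\<in>points (fb_obj F M). assoc_proj P (h e) = fb_proj F M e"
    and "invariant_vector_field P Xt"
  shows "\<forall>e\<in>points (fb_obj F M).
    darboux_lie F P N' l' \<rho>' \<omega>' Xt (assoc_map f \<circ> h) e =
    darboux_lie F P N l \<rho>' (pullback_form N' f \<omega>') Xt h e"
proof
  fix e
  interpret associated_map P N l N' l' f
    using assms by unfold_locales auto
  have "manifold (fb_obj F M)"
    using assms(1-3,5) unfolding natural_bundle_def fiber_bundle_def Mf_def by auto
  then show "darboux_lie F P N' l' \<rho>' \<omega>' Xt (assoc_map f \<circ> h) e =
      darboux_lie F P N l \<rho>' (pullback_form N' f \<omega>') Xt h e"
    using assms by (intro darboux_lie_postcompose[where V = V']) auto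
qed

end
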